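(* Suppose the $3$-form $\varphi$ defines a torsion-free $G_2$-structure $(\varphi,g)$ on a $7$-manifold, and let $v$ be a vector field. Then the deformation $\varphi_{bcd}\to\tilde\varphi_{bcd}=\varphi_{bcd}+v^e\psi_{bcde}$, which lies in $\Lambda^3_7$, results in a new torsion-free $G_2$-structure $\tilde\varphi$ if and only if $\nabla v=0$.
   Context: A $3$-form on a $7$-manifold is positive if at each point it lies in the $GL(7,\mathbb R)$-orbit of $\varphi_0=e^{123}+e^{145}+e^{167}+e^{246}-e^{257}-e^{347}-e^{356}$. A positive $3$-form $\varphi$ determines a Riemannian metric $g$ and volume form by $g(u,w)\,\mathrm{vol}=\frac16(u\lrcorner\varphi)\wedge(w\lrcorner\varphi)\wedge\varphi$; the pair $(\varphi,g)$ is a $G_2$-structure. $\psi=*\varphi$ and $\nabla$ is the Levi-Civita connection of $g$. The full torsion tensor $T_{ab}$ is defined by $\nabla_a\varphi_{bcd}=T_a{}^e\psi_{ebcd}$; the structure is torsion-free if $T=0$, i.e. $\nabla\varphi=0$. $\Lambda^3_7=\{\alpha\lrcorner\psi\}$ for $1$-forms $\alpha$. For every vector field $v$ the form $\tilde\varphi$ is positive; its torsion is taken with respect to its own metric $\tilde g$. *)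

theory Defs
  imports "HOL-Analysis.Analysis"
begin

section \<open>Smooth manifolds and tensor fields in charts\<close>

text \<open>On an open set, being \<open>k\<close> times continuously differentiable is expressed
  through iterated directional derivatives.\<close>

primrec ck_on ::
    "nat \<Rightarrow> 'b::euclidean_space set \<Rightarrow> ('b \<Rightarrow> 'c::real_normed_vector) \<Rightarrow> bool" where
  "ck_on 0 S f \<longleftrightarrow> continuous_on S f"
| "ck_on (Suc k) S f \<longleftrightarrow> (\<forall>x\<in>S. f differentiable (at x)) \<and>
     (\<forall>u. ck_on k S (\<lambda>x. frechet_derivative f (at x) u))"

definition smooth_on ::
    "'b::euclidean_space set \<Rightarrow> ('b \<Rightarrow> 'c::real_normed_vector) \<Rightarrow> bool" where
  "smooth_on S f \<longleftrightarrow> (\<forall>k. ck_on k S f)"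

text \<open>A chart is a coordinate domain together with its coordinate map.\<close>

type_synonym ('a, 'n) chart = "'a set \<times> ('a \<Rightarrow> real^'n)"

definition coords :: "('a, 'n::finite) chart \<Rightarrow> (real^'n) set" where
  "coords c = snd c ` fst c"

definition is_chart :: "'a topology \<Rightarrow> ('a, 'n::finite) chart \<Rightarrow> bool" where
  "is_chart X c \<longleftrightarrow> openin X (fst c) \<and> open (coords c) \<and>
     homeomorphic_map (subtopology X (fst c)) (top_of_set (coords c)) (snd c)"

definition overlap :: "('a, 'n::finite) chart \<Rightarrow> ('a, 'n) chart \<Rightarrow> (real^'n) set" where
  "overlap c d = snd c ` (fst c \<inter> fst d)"

definition transition :: "('a, 'n::finite) chart \<Rightarrow> ('a, 'n) chart \<Rightarrow> real^'n \<Rightarrow> real^'n" where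
  "transition c d x = snd d (inv_into (fst c) (snd c) x)"

text \<open>The atlas need not be maximal: tensor fields on a smooth atlas extend uniquely to
  the maximal atlas containing it.\<close>

definition smooth_manifold :: "'a topology \<Rightarrow> ('a, 'n::finite) chart set \<Rightarrow> bool" where
  "smooth_manifold X A \<longleftrightarrow> Hausdorff_space X \<and> second_countable X \<and>
     (\<forall>c\<in>A. is_chart X c) \<and> (\<Union>c\<in>A. fst c) = topspace X \<and>
     (\<forall>c\<in>A. \<forall>d\<in>A. smooth_on (overlap c d) (transition c d))"

text \<open>A tensor field is the family of its components in the charts of the atlas, each a
  function of the coordinates, subject to the tensor transformation law; values outside
  \<^term>\<open>coords c\<close> are irrelevant. In the laws below \<open>jacobian (transition c d) (at x) $ i $ a\<close>
  is the derivative of the \<open>i\<close>-th coordinate of \<open>d\<close> in the direction of the \<open>a\<close>-th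
  coordinate of \<open>c\<close>.\<close>

type_synonym ('a, 'n) vfield = "('a, 'n) chart \<Rightarrow> real^'n \<Rightarrow> 'n \<Rightarrow> real"
type_synonym ('a, 'n) field1 = "('a, 'n) chart \<Rightarrow> real^'n \<Rightarrow> 'n \<Rightarrow> real"
type_synonym ('a, 'n) field2 = "('a, 'n) chart \<Rightarrow> real^'n \<Rightarrow> 'n \<Rightarrow> 'n \<Rightarrow> real"
type_synonym ('a, 'n) field3 = "('a, 'n) chart \<Rightarrow> real^'n \<Rightarrow> 'n \<Rightarrow> 'n \<Rightarrow> 'n \<Rightarrow> real"

definition vector_field :: "('a, 'n::finite) chart set \<Rightarrow> ('a, 'n) vfield \<Rightarrow> bool" where
  "vector_field A v \<longleftrightarrow>
     (\<forall>c\<in>A. \<forall>a. smooth_on (coords c) (\<lambda>x. v c x a)) \<and>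
     (\<forall>c\<in>A. \<forall>d\<in>A. \<forall>x\<in>overlap c d. \<forall>i.
        v d (transition c d x) i =
          (\<Sum>a\<in>UNIV. jacobian (transition c d) (at x) $ i $ a * v c x a))"

definition one_form :: "('a, 'n::finite) chart set \<Rightarrow> ('a, 'n) field1 \<Rightarrow> bool" where
  "one_form A \<alpha> \<longleftrightarrow>
     (\<forall>c\<in>A. \<forall>a. smooth_on (coords c) (\<lambda>x. \<alpha> c x a)) \<and>
     (\<forall>c\<in>A. \<forall>d\<in>A. \<forall>x\<in>overlap c d. \<forall>a.
        \<alpha> c x a =
          (\<Sum>i\<in>UNIV. jacobian (transition c d) (at x) $ i $ a * \<alpha> d (transition c d x) i))"

definition three_form :: "('a, 'n::finite) chart set \<Rightarrow> ('a, 'n) field3 \<Rightarrow> bool" where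
  "three_form A \<phi> \<longleftrightarrow>
     (\<forall>c\<in>A. \<forall>a b e. smooth_on (coords c) (\<lambda>x. \<phi> c x a b e)) \<and>
     (\<forall>c\<in>A. \<forall>x\<in>coords c. \<forall>a b e.
        \<phi> c x b a e = - \<phi> c x a b e \<and> \<phi> c x a e b = - \<phi> c x a b e) \<and>
     (\<forall>c\<in>A. \<forall>d\<in>A. \<forall>x\<in>overlap c d. \<forall>a b e.
        \<phi> c x a b e =
          (\<Sum>i\<in>UNIV. \<Sum>j\<in>UNIV. \<Sum>k\<in>UNIV.
             jacobian (transition c d) (at x) $ i $ a *
             jacobian (transition c d) (at x) $ j $ b *
             jacobian (transition c d) (at x) $ k $ e * \<phi> d (transition c d x) i j k))"

section \<open>The Levi-Civita connection in coordinates\<close>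

definition partial :: "'n \<Rightarrow> (real^'n \<Rightarrow> real) \<Rightarrow> real^'n \<Rightarrow> real" where
  "partial a f x = frechet_derivative f (at x) (axis a 1)"

text \<open>The connection coefficients of the Levi-Civita connection of \<open>g\<close>;
  \<open>christoffel g x c a b\<close> is the component with upper index \<open>c\<close> and lower indices
  \<open>a\<close>, \<open>b\<close>.\<close>

definition christoffel :: "(real^'n \<Rightarrow> real^'n^'n) \<Rightarrow> real^'n \<Rightarrow> 'n \<Rightarrow> 'n \<Rightarrow> 'n::finite \<Rightarrow> real" where
  "christoffel g x c a b = (\<Sum>d\<in>UNIV. matrix_inv (g x) $ c $ d / 2 *
     (partial a (\<lambda>y. g y $ b $ d) x + partial b (\<lambda>y. g y $ a $ d) x
        - partial d (\<lambda>y. g y $ a $ b) x))"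

text \<open>The first index argument of a covariant derivative is the direction of
  differentiation.\<close>

definition nabla_vector ::
    "(real^'n \<Rightarrow> real^'n^'n) \<Rightarrow> (real^'n \<Rightarrow> 'n \<Rightarrow> real) \<Rightarrow> real^'n \<Rightarrow> 'n \<Rightarrow> 'n::finite \<Rightarrow> real" where
  "nabla_vector g v x a b =
     partial a (\<lambda>y. v y b) x + (\<Sum>c\<in>UNIV. christoffel g x b a c * v x c)"

definition nabla_three ::
    "(real^'n \<Rightarrow> real^'n^'n) \<Rightarrow> (real^'n \<Rightarrow> 'n \<Rightarrow> 'n \<Rightarrow> 'n \<Rightarrow> real) \<Rightarrow>
     real^'n \<Rightarrow> 'n \<Rightarrow> 'n \<Rightarrow> 'n \<Rightarrow> 'n::finite \<Rightarrow> real" where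
  "nabla_three g \<phi> x a b c d =
     partial a (\<lambda>y. \<phi> y b c d) x
     - (\<Sum>e\<in>UNIV. christoffel g x e a b * \<phi> x e c d)
     - (\<Sum>e\<in>UNIV. christoffel g x e a c * \<phi> x b e d)
     - (\<Sum>e\<in>UNIV. christoffel g x e a d * \<phi> x b c e)"

section \<open>Positive three-forms on a seven-dimensional vector space\<close>

text \<open>Indices live in the seven-element type \<^typ>\<open>7\<close>; its elements are \<open>1, \<dots>, 6\<close> and
  \<open>7 = 0\<close>, so \<open>1, \<dots>, 7\<close> are seven distinct labels.\<close>

type_synonym form3 = "7 \<Rightarrow> 7 \<Rightarrow> 7 \<Rightarrow> real"
type_synonym form4 = "7 \<Rightarrow> 7 \<Rightarrow> 7 \<Rightarrow> 7 \<Rightarrow> real"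

text \<open>The component with indices \<open>a\<close>, \<open>b\<close>, \<open>c\<close> of the wedge product of the three
  basis covectors with labels \<open>i\<close>, \<open>j\<close>, \<open>k\<close>.\<close>

definition delta :: "7 \<Rightarrow> 7 \<Rightarrow> real" where
  "delta i a = (if i = a then 1 else 0)"

definition basis3 :: "7 \<Rightarrow> 7 \<Rightarrow> 7 \<Rightarrow> form3" where
  "basis3 i j k a b c =
     delta i a * delta j b * delta k c + delta i b * delta j c * delta k a
     + delta i c * delta j a * delta k b - delta i a * delta j c * delta k b
     - delta i b * delta j a * delta k c - delta i c * delta j b * delta k a"

definition phi0 :: form3 where
  "phi0 a b c =
     basis3 1 2 3 a b c + basis3 1 4 5 a b c + basis3 1 6 7 a b c + basis3 2 4 6 a b c
     - basis3 2 5 7 a b c - basis3 3 4 7 a b c - basis3 3 5 6 a b c"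

definition positive3 :: "form3 \<Rightarrow> bool" where
  "positive3 p \<longleftrightarrow> (\<exists>P :: real^7^7. invertible P \<and>
     (\<forall>a b c. p a b c =
        (\<Sum>i\<in>UNIV. \<Sum>j\<in>UNIV. \<Sum>k\<in>UNIV. P $ i $ a * P $ j $ b * P $ k $ c * phi0 i j k)))"

definition levi_civita_symbol :: "7 \<Rightarrow> 7 \<Rightarrow> 7 \<Rightarrow> 7 \<Rightarrow> 7 \<Rightarrow> 7 \<Rightarrow> 7 \<Rightarrow> real" where
  "levi_civita_symbol a b c d e f h =
     (let s = (\<lambda>k::7. if k = 1 then a else if k = 2 then b else if k = 3 then c
                else if k = 4 then d else if k = 5 then e else if k = 6 then f else h)
      in if bij s then of_int (sign s) else 0)"

text \<open>The coefficient of the top form \<open>\<alpha> \<and> \<beta> \<and> \<gamma>\<close>, for two two-forms and a three-form, with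
  respect to the wedge product of the basis covectors \<open>1, \<dots>, 7\<close>. The normalisation is
  \<open>2! 2! 3! = 24\<close>.\<close>

definition wedge223 :: "(7 \<Rightarrow> 7 \<Rightarrow> real) \<Rightarrow> (7 \<Rightarrow> 7 \<Rightarrow> real) \<Rightarrow> form3 \<Rightarrow> real" where
  "wedge223 \<alpha> \<beta> \<gamma> =
     (\<Sum>a\<in>UNIV. \<Sum>b\<in>UNIV. \<Sum>c\<in>UNIV. \<Sum>d\<in>UNIV. \<Sum>e\<in>UNIV. \<Sum>f\<in>UNIV. \<Sum>h\<in>UNIV.
        levi_civita_symbol a b c d e f h * \<alpha> a b * \<beta> c d * \<gamma> e f h) / 24"

text \<open>\<open>g\<close> is an inner product, \<open>w\<close> is the coefficient of a volume form of \<open>g\<close> (for one of the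
  two orientations), and \<open>g(u,w) vol = (1/6) (u \<lrcorner> p) \<and> (w \<lrcorner> p) \<and> p\<close> on basis vectors. For
  positive \<open>p\<close> exactly one pair \<open>(g, w)\<close> satisfies this.\<close>

definition induces :: "form3 \<Rightarrow> real^7^7 \<Rightarrow> real \<Rightarrow> bool" where
  "induces p g w \<longleftrightarrow>
     transpose g = g \<and> (\<forall>u. u \<noteq> 0 \<longrightarrow> u \<bullet> (g *v u) > 0) \<and> w\<^sup>2 = det g \<and>
     (\<forall>i j. g $ i $ j * w = wedge223 (p i) (p j) p / 6)"

definition metric_vol :: "form3 \<Rightarrow> (real^7^7) \<times> real" where
  "metric_vol p = (THE (g, w). induces p g w)"

definition metric :: "form3 \<Rightarrow> real^7^7" where
  "metric p = fst (metric_vol p)"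

definition vol :: "form3 \<Rightarrow> real" where
  "vol p = snd (metric_vol p)"

text \<open>The Hodge dual of \<open>p\<close> for its own metric and volume form:
  \<open>\<psi>\<^sub>a\<^sub>b\<^sub>c\<^sub>d = (1/3!) p\<^sup>i\<^sup>j\<^sup>k vol\<^sub>i\<^sub>j\<^sub>k\<^sub>a\<^sub>b\<^sub>c\<^sub>d\<close>, with the indices of \<open>p\<close> raised by the inverse metric.\<close>

definition raise3 :: "real^7^7 \<Rightarrow> form3 \<Rightarrow> form3" where
  "raise3 g p i j k =
     (\<Sum>l\<in>UNIV. \<Sum>m\<in>UNIV. \<Sum>n\<in>UNIV.
        matrix_inv g $ i $ l * matrix_inv g $ j $ m * matrix_inv g $ k $ n * p l m n)"

definition hodge :: "form3 \<Rightarrow> form4" where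
  "hodge p a b c d =
     (\<Sum>i\<in>UNIV. \<Sum>j\<in>UNIV. \<Sum>k\<in>UNIV.
        raise3 (metric p) p i j k * (vol p * levi_civita_symbol i j k a b c d)) / 6"

section \<open>G2-structures\<close>

definition G2_structure :: "('a, 7) chart set \<Rightarrow> ('a, 7) field3 \<Rightarrow> bool" where
  "G2_structure A \<phi> \<longleftrightarrow> three_form A \<phi> \<and> (\<forall>c\<in>A. \<forall>x\<in>coords c. positive3 (\<phi> c x))"

definition g2_metric :: "('a, 7) field3 \<Rightarrow> ('a, 7) chart \<Rightarrow> real^7 \<Rightarrow> real^7^7" where
  "g2_metric \<phi> c x = metric (\<phi> c x)"

definition psi :: "('a, 7) field3 \<Rightarrow> ('a, 7) chart \<Rightarrow> real^7 \<Rightarrow> form4" where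
  "psi \<phi> c x = hodge (\<phi> c x)"

text \<open>\<open>T\<close> is the full torsion tensor: \<open>\<nabla>\<^sub>a \<phi>\<^sub>b\<^sub>c\<^sub>d = T\<^sub>a\<^sup>e \<psi>\<^sub>e\<^sub>b\<^sub>c\<^sub>d\<close>. This
  equation determines \<open>T\<close> on the coordinate domains.\<close>

definition full_torsion :: "('a, 7) chart set \<Rightarrow> ('a, 7) field3 \<Rightarrow> ('a, 7) field2 \<Rightarrow> bool" where
  "full_torsion A \<phi> T \<longleftrightarrow>
     (\<forall>c\<in>A. \<forall>x\<in>coords c. \<forall>a b i j.
        nabla_three (g2_metric \<phi> c) (\<phi> c) x a b i j =
          (\<Sum>e\<in>UNIV. (\<Sum>f\<in>UNIV. T c x a f * matrix_inv (g2_metric \<phi> c x) $ f $ e)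
             * psi \<phi> c x e b i j))"

definition torsion_free_G2 :: "('a, 7) chart set \<Rightarrow> ('a, 7) field3 \<Rightarrow> bool" where
  "torsion_free_G2 A \<phi> \<longleftrightarrow> G2_structure A \<phi> \<and> full_torsion A \<phi> (\<lambda>c x a b. 0)"

text \<open>Sections of the bundle of three-forms \<open>\<alpha> \<lrcorner> \<psi>\<close>.\<close>

definition Lambda37 :: "('a, 7) chart set \<Rightarrow> ('a, 7) field3 \<Rightarrow> ('a, 7) field3 set" where
  "Lambda37 A \<phi> = {\<eta>. \<exists>\<alpha>. one_form A \<alpha> \<and>
     (\<forall>c\<in>A. \<forall>x\<in>coords c. \<forall>b i j.
        \<eta> c x b i j =
          (\<Sum>e\<in>UNIV. (\<Sum>f\<in>UNIV. matrix_inv (g2_metric \<phi> c x) $ e $ f * \<alpha> c x f)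
             * psi \<phi> c x e b i j))}"

definition deformation :: "('a, 7) field3 \<Rightarrow> ('a, 7) vfield \<Rightarrow> ('a, 7) field3" where
  "deformation \<phi> v c x b i j = (\<Sum>e\<in>UNIV. v c x e * psi \<phi> c x b i j e)"

definition deformed :: "('a, 7) field3 \<Rightarrow> ('a, 7) vfield \<Rightarrow> ('a, 7) field3" where
  "deformed \<phi> v c x b i j = \<phi> c x b i j + deformation \<phi> v c x b i j"

definition parallel_vector :: "('a, 7) chart set \<Rightarrow> ('a, 7) field3 \<Rightarrow> ('a, 7) vfield \<Rightarrow> bool" where
  "parallel_vector A \<phi> v \<longleftrightarrow>
     (\<forall>c\<in>A. \<forall>x\<in>coords c. \<forall>a b. nabla_vector (g2_metric \<phi> c) (v c) x a b = 0)"

end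

(* Pointwise, phi is the pullback of phi0 by an invertible matrix P; then the metric is P^T P and psi is the
   pullback of psi0, so all algebra happens on R^7 with the cross product of phi0, whose identities follow
   from x * (x * y) = <x,y> x - |x|^2 y.

   For v on R^7 the form phi0 + v^e psi0_(bcde) is the pullback of phi0 by Q x = a x + b <v,x> v + c v * x for
   suitable a, b, c (take a cube root of 1 - i|v|), so the deformed form is positive with metric
   (1+|v|^2)^(-2/3) ((1+|v|^2) g - v v).

   If nabla phi = 0 then the metric and psi are parallel because they are natural smooth functions of phi.
   Hence nabla of the deformed form is nabla v contracted with psi.  If v is parallel, the deformed metric is
   parallel too, both Levi-Civita connections agree and the deformed form is torsion-free.

   Conversely let U = nabla v and let D be the difference of the two Levi-Civita connections.
   Alternating the equation U psi = D (deformed form) shows that U annihilates psi, i.e. lies in the Lie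
   algebra of G2.  Koszul's formula computes D(v, .), and evaluating the equation on arguments
   orthogonal to v and w = U v gives w = 0; now D(x,y) is a multiple of v_y Ux + v_x Uy, and
   evaluating once more on arguments orthogonal to v gives U = 0. *)

theory Submission
  imports Defs
begin

section \<open>The cross product on seven-dimensional space\<close>

text \<open>The cube root has a geometric origin. On the orthogonal complement of \<open>v\<close>,
  the map x -> v * x is |v| times a complex structure, and phi0 restricts there to the real part of
  a complex volume form. Adding the contraction of \<open>v\<close> with psi0 multiplies that volume
  form by 1 - i|v|. A complex scaling z with z^3 = 1 - i|v| does the same but stretches lengths by
  |z|; a compensating factor on \<open>v\<close> keeps the rest of phi0 fixed, whence the exponent
  2/3. The metric is only given through a unique description, so differentiating it needs a formula:
  the matrix of wedge products is w g, its determinant is w^9, and a signed ninth root recovers w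
  and then g. In the converse the two evaluations work because U, once in the Lie algebra of G2,
  acts on the deformed form only through its effect on \<open>v\<close>; the right side becomes a
  multiple of U v contracted with psi0. The multiple is |v|^2/(1+|v|^2), never 1, so U v vanishes,
  and in the second evaluation the right side is then zero.\<close>

lemma exhaust_7: fixes x :: 7 shows "x = 1 \<or> x = 2 \<or> x = 3 \<or> x = 4 \<or> x = 5 \<or> x = 6 \<or> x = 7"
proof (induct x)
  case (of_int z)
  then have "z = 0 \<or> z = 1 \<or> z = 2 \<or> z = 3 \<or> z = 4 \<or> z = 5 \<or> z = 6" by fastforce
  then show ?case by auto
qed
lemma forall_7: "(\<forall>i::7. P i) \<longleftrightarrow> P 1 \<and> P 2 \<and> P 3 \<and> P 4 \<and> P 5 \<and> P 6 \<and> P 7"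
  by (metis exhaust_7)
lemma UNIV_7: "UNIV = {1, 2, 3, 4, 5, 6, 7::7}"
  using exhaust_7 by auto
lemma sum_7: "sum f (UNIV::7 set) = f 1 + f 2 + f 3 + f 4 + f 5 + f 6 + f 7"
  unfolding UNIV_7 by (simp add: ac_simps)
text \<open>The imaginary part of the product of imaginary octonions; \<open>phi0\<close> is its
  associated three-form, \<open>phi0\<close>(x,y,z) = <x * y, z>.\<close>

definition cross7 :: "real^7 \<Rightarrow> real^7 \<Rightarrow> real^7" where
  "cross7 x y = (\<chi> k. \<Sum>i\<in>UNIV. \<Sum>j\<in>UNIV. phi0 i j k * (x $ i * y $ j))"

lemma sum_delta_left: "(\<Sum>i\<in>UNIV. delta k i * f i) = f k"
  by (simp add: delta_def if_distrib [of "\<lambda>t. t * _"] cong: if_cong)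

lemma sum_basis3:
  "(\<Sum>i\<in>UNIV. \<Sum>j\<in>UNIV. \<Sum>k\<in>UNIV. basis3 p q r i j k * F i j k) =
     F p q r + F r p q + F q r p - F p r q - F q p r - F r q p"
proof -
  have d: "(\<Sum>i\<in>UNIV. \<Sum>j\<in>UNIV. \<Sum>k\<in>UNIV. delta a i * delta b j * delta c k * F i j k) = F a b c" for a b c
    by (simp add: sum_delta_left sum_distrib_left[symmetric] mult.assoc)
  have e: "basis3 p q r i j k * F i j k = delta p i * delta q j * delta r k * F i j k
     + delta r i * delta p j * delta q k * F i j k + delta q i * delta r j * delta p k * F i j k
     - delta p i * delta r j * delta q k * F i j k - delta q i * delta p j * delta r k * F i j k
     - delta r i * delta q j * delta p k * F i j k" for i j k
    by (simp add: basis3_def algebra_simps)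
  show ?thesis
    unfolding e sum.distrib sum_subtractf d by simp
qed

text \<open>Only the six orderings of seven index triples contribute, so every contraction with
  \<open>phi0\<close> becomes 42 explicit terms.\<close>

lemma sum_phi0:
  "(\<Sum>i\<in>UNIV. \<Sum>j\<in>UNIV. \<Sum>k\<in>UNIV. phi0 i j k * F i j k) =
    (let B = (\<lambda>p q r. F p q r + F r p q + F q r p - F p r q - F q p r - F r q p)
     in B 1 2 3 + B 1 4 5 + B 1 6 7 + B 2 4 6 - B 2 5 7 - B 3 4 7 - B 3 5 6)"
  unfolding phi0_def ring_distribs sum.distrib sum_subtractf sum_basis3 Let_def by simp

lemma cross7_inner: "cross7 x y \<bullet> z = (\<Sum>i\<in>UNIV. \<Sum>j\<in>UNIV. \<Sum>k\<in>UNIV. phi0 i j k * (x$i * y$j * z$k))"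
proof -
  have "cross7 x y \<bullet> z = (\<Sum>k\<in>UNIV. \<Sum>i\<in>UNIV. \<Sum>j\<in>UNIV. phi0 i j k * (x$i * y$j * z$k))"
    by (simp add: inner_vec_def cross7_def sum_distrib_right mult.assoc)
  also have "\<dots> = (\<Sum>i\<in>UNIV. \<Sum>k\<in>UNIV. \<Sum>j\<in>UNIV. phi0 i j k * (x$i * y$j * z$k))"
    by (rule sum.swap)
  also have "\<dots> = (\<Sum>i\<in>UNIV. \<Sum>j\<in>UNIV. \<Sum>k\<in>UNIV. phi0 i j k * (x$i * y$j * z$k))"
    by (rule sum.cong[OF refl], rule sum.swap)
  finally show ?thesis .
qed

lemma cross7_nth: "cross7 x y $ k = cross7 x y \<bullet> axis k 1"
  by (simp add: inner_axis)

lemma cross7_components: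
  "cross7 x y $ 1 = x$2 * y$3 - x$3 * y$2 + x$4 * y$5 - x$5 * y$4 + x$6 * y$7 - x$7 * y$6"
  "cross7 x y $ 2 = - x$1 * y$3 + x$3 * y$1 + x$4 * y$6 - x$6 * y$4 - x$5 * y$7 + x$7 * y$5"
  "cross7 x y $ 3 = x$1 * y$2 - x$2 * y$1 - x$4 * y$7 + x$7 * y$4 - x$5 * y$6 + x$6 * y$5"
  "cross7 x y $ 4 = - x$1 * y$5 + x$5 * y$1 - x$2 * y$6 + x$6 * y$2 + x$3 * y$7 - x$7 * y$3"
  "cross7 x y $ 5 = x$1 * y$4 - x$4 * y$1 + x$2 * y$7 - x$7 * y$2 + x$3 * y$6 - x$6 * y$3"
  "cross7 x y $ 6 = - x$1 * y$7 + x$7 * y$1 + x$2 * y$4 - x$4 * y$2 - x$3 * y$5 + x$5 * y$3"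
  "cross7 x y $ 7 = x$1 * y$6 - x$6 * y$1 - x$2 * y$5 + x$5 * y$2 - x$3 * y$4 + x$4 * y$3"
  unfolding cross7_nth cross7_inner sum_phi0 Let_def by (simp_all add: axis_def)

lemma bilinear_cross7: "bilinear cross7"
  unfolding bilinear_def
  by (intro conjI allI linearI; simp add: cross7_def vec_eq_iff algebra_simps sum.distrib sum_distrib_left)

lemmas cross7_add_left = bilinear_ladd[OF bilinear_cross7] and cross7_add_right = bilinear_radd[OF bilinear_cross7]
  and cross7_scale_left = bilinear_lmul[OF bilinear_cross7] and cross7_scale_right = bilinear_rmul[OF bilinear_cross7]
  and cross7_diff_left = bilinear_lsub[OF bilinear_cross7] and cross7_diff_right = bilinear_rsub[OF bilinear_cross7]
  and cross7_minus_left = bilinear_lneg[OF bilinear_cross7] and cross7_minus_right = bilinear_rneg[OF bilinear_cross7]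
  and cross7_zero_left = bilinear_lzero[OF bilinear_cross7] and cross7_zero_right = bilinear_rzero[OF bilinear_cross7]

lemma cross7_skew: "cross7 x y = - cross7 y x"
  by (simp add: vec_eq_iff forall_7 cross7_components)

lemma cross7_self [simp]: "cross7 x x = 0"
  by (simp add: vec_eq_iff forall_7 cross7_components)

lemma cross7_cross7: "cross7 x (cross7 x y) = (x \<bullet> y) *\<^sub>R x - (x \<bullet> x) *\<^sub>R y"
  by (simp add: vec_eq_iff forall_7 cross7_components inner_vec_def sum_7) (simp add: algebra_simps)

lemma cross7_cyc: "cross7 x y \<bullet> z = cross7 y z \<bullet> x"
  by (simp add: cross7_components inner_vec_def sum_7 algebra_simps)

text \<open>The Hodge dual of \<open>phi0\<close>, read off from the contraction identity for
  \<open>phi0\<close> with itself. This form makes multilinearity immediate and avoids the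
  Levi-Civita symbol; the agreement with the dual is \<open>sum_phi0_levi_civita\<close>.\<close>

definition psi0 :: "real^7 \<Rightarrow> real^7 \<Rightarrow> real^7 \<Rightarrow> real^7 \<Rightarrow> real" where
  "psi0 x y z w = cross7 x y \<bullet> cross7 z w - (x \<bullet> z) * (y \<bullet> w) + (x \<bullet> w) * (y \<bullet> z)"

lemmas inner_lin = inner_add_left inner_add_right inner_diff_left inner_diff_right
  inner_minus_left inner_minus_right inner_scaleR_left inner_scaleR_right
lemmas cross7_lin = cross7_add_left cross7_add_right cross7_scale_left cross7_scale_right cross7_diff_left cross7_diff_right
  cross7_minus_left cross7_minus_right cross7_zero_left cross7_zero_right

lemma psi0_swap12: "psi0 y x z w = - psi0 x y z w"
  unfolding psi0_def by (subst cross7_skew) (simp add: cross7_lin inner_lin)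

lemma psi0_swap34: "psi0 x y w z = - psi0 x y z w"
  unfolding psi0_def by (subst (2) cross7_skew) (simp add: cross7_lin inner_lin)

lemma psi0_add:
  "psi0 (x + x') y z w = psi0 x y z w + psi0 x' y z w"
  "psi0 x (y + y') z w = psi0 x y z w + psi0 x y' z w"
  "psi0 x y (z + z') w = psi0 x y z w + psi0 x y z' w"
  "psi0 x y z (w + w') = psi0 x y z w + psi0 x y z w'"
  by (simp_all add: psi0_def cross7_lin inner_lin algebra_simps)

lemma psi0_scale:
  "psi0 (r *\<^sub>R x) y z w = r * psi0 x y z w"
  "psi0 x (r *\<^sub>R y) z w = r * psi0 x y z w"
  "psi0 x y (r *\<^sub>R z) w = r * psi0 x y z w"
  "psi0 x y z (r *\<^sub>R w) = r * psi0 x y z w"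
  by (simp_all add: psi0_def cross7_lin inner_lin algebra_simps)

lemma cross7_inner_cross7_left: "cross7 x y \<bullet> cross7 x w = (x \<bullet> x) * (y \<bullet> w) - (x \<bullet> y) * (x \<bullet> w)"
proof -
  have "cross7 x y \<bullet> cross7 x w = cross7 (cross7 x w) x \<bullet> y"
    by (metis cross7_cyc inner_commute)
  also have "cross7 (cross7 x w) x = - cross7 x (cross7 x w)" by (rule cross7_skew)
  finally show ?thesis by (simp add: cross7_cross7 inner_lin inner_commute algebra_simps)
qed

text \<open>By polarization: \<open>psi0\<close> vanishes when its first and third arguments
  coincide, by the Lagrange identity \<open>cross7_inner_cross7_left\<close>. The definition itself
  only shows the symmetries within each pair.\<close>

lemma psi0_swap13: "psi0 z y x w = - psi0 x y z w"
proof -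
  have z: "psi0 t y t w = 0" for t
    unfolding psi0_def by (simp add: cross7_inner_cross7_left inner_commute algebra_simps)
  have "0 = psi0 (x + z) y (x + z) w" by (simp add: z)
  also have "\<dots> = psi0 x y z w + psi0 z y x w"
    using z[of x] z[of z] by (simp add: psi0_add)
  finally show ?thesis by simp
qed

lemma psi0_swap23: "psi0 x z y w = - psi0 x y z w"
  using psi0_swap13[of y z x w] psi0_swap12[of z y x w] psi0_swap13[of z y x w] by simp

text \<open>A four-cycle is odd. This is the sign between contracting the last slot, as the
  deformation does, and the first.\<close>

lemma psi0_rotate: "psi0 y z w x = - psi0 x y z w"
  using psi0_swap12[of x y z w] psi0_swap23[of y x z w] psi0_swap34[of y z x w] by simp

lemma inner_matrix_skew:
  fixes A :: "real^'n^'n"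
  assumes "\<And>i j. A $ i $ j = - A $ j $ i"
  shows "(A *v x) \<bullet> y = - (x \<bullet> (A *v y))"
proof -
  have "(A *v x) \<bullet> y = (\<Sum>i\<in>UNIV. \<Sum>j\<in>UNIV. A $ i $ j * x $ j * y $ i)"
    by (simp add: inner_vec_def matrix_vector_mult_def sum_distrib_right)
  also have "\<dots> = (\<Sum>j\<in>UNIV. \<Sum>i\<in>UNIV. A $ i $ j * x $ j * y $ i)"
    by (rule sum.swap)
  also have "\<dots> = (\<Sum>j\<in>UNIV. \<Sum>i\<in>UNIV. - (x $ j * (A $ j $ i * y $ i)))"
    by (intro sum.cong refl, subst assms) (simp add: mult_ac)
  also have "\<dots> = - (x \<bullet> (A *v y))"
    by (simp add: inner_vec_def matrix_vector_mult_def sum_distrib_left sum_negf)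
  finally show ?thesis .
qed

section \<open>The infinitesimal stabilizer of the four-form\<close>

lemma cross7_axis:
  "cross7 (axis 1 1) (axis 2 1) = axis 3 1"
  "cross7 (axis 1 1) (axis 3 1) = - axis 2 1"
  "cross7 (axis 1 1) (axis 4 1) = axis 5 1"
  "cross7 (axis 1 1) (axis 5 1) = - axis 4 1"
  "cross7 (axis 1 1) (axis 6 1) = axis 7 1"
  "cross7 (axis 1 1) (axis 7 1) = - axis 6 1"
  "cross7 (axis 2 1) (axis 1 1) = - axis 3 1"
  "cross7 (axis 2 1) (axis 3 1) = axis 1 1"
  "cross7 (axis 2 1) (axis 4 1) = axis 6 1"
  "cross7 (axis 2 1) (axis 5 1) = - axis 7 1"
  "cross7 (axis 2 1) (axis 6 1) = - axis 4 1"
  "cross7 (axis 2 1) (axis 7 1) = axis 5 1"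
  "cross7 (axis 3 1) (axis 1 1) = axis 2 1"
  "cross7 (axis 3 1) (axis 2 1) = - axis 1 1"
  "cross7 (axis 3 1) (axis 4 1) = - axis 7 1"
  "cross7 (axis 3 1) (axis 5 1) = - axis 6 1"
  "cross7 (axis 3 1) (axis 6 1) = axis 5 1"
  "cross7 (axis 3 1) (axis 7 1) = axis 4 1"
  "cross7 (axis 4 1) (axis 1 1) = - axis 5 1"
  "cross7 (axis 4 1) (axis 2 1) = - axis 6 1"
  "cross7 (axis 4 1) (axis 3 1) = axis 7 1"
  "cross7 (axis 4 1) (axis 5 1) = axis 1 1"
  "cross7 (axis 4 1) (axis 6 1) = axis 2 1"
  "cross7 (axis 4 1) (axis 7 1) = - axis 3 1"
  "cross7 (axis 5 1) (axis 1 1) = axis 4 1"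
  "cross7 (axis 5 1) (axis 2 1) = axis 7 1"
  "cross7 (axis 5 1) (axis 3 1) = axis 6 1"
  "cross7 (axis 5 1) (axis 4 1) = - axis 1 1"
  "cross7 (axis 5 1) (axis 6 1) = - axis 3 1"
  "cross7 (axis 5 1) (axis 7 1) = - axis 2 1"
  "cross7 (axis 6 1) (axis 1 1) = - axis 7 1"
  "cross7 (axis 6 1) (axis 2 1) = axis 4 1"
  "cross7 (axis 6 1) (axis 3 1) = - axis 5 1"
  "cross7 (axis 6 1) (axis 4 1) = - axis 2 1"
  "cross7 (axis 6 1) (axis 5 1) = axis 3 1"
  "cross7 (axis 6 1) (axis 7 1) = axis 1 1"
  "cross7 (axis 7 1) (axis 1 1) = axis 6 1"
  "cross7 (axis 7 1) (axis 2 1) = - axis 5 1"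
  "cross7 (axis 7 1) (axis 3 1) = - axis 4 1"
  "cross7 (axis 7 1) (axis 4 1) = axis 3 1"
  "cross7 (axis 7 1) (axis 5 1) = axis 2 1"
  "cross7 (axis 7 1) (axis 6 1) = - axis 1 1"
  by (simp_all add: vec_eq_iff forall_7 cross7_components axis_def)

lemma axis_component: "axis i (1::real) $ j = (if j = i then 1 else 0)"
  by (simp add: axis_def)

lemma matrix_vector_mult_minus_right: "A *v (- x) = - (A *v (x::real^'n))"
  by (simp add: matrix_vector_mult_def sum_negf vec_eq_iff)

text \<open>The 35 equations are independent conditions on the 49 entries of \<open>A\<close> and
  leave a space of dimension 14, the Lie algebra of G2, which preserves the inner product and the
  cross product.\<close>

lemma stabilizer_psi0:
  fixes A :: "real^7^7"
  assumes H: "\<And>x y z w. psi0 (A *v x) y z w + psi0 x (A *v y) z w + psi0 x y (A *v z) w + psi0 x y z (A *v w) = 0"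
  shows stabilizer_psi0_skew: "(A *v x) \<bullet> y = - (x \<bullet> (A *v y))"
    and stabilizer_psi0_cross7: "A *v cross7 x y = cross7 (A *v x) y + cross7 x (A *v y)"
proof -
  have nth: "(A *v axis j 1) $ i = A $ i $ j" for i j
    by (simp add: matrix_vector_mult_basis column_def)
  \<comment> \<open>One equation for each increasing quadruple of labels. Seven of them involve the
    diagonal only. The others fall into seven blocks of four equations, one block for each label k:
    it contains only the entries \<open>A$i$j\<close> for which the product of the basis vectors i
    and j is plus or minus the basis vector k.\<close>
  have e1234: "- A$5$1 - A$6$2 + A$7$3 = 0"
    using H[of "axis 1 1" "axis 2 1" "axis 3 1" "axis 4 1"]
    by (simp add: psi0_def cross7_axis inner_axis inner_axis' cross7_components nth axis_component)
  have e1235: "A$4$1 + A$7$2 + A$6$3 = 0"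
    using H[of "axis 1 1" "axis 2 1" "axis 3 1" "axis 5 1"]
    by (simp add: psi0_def cross7_axis inner_axis inner_axis' cross7_components nth axis_component)
  have e1236: "- A$7$1 + A$4$2 - A$5$3 = 0"
    using H[of "axis 1 1" "axis 2 1" "axis 3 1" "axis 6 1"]
    by (simp add: psi0_def cross7_axis inner_axis inner_axis' cross7_components nth axis_component)
  have e1237: "A$6$1 - A$5$2 - A$4$3 = 0"
    using H[of "axis 1 1" "axis 2 1" "axis 3 1" "axis 7 1"]
    by (simp add: psi0_def cross7_axis inner_axis inner_axis' cross7_components nth axis_component)
  have e1245: "- A$3$1 + A$6$4 - A$7$5 = 0"
    using H[of "axis 1 1" "axis 2 1" "axis 4 1" "axis 5 1"]
    by (simp add: psi0_def cross7_axis inner_axis inner_axis' cross7_components nth axis_component)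
  have e1246: "- A$3$2 - A$5$4 - A$7$6 = 0"
    using H[of "axis 1 1" "axis 2 1" "axis 4 1" "axis 6 1"]
    by (simp add: psi0_def cross7_axis inner_axis inner_axis' cross7_components nth axis_component)
  have e1247: "- A$1$1 - A$2$2 - A$4$4 - A$7$7 = 0"
    using H[of "axis 1 1" "axis 2 1" "axis 4 1" "axis 7 1"]
    by (simp add: psi0_def cross7_axis inner_axis inner_axis' cross7_components nth axis_component)
  have e1256: "- A$1$1 - A$2$2 - A$5$5 - A$6$6 = 0"
    using H[of "axis 1 1" "axis 2 1" "axis 5 1" "axis 6 1"]
    by (simp add: psi0_def cross7_axis inner_axis inner_axis' cross7_components nth axis_component)
  have e1257: "A$3$2 - A$4$5 - A$6$7 = 0"
    using H[of "axis 1 1" "axis 2 1" "axis 5 1" "axis 7 1"]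
    by (simp add: psi0_def cross7_axis inner_axis inner_axis' cross7_components nth axis_component)
  have e1267: "- A$3$1 - A$4$6 + A$5$7 = 0"
    using H[of "axis 1 1" "axis 2 1" "axis 6 1" "axis 7 1"]
    by (simp add: psi0_def cross7_axis inner_axis inner_axis' cross7_components nth axis_component)
  have e1345: "A$2$1 - A$7$4 - A$6$5 = 0"
    using H[of "axis 1 1" "axis 3 1" "axis 4 1" "axis 5 1"]
    by (simp add: psi0_def cross7_axis inner_axis inner_axis' cross7_components nth axis_component)
  have e1346: "- A$1$1 - A$3$3 - A$4$4 - A$6$6 = 0"
    using H[of "axis 1 1" "axis 3 1" "axis 4 1" "axis 6 1"]
    by (simp add: psi0_def cross7_axis inner_axis inner_axis' cross7_components nth axis_component)
  have e1347: "- A$2$3 + A$5$4 - A$6$7 = 0"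
    using H[of "axis 1 1" "axis 3 1" "axis 4 1" "axis 7 1"]
    by (simp add: psi0_def cross7_axis inner_axis inner_axis' cross7_components nth axis_component)
  have e1356: "- A$2$3 - A$4$5 + A$7$6 = 0"
    using H[of "axis 1 1" "axis 3 1" "axis 5 1" "axis 6 1"]
    by (simp add: psi0_def cross7_axis inner_axis inner_axis' cross7_components nth axis_component)
  have e1357: "A$1$1 + A$3$3 + A$5$5 + A$7$7 = 0"
    using H[of "axis 1 1" "axis 3 1" "axis 5 1" "axis 7 1"]
    by (simp add: psi0_def cross7_axis inner_axis inner_axis' cross7_components nth axis_component)
  have e1367: "A$2$1 + A$5$6 + A$4$7 = 0"
    using H[of "axis 1 1" "axis 3 1" "axis 6 1" "axis 7 1"]
    by (simp add: psi0_def cross7_axis inner_axis inner_axis' cross7_components nth axis_component)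
  have e1456: "- A$7$1 - A$2$4 + A$3$5 = 0"
    using H[of "axis 1 1" "axis 4 1" "axis 5 1" "axis 6 1"]
    by (simp add: psi0_def cross7_axis inner_axis inner_axis' cross7_components nth axis_component)
  have e1457: "A$6$1 + A$3$4 + A$2$5 = 0"
    using H[of "axis 1 1" "axis 4 1" "axis 5 1" "axis 7 1"]
    by (simp add: psi0_def cross7_axis inner_axis inner_axis' cross7_components nth axis_component)
  have e1467: "- A$5$1 + A$2$6 - A$3$7 = 0"
    using H[of "axis 1 1" "axis 4 1" "axis 6 1" "axis 7 1"]
    by (simp add: psi0_def cross7_axis inner_axis inner_axis' cross7_components nth axis_component)
  have e1567: "A$4$1 - A$3$6 - A$2$7 = 0"
    using H[of "axis 1 1" "axis 5 1" "axis 6 1" "axis 7 1"]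
    by (simp add: psi0_def cross7_axis inner_axis inner_axis' cross7_components nth axis_component)
  have e2345: "A$2$2 + A$3$3 + A$4$4 + A$5$5 = 0"
    using H[of "axis 2 1" "axis 3 1" "axis 4 1" "axis 5 1"]
    by (simp add: psi0_def cross7_axis inner_axis inner_axis' cross7_components nth axis_component)
  have e2346: "- A$1$2 - A$7$4 + A$5$6 = 0"
    using H[of "axis 2 1" "axis 3 1" "axis 4 1" "axis 6 1"]
    by (simp add: psi0_def cross7_axis inner_axis inner_axis' cross7_components nth axis_component)
  have e2347: "A$1$3 + A$6$4 + A$5$7 = 0"
    using H[of "axis 2 1" "axis 3 1" "axis 4 1" "axis 7 1"]
    by (simp add: psi0_def cross7_axis inner_axis inner_axis' cross7_components nth axis_component)
  have e2356: "A$1$3 - A$7$5 - A$4$6 = 0"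
    using H[of "axis 2 1" "axis 3 1" "axis 5 1" "axis 6 1"]
    by (simp add: psi0_def cross7_axis inner_axis inner_axis' cross7_components nth axis_component)
  have e2357: "A$1$2 + A$6$5 - A$4$7 = 0"
    using H[of "axis 2 1" "axis 3 1" "axis 5 1" "axis 7 1"]
    by (simp add: psi0_def cross7_axis inner_axis inner_axis' cross7_components nth axis_component)
  have e2367: "A$2$2 + A$3$3 + A$6$6 + A$7$7 = 0"
    using H[of "axis 2 1" "axis 3 1" "axis 6 1" "axis 7 1"]
    by (simp add: psi0_def cross7_axis inner_axis inner_axis' cross7_components nth axis_component)
  have e2456: "- A$7$2 + A$1$4 + A$3$6 = 0"
    using H[of "axis 2 1" "axis 4 1" "axis 5 1" "axis 6 1"]
    by (simp add: psi0_def cross7_axis inner_axis inner_axis' cross7_components nth axis_component)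
  have e2457: "A$6$2 - A$1$5 + A$3$7 = 0"
    using H[of "axis 2 1" "axis 4 1" "axis 5 1" "axis 7 1"]
    by (simp add: psi0_def cross7_axis inner_axis inner_axis' cross7_components nth axis_component)
  have e2467: "- A$5$2 + A$3$4 - A$1$6 = 0"
    using H[of "axis 2 1" "axis 4 1" "axis 6 1" "axis 7 1"]
    by (simp add: psi0_def cross7_axis inner_axis inner_axis' cross7_components nth axis_component)
  have e2567: "A$4$2 + A$3$5 + A$1$7 = 0"
    using H[of "axis 2 1" "axis 5 1" "axis 6 1" "axis 7 1"]
    by (simp add: psi0_def cross7_axis inner_axis inner_axis' cross7_components nth axis_component)
  have e3456: "- A$7$3 - A$1$5 - A$2$6 = 0"
    using H[of "axis 3 1" "axis 4 1" "axis 5 1" "axis 6 1"]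
    by (simp add: psi0_def cross7_axis inner_axis inner_axis' cross7_components nth axis_component)
  have e3457: "A$6$3 - A$1$4 - A$2$7 = 0"
    using H[of "axis 3 1" "axis 4 1" "axis 5 1" "axis 7 1"]
    by (simp add: psi0_def cross7_axis inner_axis inner_axis' cross7_components nth axis_component)
  have e3467: "- A$5$3 - A$2$4 + A$1$7 = 0"
    using H[of "axis 3 1" "axis 4 1" "axis 6 1" "axis 7 1"]
    by (simp add: psi0_def cross7_axis inner_axis inner_axis' cross7_components nth axis_component)
  have e3567: "A$4$3 - A$2$5 + A$1$6 = 0"
    using H[of "axis 3 1" "axis 5 1" "axis 6 1" "axis 7 1"]
    by (simp add: psi0_def cross7_axis inner_axis inner_axis' cross7_components nth axis_component)
  have e4567: "A$4$4 + A$5$5 + A$6$6 + A$7$7 = 0"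
    using H[of "axis 4 1" "axis 5 1" "axis 6 1" "axis 7 1"]
    by (simp add: psi0_def cross7_axis inner_axis inner_axis' cross7_components nth axis_component)
  have s11: "A$1$1 = 0" using e1247 e1256 e1346 e1357 e2345 e2367 e4567 by linarith
  have s12: "A$1$2 = - A$2$1" using e1345 e1367 e2346 e2357 by linarith
  have s13: "A$1$3 = - A$3$1" using e1245 e1267 e2347 e2356 by linarith
  have s14: "A$1$4 = - A$4$1" using e1235 e1567 e2456 e3457 by linarith
  have s15: "A$1$5 = - A$5$1" using e1234 e1467 e2457 e3456 by linarith
  have s16: "A$1$6 = - A$6$1" using e1237 e1457 e2467 e3567 by linarith
  have s17: "A$1$7 = - A$7$1" using e1236 e1456 e2567 e3467 by linarith
  have s22: "A$2$2 = 0" using e1247 e1256 e1346 e1357 e2345 e2367 e4567 by linarith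
  have s23: "A$2$3 = - A$3$2" using e1246 e1257 e1347 e1356 by linarith
  have s24: "A$2$4 = - A$4$2" using e1236 e1456 e2567 e3467 by linarith
  have s25: "A$2$5 = - A$5$2" using e1237 e1457 e2467 e3567 by linarith
  have s26: "A$2$6 = - A$6$2" using e1234 e1467 e2457 e3456 by linarith
  have s27: "A$2$7 = - A$7$2" using e1235 e1567 e2456 e3457 by linarith
  have s33: "A$3$3 = 0" using e1247 e1256 e1346 e1357 e2345 e2367 e4567 by linarith
  have s34: "A$3$4 = - A$4$3" using e1237 e1457 e2467 e3567 by linarith
  have s35: "A$3$5 = - A$5$3" using e1236 e1456 e2567 e3467 by linarith
  have s36: "A$3$6 = - A$6$3" using e1235 e1567 e2456 e3457 by linarith
  have s37: "A$3$7 = - A$7$3" using e1234 e1467 e2457 e3456 by linarith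
  have s44: "A$4$4 = 0" using e1247 e1256 e1346 e1357 e2345 e2367 e4567 by linarith
  have s45: "A$4$5 = - A$5$4" using e1246 e1257 e1347 e1356 by linarith
  have s46: "A$4$6 = - A$6$4" using e1245 e1267 e2347 e2356 by linarith
  have s47: "A$4$7 = - A$7$4" using e1345 e1367 e2346 e2357 by linarith
  have s55: "A$5$5 = 0" using e1247 e1256 e1346 e1357 e2345 e2367 e4567 by linarith
  have s56: "A$5$6 = - A$6$5" using e1345 e1367 e2346 e2357 by linarith
  have s57: "A$5$7 = - A$7$5" using e1245 e1267 e2347 e2356 by linarith
  have s66: "A$6$6 = 0" using e1247 e1256 e1346 e1357 e2345 e2367 e4567 by linarith
  have s67: "A$6$7 = - A$7$6" using e1246 e1257 e1347 e1356 by linarith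
  have s77: "A$7$7 = 0" using e1247 e1256 e1346 e1357 e2345 e2367 e4567 by linarith
  \<comment> \<open>Besides skewness, each block gives one further relation. Together the seven say
    that the contraction of \<open>A\<close> with \<open>phi0\<close> is zero, which cuts the 21
    dimensions of skew matrices down to 14.\<close>
  have r1: "A$2$3 = - A$4$5 - A$6$7" using e1246 e1257 e1347 e1356 s23 s45 s67 by linarith
  have r2: "A$1$3 = A$4$6 - A$5$7" using e1245 e1267 e2347 e2356 s13 s46 s57 by linarith
  have r3: "A$1$2 = A$4$7 + A$5$6" using e1345 e1367 e2346 e2357 s12 s47 s56 by linarith
  have r4: "A$1$5 = - A$2$6 + A$3$7" using e1234 e1467 e2457 e3456 s15 s26 s37 by linarith
  have r5: "A$1$4 = - A$2$7 - A$3$6" using e1235 e1567 e2456 e3457 s14 s27 s36 by linarith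
  have r6: "A$1$7 = A$2$4 - A$3$5" using e1236 e1456 e2567 e3467 s17 s24 s35 by linarith
  have r7: "A$1$6 = A$2$5 + A$3$4" using e1237 e1457 e2467 e3567 s16 s25 s34 by linarith
  have d: "A$i$i = 0" for i using exhaust_7[of i] s11 s22 s33 s44 s55 s66 s77 by auto
  have t: "A$2$1 = - A$1$2" "A$3$1 = - A$1$3" "A$4$1 = - A$1$4" "A$5$1 = - A$1$5" "A$6$1 = - A$1$6" "A$7$1 = - A$1$7" "A$3$2 = - A$2$3" "A$4$2 = - A$2$4" "A$5$2 = - A$2$5" "A$6$2 = - A$2$6" "A$7$2 = - A$2$7" "A$4$3 = - A$3$4" "A$5$3 = - A$3$5" "A$6$3 = - A$3$6" "A$7$3 = - A$3$7" "A$5$4 = - A$4$5" "A$6$4 = - A$4$6" "A$7$4 = - A$4$7" "A$6$5 = - A$5$6" "A$7$5 = - A$5$7" "A$7$6 = - A$6$7" by (simp_all only: s12 s13 s14 s15 s16 s17 s23 s24 s25 s26 s27 s34 s35 s36 s37 s45 s46 s47 s56 s57 s67 minus_minus)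
  have sk: "A$i$j = - A$j$i" for i j
    using exhaust_7[of i] exhaust_7[of j] by (elim disjE; hypsubst; simp only: d t minus_minus minus_zero)
  show "(A *v x) \<bullet> y = - (x \<bullet> (A *v y))"
    by (rule inner_matrix_skew, rule sk)
  have b: "A *v cross7 (axis i 1) (axis j 1) = cross7 (A *v axis i 1) (axis j 1) + cross7 (axis i 1) (A *v axis j 1)" for i j
    using exhaust_7[of i] exhaust_7[of j]
    by (elim disjE; hypsubst)
      (simp_all add: vec_eq_iff forall_7 cross7_axis cross7_components nth axis_component d t matrix_vector_mult_minus_right r1 r2 r3 r4 r5 r6 r7)
  have "(\<lambda>x y. A *v cross7 x y) = (\<lambda>x y. cross7 (A *v x) y + cross7 x (A *v y))"
  proof (rule bilinear_eq_stdbasis)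
    show "bilinear (\<lambda>x y. A *v cross7 x y)" "bilinear (\<lambda>x y. cross7 (A *v x) y + cross7 x (A *v y))"
      unfolding bilinear_def
      by (intro conjI allI linearI; simp add: cross7_lin matrix_vector_right_distrib matrix_vector_mult_scaleR algebra_simps)+
  qed (use b in \<open>auto simp: Basis_vec_def\<close>)
  then show "A *v cross7 x y = cross7 (A *v x) y + cross7 x (A *v y)"
    by meson
qed

text \<open>On the complement of \<open>v\<close> the form \<open>psi0\<close> is half the square of
  a Kaehler form, up to a factor, and the product with \<open>v\<close> is a multiple of the complex
  structure. Evaluating on \<open>p\<close>, a vector \<open>z\<close> complex-orthogonal to it, and
  the products of both with \<open>v\<close> gives |p|^2 |z|^2 |v|^2. Such a \<open>z\<close> exists
  since only three directions are excluded.\<close>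

lemma psi0_perp_eq_0:
  assumes pv: "p \<bullet> v = 0" and v: "v \<noteq> 0"
    and H: "\<And>y z u. y \<bullet> p = 0 \<Longrightarrow> z \<bullet> p = 0 \<Longrightarrow> u \<bullet> p = 0 \<Longrightarrow>
      y \<bullet> v = 0 \<Longrightarrow> z \<bullet> v = 0 \<Longrightarrow> u \<bullet> v = 0 \<Longrightarrow> psi0 p y z u = 0"
  shows "p = 0"
proof -
  let ?y = "cross7 v p"
  have "dim {v, p, ?y} \<le> 3"
    by (rule order_trans[OF dim_le_card']) (auto simp: card_insert_if)
  then have "dim {v, p, ?y} < DIM(real^7)" by simp
  then obtain z where z: "z \<noteq> 0" and o: "\<And>y. y \<in> span {v, p, ?y} \<Longrightarrow> orthogonal z y"
    using orthogonal_to_subspace_exists by blast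
  have zo: "z \<bullet> v = 0" "z \<bullet> p = 0" "z \<bullet> ?y = 0"
    using o[OF span_base] by (auto simp: orthogonal_def)
  let ?u = "cross7 v z"
  have yo: "?y \<bullet> p = 0" "?y \<bullet> v = 0" "?u \<bullet> v = 0"
    using cross7_cyc[of v p p] cross7_cyc[of v p v] cross7_cyc[of p v v] cross7_cyc[of v z v] cross7_cyc[of z v v] by simp_all
  have uo: "?u \<bullet> p = 0"
    using cross7_cyc[of p v z] cross7_skew[of p v] zo by (simp add: inner_commute)
  have "cross7 p ?y = (p \<bullet> p) *\<^sub>R v"
    using cross7_cross7[of p v] cross7_skew[of v p] pv by (simp add: cross7_lin inner_commute)
  moreover have "cross7 z ?u = (z \<bullet> z) *\<^sub>R v"
    using cross7_cross7[of z v] cross7_skew[of v z] zo by (simp add: cross7_lin inner_commute)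
  ultimately have "psi0 p ?y z ?u = (p \<bullet> p) * (z \<bullet> z) * (v \<bullet> v)"
    using zo uo by (simp add: psi0_def inner_commute)
  then show ?thesis
    using H[of ?y z ?u] yo uo zo z v by simp
qed

section \<open>Triple products with factors multiplied by a fixed vector\<close>

lemma cross7_left_cross7:
  "cross7 (cross7 v x) y \<bullet> z = psi0 v x y z + (v \<bullet> y) * (x \<bullet> z) - (v \<bullet> z) * (x \<bullet> y)"
proof -
  have "cross7 (cross7 v x) y \<bullet> z = cross7 v x \<bullet> cross7 y z"
    using cross7_cyc[of "cross7 v x" y z] by (simp add: inner_commute)
  then show ?thesis by (simp add: psi0_def)
qed

lemma cross7_inner_swap: "cross7 x y \<bullet> z = - (cross7 y x \<bullet> z)" "cross7 x y \<bullet> z = - (cross7 x z \<bullet> y)"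
  using cross7_skew[of x y] cross7_skew[of z x] cross7_cyc[of x y z] cross7_cyc[of z x y] by (simp_all add: inner_lin)

text \<open>\<open>cross7_left_cross7\<close> is used twice: once to pass to \<open>psi0\<close>,
  then, after the remaining product with \<open>v\<close> has been moved next to \<open>v\<close>,
  backwards, so that the double product with \<open>v\<close> collapses by
  \<open>cross7_cross7\<close>.\<close>

lemma cross7_cross72:
  "cross7 (cross7 v x) (cross7 v y) \<bullet> z = - (v \<bullet> v) * (cross7 x y \<bullet> z) + (v \<bullet> x) * (cross7 v y \<bullet> z)
     + (v \<bullet> y) * (cross7 v z \<bullet> x) + 2 * (v \<bullet> z) * (cross7 v x \<bullet> y)"
proof -
  have "cross7 (cross7 v x) (cross7 v y) \<bullet> z = psi0 v x (cross7 v y) z - (v \<bullet> z) * (cross7 v y \<bullet> x)"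
    using cross7_cyc[of v v y] by (simp add: cross7_left_cross7 inner_commute[of x] inner_commute[of v "cross7 v y"])
  also have "psi0 v x (cross7 v y) z = - psi0 v (cross7 v y) x z"
    by (rule psi0_swap23)
  also have "psi0 v (cross7 v y) x z = cross7 (cross7 v (cross7 v y)) x \<bullet> z - (v \<bullet> x) * (cross7 v y \<bullet> z)
      + (v \<bullet> z) * (cross7 v y \<bullet> x)"
    by (simp add: cross7_left_cross7)
  also have "cross7 (cross7 v (cross7 v y)) x \<bullet> z = (v \<bullet> y) * (cross7 v x \<bullet> z) - (v \<bullet> v) * (cross7 y x \<bullet> z)"
    by (simp add: cross7_cross7 cross7_lin inner_lin)
  finally show ?thesis
    using cross7_inner_swap(1)[of y x z] cross7_inner_swap(2)[of v x z] cross7_inner_swap(2)[of v y x]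
    by (simp add: algebra_simps)
qed

lemma cross7_cross73:
  "cross7 (cross7 v x) (cross7 v y) \<bullet> cross7 v z = - (v \<bullet> v) * psi0 v x y z"
proof -
  have a: "cross7 v y \<bullet> cross7 v z = (v \<bullet> v) * (y \<bullet> z) - (v \<bullet> y) * (v \<bullet> z)" for y z
    by (rule cross7_inner_cross7_left)
  have b: "cross7 v (cross7 v z) \<bullet> x = (v \<bullet> z) * (v \<bullet> x) - (v \<bullet> v) * (z \<bullet> x)"
    by (simp add: cross7_cross7 inner_lin)
  have c: "cross7 x y \<bullet> cross7 v z = psi0 v x y z + (v \<bullet> x) * (z \<bullet> y) - (v \<bullet> y) * (z \<bullet> x)"
  proof -
    have "cross7 x y \<bullet> cross7 v z = cross7 v z \<bullet> cross7 x y" by (simp add: inner_commute)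
    also have "\<dots> = psi0 v z x y + (v \<bullet> x) * (z \<bullet> y) - (v \<bullet> y) * (z \<bullet> x)"
      by (simp add: psi0_def)
    also have "psi0 v z x y = psi0 v x y z"
      using psi0_swap23[of v x z y] psi0_swap34[of v x y z] by simp
    finally show ?thesis by simp
  qed
  have "v \<bullet> cross7 v z = 0" using cross7_cyc[of v z v] cross7_cyc[of z v v] by (simp add: inner_commute)
  then show ?thesis
    unfolding cross7_cross72 a b c by (simp add: algebra_simps inner_commute)
qed

text \<open>On the complement of \<open>v\<close> this is multiplication by the complex number a + i
  c |v|; on the line of \<open>v\<close> it is multiplication by a + b |v|^2.\<close>

definition twist :: "real \<Rightarrow> real \<Rightarrow> real \<Rightarrow> real^7 \<Rightarrow> real^7 \<Rightarrow> real^7" where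
  "twist a b c v x = a *\<^sub>R x + (b * (v \<bullet> x)) *\<^sub>R v + c *\<^sub>R cross7 v x"

text \<open>For nonzero \<open>v\<close>, the three-forms invariant under the stabilizer SU(3) of
  \<open>v\<close> in G2 are spanned by \<open>phi0\<close>, the wedge product of \<open>v\<close>
  with the contraction of \<open>phi0\<close> by \<open>v\<close>, and the contraction of
  \<open>psi0\<close> by \<open>v\<close>; hence three coefficients. In the expansion,
  \<open>l1\<close> to \<open>l7\<close> treat the possible sets of arguments that carry a product
  with \<open>v\<close>.\<close>

lemma twist_cross7:
  "cross7 (twist a b c v x) (twist a b c v y) \<bullet> twist a b c v z =
    (a^3 - 3 * a * c^2 * (v \<bullet> v)) * (cross7 x y \<bullet> z)
    + (a^2 * b + 4 * a * c^2 + b * c^2 * (v \<bullet> v)) *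
       ((v \<bullet> x) * (cross7 v y \<bullet> z) + (v \<bullet> y) * (cross7 v z \<bullet> x) + (v \<bullet> z) * (cross7 v x \<bullet> y))
    + (3 * a^2 * c - c^3 * (v \<bullet> v)) * psi0 v x y z"
proof -
  have z: "cross7 v p \<bullet> v = 0" "v \<bullet> cross7 v p = 0" "cross7 p v \<bullet> v = 0" "v \<bullet> cross7 p v = 0" for p
    using cross7_cyc[of v p v] cross7_cyc[of p v v] by (simp_all add: inner_commute)
  have k: "cross7 v p \<bullet> cross7 v q = (v \<bullet> v) * (p \<bullet> q) - (v \<bullet> p) * (v \<bullet> q)" for p q
    by (rule cross7_inner_cross7_left)
  have s: "cross7 v x \<bullet> z = - (cross7 v z \<bullet> x)" "cross7 v y \<bullet> x = - (cross7 v x \<bullet> y)" "cross7 v z \<bullet> y = - (cross7 v y \<bullet> z)"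
    by (rule cross7_inner_swap(2))+
  have g: "cross7 x v = - cross7 v x" "cross7 (cross7 v x) v = - cross7 v (cross7 v x)"
    by (rule cross7_skew)+
  have g': "cross7 x y \<bullet> v = cross7 v x \<bullet> y" "cross7 x (cross7 v y) \<bullet> v = cross7 v x \<bullet> cross7 v y"
    "cross7 (cross7 v x) y \<bullet> v = cross7 v (cross7 v x) \<bullet> y" "cross7 (cross7 v x) (cross7 v y) \<bullet> v = cross7 v (cross7 v x) \<bullet> cross7 v y"
    by (rule cross7_cyc[symmetric])+
  have l1: "cross7 (cross7 v x) y \<bullet> z = psi0 v x y z + (v \<bullet> y) * (x \<bullet> z) - (v \<bullet> z) * (x \<bullet> y)"
    by (rule cross7_left_cross7)
  have l2: "cross7 x (cross7 v y) \<bullet> z = psi0 v x y z + (v \<bullet> z) * (x \<bullet> y) - (v \<bullet> x) * (y \<bullet> z)"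
  proof -
    have "cross7 x (cross7 v y) \<bullet> z = cross7 (cross7 v y) z \<bullet> x" by (rule cross7_cyc)
    also have "\<dots> = psi0 v y z x + (v \<bullet> z) * (y \<bullet> x) - (v \<bullet> x) * (y \<bullet> z)" by (rule cross7_left_cross7)
    also have "psi0 v y z x = psi0 v x y z"
      using psi0_swap34[of v y z x] psi0_swap23[of v y x z] by simp
    finally show ?thesis by (simp add: inner_commute)
  qed
  have l3: "cross7 x y \<bullet> cross7 v z = psi0 v x y z + (v \<bullet> x) * (y \<bullet> z) - (v \<bullet> y) * (x \<bullet> z)"
  proof -
    have "cross7 x y \<bullet> cross7 v z = cross7 (cross7 v z) x \<bullet> y" using cross7_cyc[of x y "cross7 v z"] cross7_cyc[of y "cross7 v z" x] by simp
    also have "\<dots> = psi0 v z x y + (v \<bullet> x) * (z \<bullet> y) - (v \<bullet> y) * (z \<bullet> x)" by (rule cross7_left_cross7)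
    also have "psi0 v z x y = psi0 v x y z"
      using psi0_swap23[of v x z y] psi0_swap34[of v x y z] by simp
    finally show ?thesis by (simp add: inner_commute)
  qed
  have l4: "cross7 (cross7 v x) (cross7 v y) \<bullet> z = - (v \<bullet> v) * (cross7 x y \<bullet> z) + (v \<bullet> x) * (cross7 v y \<bullet> z)
     + (v \<bullet> y) * (cross7 v z \<bullet> x) + 2 * (v \<bullet> z) * (cross7 v x \<bullet> y)" by (rule cross7_cross72)
  have l5: "cross7 x (cross7 v y) \<bullet> cross7 v z = - (v \<bullet> v) * (cross7 x y \<bullet> z) + (v \<bullet> y) * (cross7 v z \<bullet> x)
     + (v \<bullet> z) * (cross7 v x \<bullet> y) + 2 * (v \<bullet> x) * (cross7 v y \<bullet> z)"
    using cross7_cross72[of v y z x] cross7_cyc[of x "cross7 v y" "cross7 v z"] cross7_cyc[of x y z] by simp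
  have l6: "cross7 (cross7 v x) y \<bullet> cross7 v z = - (v \<bullet> v) * (cross7 x y \<bullet> z) + (v \<bullet> z) * (cross7 v x \<bullet> y)
     + (v \<bullet> x) * (cross7 v y \<bullet> z) + 2 * (v \<bullet> y) * (cross7 v z \<bullet> x)"
    using cross7_cross72[of v z x y] cross7_cyc[of "cross7 v z" "cross7 v x" y] cross7_cyc[of z x y] by simp
  have l7: "cross7 (cross7 v x) (cross7 v y) \<bullet> cross7 v z = - (v \<bullet> v) * psi0 v x y z" by (rule cross7_cross73)
  show ?thesis
    unfolding twist_def
    by (simp only: cross7_lin inner_lin cross7_self inner_zero_left g,
        simp only: l1 l2 l3 l4 l5 l6 l7 g' k z,
        simp only: cross7_cross7 cross7_lin inner_lin z k,
        simp only: s inner_commute[of y x] inner_commute[of z x] inner_commute[of z y],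
        algebra)
qed

section \<open>The twist and the algebra of the torsion\<close>

lemma twist_inner:
  "twist a b c v x \<bullet> twist a b c v y =
     (a^2 + c^2 * (v \<bullet> v)) * (x \<bullet> y) + (2 * a * b + b^2 * (v \<bullet> v) - c^2) * ((v \<bullet> x) * (v \<bullet> y))"
proof -
  have z: "cross7 v p \<bullet> v = 0" "v \<bullet> cross7 v p = 0" for p
    using cross7_cyc[of v p v] cross7_cyc[of p v v] by (simp_all add: inner_commute)
  have k: "cross7 v x \<bullet> cross7 v y = (v \<bullet> v) * (x \<bullet> y) - (v \<bullet> x) * (v \<bullet> y)"
    by (rule cross7_inner_cross7_left)
  have s: "x \<bullet> cross7 v y = - (cross7 v x \<bullet> y)"
    using cross7_inner_swap(2)[of v x y] by (simp add: inner_commute)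
  show ?thesis
    unfolding twist_def
    by (simp only: inner_lin z k s inner_commute[of x v]) algebra
qed

text \<open>With \<open>z = a + \<i> c t\<close> and \<open>t\<^sup>2 = M\<close>, the first and the third condition say \<open>z\<^sup>3 = 1 - \<i> t\<close>:
  on the complex three-space orthogonal to \<open>v\<close>, twisting multiplies the complex volume form
  by \<open>1 - \<i> t\<close>.\<close>

lemma twist_parameters:
  fixes M r :: real
  assumes M: "M \<ge> 0" and r: "r > 0" "r ^ 3 = 1 + M"
  obtains a b c where "a^3 - 3 * a * c^2 * M = 1" "a^2 * b + 4 * a * c^2 + b * c^2 * M = 0"
    "3 * a^2 * c - c^3 * M = -1" "a^2 + c^2 * M = r" "2 * a * b + b^2 * M - c^2 = - 1 / r^2"
proof (cases "M = 0")
  case True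
  \<comment> \<open>The limits of the general values as t tends to 0: the cube root of 1 - i t is 1
    - i t/3 to first order, so c = -1/3, and the second equation gives b.\<close>
  then have "r = 1" using r power_eq_imp_eq_base[of r 3 1] by simp
  with True show ?thesis by (intro that[of 1 "-1/3" "-4/9"]) (simp_all add: power2_eq_square power3_eq_cube)
next
  case False
  define t where "t = sqrt M"
  have t: "t > 0" "t^2 = M" using M False by (auto simp: t_def)
  define w where "w = Complex 1 (- t)"
  have "w \<noteq> 0" by (simp add: w_def complex_eq_iff)
  define z where "z = exp (Ln w / 3)"
  have z3: "z ^ 3 = w"
    using \<open>w \<noteq> 0\<close> exp_of_nat_mult[of 3 "Ln w / 3"] by (simp add: z_def)
  define a p where "a = Re z" and "p = Im z"
  have 1: "a^3 - 3 * a * p^2 = 1" "3 * a^2 * p - p^3 = - t"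
  proof -
    have "Complex a p ^ 3 = Complex (a^3 - 3 * a * p^2) (3 * a^2 * p - p^3)"
      by (simp add: complex_eq_iff power3_eq_cube power2_eq_square algebra_simps)
    moreover have "Complex a p ^ 3 = Complex 1 (- t)"
      using z3 unfolding w_def a_def p_def complex_surj .
    ultimately have "Complex (a^3 - 3 * a * p^2) (3 * a^2 * p - p^3) = Complex 1 (- t)"
      by (rule trans[OF sym])
    then show "a^3 - 3 * a * p^2 = 1" "3 * a^2 * p - p^3 = - t"
      by (simp_all only: complex.inject)
  qed
  \<comment> \<open>Multiplicativity of the complex modulus: |z|^6 = |w|^2 = 1 + M = r^3.\<close>
  have "(a^2 + p^2)^3 = (a^3 - 3 * a * p^2)^2 + (3 * a^2 * p - p^3)^2"
    by (simp add: power2_eq_square power3_eq_cube algebra_simps)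
  also have "\<dots> = r^3" unfolding 1 r(2) t(2)[symmetric] by simp
  finally have n: "a^2 + p^2 = r"
    by (rule power_eq_imp_eq_base[where n = 3]) (use r in auto)
  define c where "c = p / t"
  have p: "p = c * t" using t by (simp add: c_def)
  \<comment> \<open>The second equation reads b r = - 4 a c^2 once a^2 + c^2 M = r is known.\<close>
  define b where "b = - 4 * a * c^2 / r"
  have b: "b * r = - 4 * a * c^2" using r by (simp add: b_def)
  have n': "a^2 + c^2 * M = r" using n t by (simp add: p power_mult_distrib)
  have e1: "a^3 - 3 * a * c^2 * M = 1" using 1(1) t by (simp add: p power_mult_distrib mult.assoc)
  have "t * (3 * a^2 * c - c^3 * M) = t * (-1)"
    using 1(2) unfolding p t(2)[symmetric] by (simp add: power2_eq_square power3_eq_cube algebra_simps)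
  then have e3: "3 * a^2 * c - c^3 * M = -1" by (rule mult_left_cancel[THEN iffD1, rotated]) (use t in simp)
  have e2: "a^2 * b + 4 * a * c^2 + b * c^2 * M = 0" using b unfolding n'[symmetric] by (simp add: algebra_simps)
  \<comment> \<open>The factor on the line of \<open>v\<close> is 1/r. Since the squared factor on
    the complement is r, this determines the coefficient of the square of \<open>v\<close> in the
    metric.\<close>
  have "r * (a + b * M) = a * r + (b * r) * M" by (simp add: power2_eq_square power3_eq_cube algebra_simps)
  also have "\<dots> = a * (a^2 + c^2 * M) + (- 4 * a * c^2) * M" by (simp only: b n')
  also have "\<dots> = a^3 - 3 * a * c^2 * M" by (simp add: power2_eq_square power3_eq_cube algebra_simps)
  finally have l: "r * (a + b * M) = 1" using e1 by simp
  have "M * (r^2 * (2 * a * b + b^2 * M - c^2)) = (r * (a + b * M))^2 - r^2 * (a^2 + c^2 * M)" by (simp add: power2_eq_square power3_eq_cube algebra_simps)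
  also have "\<dots> = 1 - r^3" unfolding l n' by (simp add: power2_eq_square power3_eq_cube algebra_simps)
  also have "\<dots> = M * (-1)" using r by simp
  finally have "M * (r^2 * (2 * a * b + b^2 * M - c^2)) = M * (-1)" .
  then have "r^2 * (2 * a * b + b^2 * M - c^2) = -1" by (rule mult_left_cancel[OF False, THEN iffD1])
  then have "2 * a * b + b^2 * M - c^2 = - 1 / r^2" using r by (simp add: field_simps)
  then show ?thesis by (rule that[OF e1 e2 e3 n'])
qed

text \<open>Everything is read in a frame in which the form is \<open>phi0\<close>. In
  \<open>met\<close>, the derivative of the deformed metric for the old connection is compared with
  the action of \<open>D\<close>; both sides carry the factor r^2, where r^3 = f, so that the metric
  becomes f <y,z> - <v,y> <v,z> and no cube root is left.\<close>

lemma torsion_kernel: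
  fixes A :: "real^7^7" and D :: "real^7 \<Rightarrow> real^7 \<Rightarrow> real^7" and v :: "real^7"
  defines "f \<equiv> 1 + v \<bullet> v" and "p \<equiv> \<lambda>y z w. cross7 y z \<bullet> w + psi0 y z w v"
  assumes sym: "\<And>x y. D x y = D y x"
    and form: "\<And>x y z w. psi0 y z w (A *v x) = p (D x y) z w + p y (D x z) w + p y z (D x w)"
    and met: "\<And>x y z. 2/3 * ((A *v x) \<bullet> v) * (y \<bullet> z) + 4/3 * (((A *v x) \<bullet> v) / f) * (v \<bullet> y) * (v \<bullet> z)
        - ((A *v x) \<bullet> y) * (v \<bullet> z) - (v \<bullet> y) * ((A *v x) \<bullet> z) =
      f * (D x y \<bullet> z) - (v \<bullet> D x y) * (v \<bullet> z) + f * (y \<bullet> D x z) - (v \<bullet> y) * (v \<bullet> D x z)"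
  shows "A = 0"
proof -
  have f: "f > 0" unfolding f_def using inner_ge_zero[of v] by linarith
  have p12: "p z y w = - p y z w" for y z w
    unfolding p_def using cross7_inner_swap(1)[of y z w] psi0_swap12[of y z w v] by simp
  have p23: "p y w z = - p y z w" for y z w
    unfolding p_def using cross7_inner_swap(2)[of y z w] psi0_swap23[of y z w v] by simp
  have p13: "p w z y = - p y z w" for y z w
    using p12[of w z y] p23[of z w y] p12[of z y w] by simp
  \<comment> \<open>Alternation amounts to taking the exterior derivative: the terms with
    \<open>D\<close> cancel in pairs because \<open>D\<close> is symmetric and \<open>p\<close>
    alternating.\<close>
  have alt: "psi0 y z w (A *v x) - psi0 x z w (A *v y) - psi0 y x w (A *v z) - psi0 y z x (A *v w) = 0"
    for x y z w
    unfolding form sym[of y x] sym[of z x] sym[of w x] sym[of z y] sym[of w y] sym[of w z]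
    using p12[of x "D y z" w] p13[of x z "D y w"] p23[of y x "D z w"] by simp
  have psi: "psi0 (A *v x) y z w + psi0 x (A *v y) z w + psi0 x y (A *v z) w + psi0 x y z (A *v w) = 0"
    for x y z w
  proof -
    have "psi0 y z w (A *v x) = - psi0 (A *v x) y z w"
      by (rule psi0_rotate)
    moreover have "psi0 x z w (A *v y) = psi0 x (A *v y) z w"
      using psi0_swap34[of x z w "A *v y"] psi0_swap23[of x z "A *v y" w] by simp
    moreover have "psi0 y x w (A *v z) = psi0 x y (A *v z) w"
      using psi0_swap34[of y x w "A *v z"] psi0_swap12[of y x "A *v z" w] by simp
    moreover have "psi0 y z x (A *v w) = psi0 x y z (A *v w)"
      using psi0_swap23[of y z x "A *v w"] psi0_swap12[of y x z "A *v w"] by simp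
    ultimately show ?thesis using alt[of y z w x] by linarith
  qed
  have skew: "(A *v x) \<bullet> y = - (x \<bullet> (A *v y))" for x y
    using stabilizer_psi0_skew[OF psi] .
  have der: "A *v cross7 x y = cross7 (A *v x) y + cross7 x (A *v y)" for x y
    using stabilizer_psi0_cross7[OF psi] .
  define w where "w = A *v v"
  have Av: "(A *v x) \<bullet> v = - (w \<bullet> x)" for x
    using skew[of x v] by (simp add: w_def inner_commute)
  have vw: "v \<bullet> w = 0"
    using Av[of v] by (simp add: w_def inner_commute)
  \<comment> \<open>As an infinitesimal symmetry of both \<open>phi0\<close> and
    \<open>psi0\<close>, \<open>A\<close> acts on \<open>p\<close> only through the vector
    \<open>v\<close> in the last slot.\<close>
  have pder: "p (A *v y) z u + p y (A *v z) u + p y z (A *v u) = - psi0 y z u w" for y z u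
    using psi[of y z u v] der[of y z] skew[of "cross7 y z" u]
    by (simp add: p_def w_def inner_lin)
  \<comment> \<open>The usual Koszul combination, for the rescaled deformed metric and the symmetric
    tensor \<open>D\<close>.\<close>
  have koszul: "2 * (f * (D x y \<bullet> z) - (v \<bullet> D x y) * (v \<bullet> z)) = K x y z + K y x z - K z x y"
    if K: "\<And>x y z. K x y z = f * (D x y \<bullet> z) - (v \<bullet> D x y) * (v \<bullet> z) + f * (y \<bullet> D x z) - (v \<bullet> y) * (v \<bullet> D x z)"
    for K x y z
    unfolding K sym[of y x] sym[of z x] sym[of z y] by (simp add: inner_commute algebra_simps)
  \<comment> \<open>Taking z = v first shows that the difference is orthogonal to \<open>v\<close>,
    because f - |v|^2 = 1; then only the positive multiple f of the inner product remains.\<close>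
  have nondeg: "q = q'" if "\<And>z. f * (q \<bullet> z) - (v \<bullet> q) * (v \<bullet> z) = f * (q' \<bullet> z) - (v \<bullet> q') * (v \<bullet> z)" for q q'
  proof -
    define s where "s = q - q'"
    have s: "f * (s \<bullet> z) = (v \<bullet> s) * (v \<bullet> z)" for z
      using that[of z] by (simp add: s_def inner_lin algebra_simps)
    have "v \<bullet> s = 0" using s[of v] by (simp add: f_def inner_commute algebra_simps)
    then have "s \<bullet> s = 0" using s[of s] f by simp
    then show ?thesis by (simp add: s_def)
  qed
  have Dv: "D v y = - (1/f) *\<^sub>R ((1/3 * (w \<bullet> y)) *\<^sub>R v + (v \<bullet> v) *\<^sub>R (A *v y)) - (2/3 * (v \<bullet> y) / f^2) *\<^sub>R w" (is "_ = ?R") for y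
  proof (rule nondeg)
    fix z
    define M where "M = v \<bullet> v"
    have fM: "f = 1 + M" by (simp add: f_def M_def)
    have *: "z \<bullet> (A *v y) = (A *v y) \<bullet> z" "(A *v z) \<bullet> y = - ((A *v y) \<bullet> z)" "v \<bullet> (A *v y) = - (w \<bullet> y)" "v \<bullet> (A *v z) = - (w \<bullet> z)"
      "(A *v v) = w"
      using skew[of z y] Av[of y] Av[of z] by (simp_all add: inner_commute w_def)
    have "2 * (f * (D v y \<bullet> z) - (v \<bullet> D v y) * (v \<bullet> z)) =
       2 * (f * (?R \<bullet> z) - (v \<bullet> ?R) * (v \<bullet> z))"
      unfolding koszul[of "\<lambda>x y z. 2/3 * ((A *v x) \<bullet> v) * (y \<bullet> z) + 4/3 * (((A *v x) \<bullet> v) / f) * (v \<bullet> y) * (v \<bullet> z)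
        - ((A *v x) \<bullet> y) * (v \<bullet> z) - (v \<bullet> y) * ((A *v x) \<bullet> z)", OF met]
      using f
      by (simp add: inner_lin Av * vw inner_commute[of w v] inner_commute[of y v] inner_commute[of z v] flip: M_def,
          simp add: field_simps power2_eq_square ,
          simp add: fM field_simps)
    then show "f * (D v y \<bullet> z) - (v \<bullet> D v y) * (v \<bullet> z) = f * (?R \<bullet> z) - (v \<bullet> ?R) * (v \<bullet> z)" by simp
  qed
  have plin: "p (r *\<^sub>R y) z u = r * p y z u" "p y (r *\<^sub>R z) u = r * p y z u" "p y z (r *\<^sub>R u) = r * p y z u" for r y z u
    by (simp_all add: p_def cross7_lin inner_lin psi0_scale algebra_simps)
  have w0: "w = 0"
  proof (cases "v = 0")
    case True then show ?thesis by (simp add: w_def)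
  next
    case False
    show ?thesis
    proof (rule psi0_perp_eq_0[OF _ False])
      show "w \<bullet> v = 0" using vw by (simp add: inner_commute)
      fix y z u assume o: "y \<bullet> w = 0" "z \<bullet> w = 0" "u \<bullet> w = 0" "y \<bullet> v = 0" "z \<bullet> v = 0" "u \<bullet> v = 0"
      \<comment> \<open>On arguments orthogonal to \<open>v\<close> and \<open>w\<close> the map
        D(v, .) is k times \<open>A\<close>, so \<open>pder\<close> makes the right side -k times
        the left. Since -k = |v|^2/(1+|v|^2) differs from 1, the left side is zero.\<close>
      define k where "k = - (v \<bullet> v) / f"
      have d: "D v t = k *\<^sub>R (A *v t)" if "t \<bullet> w = 0" "t \<bullet> v = 0" for t
        using that by (simp add: k_def Dv inner_commute)
      have "psi0 y z u w = p (D v y) z u + p y (D v z) u + p y z (D v u)"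
        using form[of y z u v] by (simp add: w_def)
      also have "\<dots> = k * (p (A *v y) z u + p y (A *v z) u + p y z (A *v u))"
        using o by (simp add: d plin ring_distribs)
      finally have "f * psi0 y z u w = (v \<bullet> v) * psi0 y z u w"
        using f unfolding pder by (simp add: k_def field_simps)
      then have "psi0 y z u w = 0" by (simp add: f_def algebra_simps)
      then show "psi0 w y z u = 0" using psi0_rotate[of y z u w] by simp
    qed
  qed
  \<comment> \<open>With w = 0 the image of \<open>A\<close> is orthogonal to \<open>v\<close>, so
    the first two terms of \<open>met\<close> disappear and Koszul's formula can be solved for all
    arguments.\<close>
  have D: "D x y = - (1/f) *\<^sub>R ((v \<bullet> y) *\<^sub>R (A *v x) + (v \<bullet> x) *\<^sub>R (A *v y))" (is "_ = ?R") for x y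
  proof (rule nondeg)
    fix z
    have *: "(A *v x) \<bullet> v = 0" "v \<bullet> (A *v x) = 0" for x
      using Av[of x] w0 by (simp_all add: inner_commute)
    have sk: "(A *v y) \<bullet> x = - ((A *v x) \<bullet> y)" "(A *v z) \<bullet> x = - ((A *v x) \<bullet> z)" "(A *v z) \<bullet> y = - ((A *v y) \<bullet> z)"
      using skew[of y x] skew[of z x] skew[of z y] by (simp_all add: inner_commute)
    have "2 * (f * (D x y \<bullet> z) - (v \<bullet> D x y) * (v \<bullet> z)) =
       2 * (f * (?R \<bullet> z) - (v \<bullet> ?R) * (v \<bullet> z))"
      unfolding koszul[of "\<lambda>x y z. 2/3 * ((A *v x) \<bullet> v) * (y \<bullet> z) + 4/3 * (((A *v x) \<bullet> v) / f) * (v \<bullet> y) * (v \<bullet> z)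
        - ((A *v x) \<bullet> y) * (v \<bullet> z) - (v \<bullet> y) * ((A *v x) \<bullet> z)", OF met]
      using f by (simp add: inner_lin * sk field_simps)
    then show "f * (D x y \<bullet> z) - (v \<bullet> D x y) * (v \<bullet> z) = f * (?R \<bullet> z) - (v \<bullet> ?R) * (v \<bullet> z)" by simp
  qed
  have perp: "psi0 (A *v x) y z u = 0" if o: "y \<bullet> v = 0" "z \<bullet> v = 0" "u \<bullet> v = 0" for x y z u
  proof -
    define k where "k = - (v \<bullet> x) / f"
    have d: "D x t = k *\<^sub>R (A *v t)" if "t \<bullet> v = 0" for t
      using that by (simp add: k_def D inner_commute)
    have "psi0 y z u (A *v x) = p (D x y) z u + p y (D x z) u + p y z (D x u)"
      by (rule form)
    also have "\<dots> = k * (p (A *v y) z u + p y (A *v z) u + p y z (A *v u))"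
      using o by (simp add: d plin ring_distribs)
    also have "\<dots> = 0" unfolding pder w0 by (simp add: psi0_def cross7_lin)
    finally show ?thesis using psi0_rotate[of y z u "A *v x"] by simp
  qed
  have "A *v x = 0" for x
  proof (cases "v = 0")
    case False
    show ?thesis
      by (rule psi0_perp_eq_0[OF _ False]) (use Av w0 perp in auto)
  next
    case True
    \<comment> \<open>When v = 0, \<open>perp\<close> holds without restriction, so any nonzero
      vector orthogonal to \<open>A *v x\<close> can take the part of \<open>v\<close> in
      \<open>psi0_perp_eq_0\<close>.\<close>
    have "dim {A *v x} \<le> 1"
      by (rule order_trans[OF dim_le_card']) auto
    then have "dim {A *v x} < DIM(real^7)" by simp
    then obtain z where z: "z \<noteq> 0" and o: "\<And>y. y \<in> span {A *v x} \<Longrightarrow> orthogonal z y"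
      using orthogonal_to_subspace_exists by blast
    show ?thesis
      by (rule psi0_perp_eq_0[OF _ z])
        (use o[OF span_base] perp True in \<open>auto simp: orthogonal_def inner_commute\<close>)
  qed
  then show ?thesis
    by (metis matrix_eq matrix_vector_mult_0)
qed

section \<open>Determinants and the Levi-Civita symbol\<close>

definition vec7 :: "'a \<Rightarrow> 'a \<Rightarrow> 'a \<Rightarrow> 'a \<Rightarrow> 'a \<Rightarrow> 'a \<Rightarrow> 'a \<Rightarrow> 7 \<Rightarrow> 'a" where
  "vec7 a b c d e f h = (\<lambda>k. if k = 1 then a else if k = 2 then b else if k = 3 then c
     else if k = 4 then d else if k = 5 then e else if k = 6 then f else h)"

text \<open>The multilinear extension of the Levi-Civita symbol from indices to vectors; a change of
  frame then acts through \<open>det7_mult\<close>.\<close>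

definition det7 :: "real^7 \<Rightarrow> real^7 \<Rightarrow> real^7 \<Rightarrow> real^7 \<Rightarrow> real^7 \<Rightarrow> real^7 \<Rightarrow> real^7 \<Rightarrow> real" where
  "det7 a b c d e f h = det (\<chi> r. vec7 a b c d e f h r)"

lemma vec7_simps [simp]:
  "vec7 a b c d e f h 1 = a" "vec7 a b c d e f h 2 = b" "vec7 a b c d e f h 3 = c"
  "vec7 a b c d e f h 4 = d" "vec7 a b c d e f h 5 = e" "vec7 a b c d e f h 6 = f"
  "vec7 a b c d e f h 7 = h"
  by (simp_all add: vec7_def)

lemma det_axis_rows:
  "det (\<chi> r. axis (s r) 1 :: real^'n^'n) = (if bij s then of_int (sign s) else 0)"
proof (cases "bij s")
  case True
  then have "s permutes UNIV" using bij_imp_permutes[of s UNIV] by simp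
  then have "det (\<chi> r. (mat 1 :: real^'n^'n) $ s r) = of_int (sign s) * det (mat 1 :: real^'n^'n)"
    by (rule det_permute_rows)
  moreover have "(mat 1 :: real^'n^'n) $ i = axis i 1" for i
    by (simp add: mat_def axis_def vec_eq_iff)
  ultimately show ?thesis using True by simp
next
  case False
  then have "\<not> inj s" by (simp add: bij_def finite_UNIV_inj_surj)
  then obtain i j where "i \<noteq> j" "s i = s j" by (auto simp: inj_def)
  then have "det (\<chi> r. axis (s r) 1 :: real^'n^'n) = 0"
    by (intro det_identical_rows[of i j]) (simp_all add: row_def)
  then show ?thesis using False by simp
qed

lemma levi_civita_symbol_det7:
  "levi_civita_symbol a b c d e f h =
     det7 (axis a 1) (axis b 1) (axis c 1) (axis d 1) (axis e 1) (axis f 1) (axis h 1)"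
proof -
  have "levi_civita_symbol a b c d e f h = (if bij (vec7 a b c d e f h) then of_int (sign (vec7 a b c d e f h)) else 0)"
    unfolding levi_civita_symbol_def vec7_def Let_def ..
  also have "\<dots> = det (\<chi> r. axis (vec7 a b c d e f h r) 1 :: real^7^7)"
    by (rule det_axis_rows[symmetric])
  also have "(\<chi> r. axis (vec7 a b c d e f h r) 1 :: real^7^7) =
     (\<chi> r. vec7 (axis a 1) (axis b 1) (axis c 1) (axis d 1) (axis e 1) (axis f 1) (axis h 1) r)"
    by (simp add: vec_eq_iff forall_7)
  finally show ?thesis by (simp add: det7_def)
qed

lemma det7_mult:
  "det7 (P *v a) (P *v b) (P *v c) (P *v d) (P *v e) (P *v f) (P *v h) = det P * det7 a b c d e f h"
proof -
  have "(\<chi> r. vec7 (P *v a) (P *v b) (P *v c) (P *v d) (P *v e) (P *v f) (P *v h) r) =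
     (\<chi> r. vec7 a b c d e f h r) ** transpose P"
    unfolding vec_eq_iff forall_7
    by (simp add: matrix_matrix_mult_def matrix_vector_mult_def transpose_def mult.commute)
  then show ?thesis by (simp add: det7_def det_mul det_transpose)
qed

lemma det_linear_row:
  fixes c :: "'n::finite \<Rightarrow> real^'n"
  shows "linear (\<lambda>x. det (\<chi> i. if i = k then x else c i))"
proof (rule linearI)
  fix x y :: "real^'n" and r :: real
  show "det (\<chi> i. if i = k then x + y else c i) = det (\<chi> i. if i = k then x else c i) + det (\<chi> i. if i = k then y else c i)"
    using det_row_add[of k "\<lambda>_. x" "\<lambda>_. y" c] by simp
  show "det (\<chi> i. if i = k then r *\<^sub>R x else c i) = r *\<^sub>R det (\<chi> i. if i = k then x else c i)"
    using det_row_mul[of k r "\<lambda>_. x" c] unfolding scalar_mult_eq_scaleR by simp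
qed

lemma linear_det7:
  "linear (\<lambda>x. det7 x b c d e f h)" "linear (\<lambda>x. det7 a x c d e f h)" "linear (\<lambda>x. det7 a b x d e f h)"
  "linear (\<lambda>x. det7 a b c x e f h)" "linear (\<lambda>x. det7 a b c d x f h)" "linear (\<lambda>x. det7 a b c d e x h)"
  "linear (\<lambda>x. det7 a b c d e f x)"
proof -
  have "(\<lambda>x. det7 x b c d e f h) = (\<lambda>x. det (\<chi> i. if i = 1 then x else vec7 0 b c d e f h i))"
    "(\<lambda>x. det7 a x c d e f h) = (\<lambda>x. det (\<chi> i. if i = 2 then x else vec7 a 0 c d e f h i))"
    "(\<lambda>x. det7 a b x d e f h) = (\<lambda>x. det (\<chi> i. if i = 3 then x else vec7 a b 0 d e f h i))"
    "(\<lambda>x. det7 a b c x e f h) = (\<lambda>x. det (\<chi> i. if i = 4 then x else vec7 a b c 0 e f h i))"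
    "(\<lambda>x. det7 a b c d x f h) = (\<lambda>x. det (\<chi> i. if i = 5 then x else vec7 a b c d 0 f h i))"
    "(\<lambda>x. det7 a b c d e x h) = (\<lambda>x. det (\<chi> i. if i = 6 then x else vec7 a b c d e 0 h i))"
    "(\<lambda>x. det7 a b c d e f x) = (\<lambda>x. det (\<chi> i. if i = 7 then x else vec7 a b c d e f 0 i))"
    unfolding det7_def fun_eq_iff by (intro allI arg_cong[where f = det]; simp add: vec_eq_iff forall_7)+
  then show "linear (\<lambda>x. det7 x b c d e f h)" "linear (\<lambda>x. det7 a x c d e f h)" "linear (\<lambda>x. det7 a b x d e f h)"
  "linear (\<lambda>x. det7 a b c x e f h)" "linear (\<lambda>x. det7 a b c d x f h)" "linear (\<lambda>x. det7 a b c d e x h)"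
  "linear (\<lambda>x. det7 a b c d e f x)"
    by (simp_all only: det_linear_row)
qed

lemma det7_swap:
  "det7 a b c d e f h = - det7 b a c d e f h" "det7 a b c d e f h = - det7 a c b d e f h"
  "det7 a b c d e f h = - det7 a b d c e f h" "det7 a b c d e f h = - det7 a b c e d f h"
  "det7 a b c d e f h = - det7 a b c d f e h" "det7 a b c d e f h = - det7 a b c d e h f"
proof -
  have s: "det (\<chi> i. w (Transposition.transpose k l i)) = - det (\<chi> i. w i)" if "k \<noteq> l"
    for w :: "7 \<Rightarrow> real^7" and k l
    using det_permute_rows[of "Transposition.transpose k l" "\<chi> i. w i"] that
    by (simp add: permutes_swap_id sign_swap_id)
  have t: "vec7 b a c d e f h = (\<lambda>i. vec7 a b c d e f h (Transposition.transpose 1 2 i))"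
    "vec7 a c b d e f h = (\<lambda>i. vec7 a b c d e f h (Transposition.transpose 2 3 i))"
    "vec7 a b d c e f h = (\<lambda>i. vec7 a b c d e f h (Transposition.transpose 3 4 i))"
    "vec7 a b c e d f h = (\<lambda>i. vec7 a b c d e f h (Transposition.transpose 4 5 i))"
    "vec7 a b c d f e h = (\<lambda>i. vec7 a b c d e f h (Transposition.transpose 5 6 i))"
    "vec7 a b c d e h f = (\<lambda>i. vec7 a b c d e f h (Transposition.transpose 6 7 i))"
    unfolding fun_eq_iff forall_7 by (simp_all add: Transposition.transpose_def)
  show "det7 a b c d e f h = - det7 b a c d e f h" "det7 a b c d e f h = - det7 a c b d e f h"
  "det7 a b c d e f h = - det7 a b d c e f h" "det7 a b c d e f h = - det7 a b c e d f h"
  "det7 a b c d e f h = - det7 a b c d f e h" "det7 a b c d e f h = - det7 a b c d e h f"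
    unfolding det7_def t by (simp_all add: s)
qed

lemma det7_rotate: "det7 a b c d e f h = det7 b c d e f h a"
  using det7_swap(1)[of a b c d e f h] det7_swap(2)[of b a c d e f h] det7_swap(3)[of b c a d e f h]
    det7_swap(4)[of b c d a e f h] det7_swap(5)[of b c d e a f h] det7_swap(6)[of b c d e f a h]
  by simp

lemma levi_civita_not_distinct: "\<not> distinct [a, b, c, d, e, f, h] \<Longrightarrow> levi_civita_symbol a b c d e f h = 0"
proof -
  assume nd: "\<not> distinct [a, b, c, d, e, f, h]"
  have "inj (vec7 a b c d e f h) \<Longrightarrow> distinct [a, b, c, d, e, f, h]"
    unfolding inj_def forall_7 by simp
  with nd have "\<not> bij (vec7 a b c d e f h)" by (auto simp: bij_def)
  then show ?thesis
    unfolding levi_civita_symbol_def vec7_def Let_def by simp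
qed

text \<open>The seven index triples of \<open>phi0\<close>, each preceded by its complement. An even
  number of adjacent swaps sorts every row, so the signs in the dual form are those of
  \<open>phi0\<close>.\<close>

lemma levi_civita_values:
  shows "levi_civita_symbol 4 5 6 7 1 2 3 = 1"
    and "levi_civita_symbol 2 3 6 7 1 4 5 = 1"
    and "levi_civita_symbol 2 3 4 5 1 6 7 = 1"
    and "levi_civita_symbol 1 3 5 7 2 4 6 = 1"
    and "levi_civita_symbol 1 3 4 6 2 5 7 = 1"
    and "levi_civita_symbol 1 2 5 6 3 4 7 = 1"
    and "levi_civita_symbol 1 2 4 7 3 5 6 = 1"
proof -
  note sw = det7_swap[of "axis _ 1" "axis _ 1" "axis _ 1" "axis _ 1" "axis _ 1" "axis _ 1" "axis _ 1", folded levi_civita_symbol_det7]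
  have "(\<chi> r. vec7 (axis 1 1) (axis 2 1) (axis 3 1) (axis 4 1) (axis 5 1) (axis 6 1) (axis 7 1) r) = (mat 1 :: real^7^7)"
    by (simp add: vec_eq_iff forall_7 mat_def axis_def)
  then have lc_id: "levi_civita_symbol 1 2 3 4 5 6 7 = 1"
    by (simp add: levi_civita_symbol_det7 det7_def)
  show "levi_civita_symbol 4 5 6 7 1 2 3 = 1"
    using lc_id sw(4)[of 4 5 6 7 1 2 3] sw(3)[of 4 5 6 1 7 2 3] sw(2)[of 4 5 1 6 7 2 3] sw(1)[of 4 1 5 6 7 2 3] sw(5)[of 1 4 5 6 7 2 3] sw(4)[of 1 4 5 6 2 7 3] sw(3)[of 1 4 5 2 6 7 3] sw(2)[of 1 4 2 5 6 7 3] sw(6)[of 1 2 4 5 6 7 3] sw(5)[of 1 2 4 5 6 3 7] sw(4)[of 1 2 4 5 3 6 7] sw(3)[of 1 2 4 3 5 6 7] by linarith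
  show "levi_civita_symbol 2 3 6 7 1 4 5 = 1"
    using lc_id sw(4)[of 2 3 6 7 1 4 5] sw(3)[of 2 3 6 1 7 4 5] sw(2)[of 2 3 1 6 7 4 5] sw(1)[of 2 1 3 6 7 4 5] sw(5)[of 1 2 3 6 7 4 5] sw(4)[of 1 2 3 6 4 7 5] sw(6)[of 1 2 3 4 6 7 5] sw(5)[of 1 2 3 4 6 5 7] by linarith
  show "levi_civita_symbol 2 3 4 5 1 6 7 = 1"
    using lc_id sw(4)[of 2 3 4 5 1 6 7] sw(3)[of 2 3 4 1 5 6 7] sw(2)[of 2 3 1 4 5 6 7] sw(1)[of 2 1 3 4 5 6 7] by linarith
  show "levi_civita_symbol 1 3 5 7 2 4 6 = 1"
    using lc_id sw(4)[of 1 3 5 7 2 4 6] sw(3)[of 1 3 5 2 7 4 6] sw(2)[of 1 3 2 5 7 4 6] sw(5)[of 1 2 3 5 7 4 6] sw(4)[of 1 2 3 5 4 7 6] sw(6)[of 1 2 3 4 5 7 6] by linarith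
  show "levi_civita_symbol 1 3 4 6 2 5 7 = 1"
    using lc_id sw(4)[of 1 3 4 6 2 5 7] sw(3)[of 1 3 4 2 6 5 7] sw(2)[of 1 3 2 4 6 5 7] sw(5)[of 1 2 3 4 6 5 7] by linarith
  show "levi_civita_symbol 1 2 5 6 3 4 7 = 1"
    using lc_id sw(4)[of 1 2 5 6 3 4 7] sw(3)[of 1 2 5 3 6 4 7] sw(5)[of 1 2 3 5 6 4 7] sw(4)[of 1 2 3 5 4 6 7] by linarith
  show "levi_civita_symbol 1 2 4 7 3 5 6 = 1"
    using lc_id sw(4)[of 1 2 4 7 3 5 6] sw(3)[of 1 2 4 3 7 5 6] sw(5)[of 1 2 3 4 7 5 6] sw(6)[of 1 2 3 4 5 7 6] by linarith
qed

text \<open>Labels are residues with 7 = 0; ranking them by natural numbers puts 7 last.\<close>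

definition index7 :: "7 \<Rightarrow> nat" where
  "index7 k = (if k = 1 then 1 else if k = 2 then 2 else if k = 3 then 3 else if k = 4 then 4
     else if k = 5 then 5 else if k = 6 then 6 else 7)"

lemma index7_values:
  "index7 1 = 1" "index7 2 = 2" "index7 3 = 3" "index7 4 = 4" "index7 5 = 5" "index7 6 = 6" "index7 7 = 7"
  by (simp_all add: index7_def)

lemma index7_eq_iff: "index7 a = index7 b \<longleftrightarrow> a = b"
  using exhaust_7[of a] exhaust_7[of b] by (elim disjE; simp add: index7_values)

text \<open>Room for the other labels forces b to be at most 5 and c at least 3. Each half then has
  ten possibilities, and matching the halves is far cheaper than running through all quadruples of
  labels.\<close>

lemma increasing_quadruple:
  assumes "index7 a < index7 b" "index7 b < index7 c" "index7 c < index7 d"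
  shows "(a, b, c, d) \<in> {(1, 2, 3, 4), (1, 2, 3, 5), (1, 2, 3, 6), (1, 2, 3, 7), (1, 2, 4, 5), (1, 2, 4, 6), (1, 2, 4, 7), (1, 2, 5, 6), (1, 2, 5, 7), (1, 2, 6, 7), (1, 3, 4, 5), (1, 3, 4, 6), (1, 3, 4, 7), (1, 3, 5, 6), (1, 3, 5, 7), (1, 3, 6, 7), (1, 4, 5, 6), (1, 4, 5, 7), (1, 4, 6, 7), (1, 5, 6, 7), (2, 3, 4, 5), (2, 3, 4, 6), (2, 3, 4, 7), (2, 3, 5, 6), (2, 3, 5, 7), (2, 3, 6, 7), (2, 4, 5, 6), (2, 4, 5, 7), (2, 4, 6, 7), (2, 5, 6, 7), (3, 4, 5, 6), (3, 4, 5, 7), (3, 4, 6, 7), (3, 5, 6, 7), (4, 5, 6, 7)}"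
proof -
  have b: "index7 k \<le> 7" "index7 k \<ge> 1" for k by (simp_all add: index7_def)
  have ab: "index7 a < index7 b" "index7 b \<le> 5" and cd: "index7 c < index7 d" "index7 c \<ge> 3"
    using assms b[of d] b[of a] by linarith+
  have "(a, b) \<in> {(1, 2), (1, 3), (1, 4), (1, 5), (2, 3), (2, 4), (2, 5), (3, 4), (3, 5), (4, 5)}"
    using ab exhaust_7[of a] exhaust_7[of b] by (elim disjE; hypsubst; simp add: index7_values)
  moreover have "(c, d) \<in> {(3, 4), (3, 5), (3, 6), (3, 7), (4, 5), (4, 6), (4, 7), (5, 6), (5, 7), (6, 7)}"
    using cd exhaust_7[of c] exhaust_7[of d] by (elim disjE; hypsubst; simp add: index7_values)
  ultimately show ?thesis
    using assms(2) unfolding insert_iff empty_iff prod.inject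
    by (elim disjE conjE FalseE; hypsubst; simp add: index7_values)
qed

text \<open>Insertion sort: the last argument is moved into an increasing triple, then the third
  into an increasing pair, then the first two are compared. Equal neighbours give zero by
  antisymmetry.\<close>

lemma alternating4_eq_0:
  fixes F :: "7 \<Rightarrow> 7 \<Rightarrow> 7 \<Rightarrow> 7 \<Rightarrow> real"
  assumes s12: "\<And>a b c d. F b a c d = - F a b c d"
    and s23: "\<And>a b c d. F a c b d = - F a b c d"
    and s34: "\<And>a b c d. F a b d c = - F a b c d"
    and F: "\<And>a b c d. index7 a < index7 b \<Longrightarrow> index7 b < index7 c \<Longrightarrow> index7 c < index7 d \<Longrightarrow> F a b c d = 0"
  shows "F a b c d = 0"
proof -
  have e12: "F a a c d = 0" for a c d using s12[of a a c d] by simp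
  have e23: "F a b b d = 0" for a b d using s23[of a b b d] by simp
  have e34: "F a b c c = 0" for a b c using s34[of a b c c] by simp
  have lt: "a = b \<or> index7 a < index7 b \<or> index7 b < index7 a" for a b
    using index7_eq_iff[of a b] by linarith
  have 1: "F a b c d = 0" if "index7 a < index7 b" "index7 b < index7 c" for a b c d
  proof -
    have "F a b c d = - F a b d c" "F a b d c = - F a d b c" "F a d b c = - F d a b c"
      by (rule s34 s23 s12)+
    then show ?thesis
      using that lt[of c d] lt[of b d] lt[of a d] F[of a b c d] F[of a b d c] F[of a d b c] F[of d a b c]
        e34[of a b c] e23[of a b c] e12[of a b c] by auto
  qed
  have 2: "F a b c d = 0" if "index7 a < index7 b" for a b c d
  proof -
    have "F a b c d = - F a c b d" "F a c b d = - F c a b d"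
      by (rule s23 s12)+
    then show ?thesis
      using that lt[of b c] lt[of a c] 1[of a b c d] 1[of a c b d] 1[of c a b d]
        e23[of a b d] e12[of a b d] by auto
  qed
  show ?thesis
    using lt[of a b] 2[of a b c d] 2[of b a c d] e12[of a c d] s12[of a b c d] by auto
qed

text \<open>Identifies \<open>psi0\<close> as the Hodge dual of \<open>phi0\<close>; the 6 counts
  the orderings of a triple. Both sides alternate, so increasing quadruples suffice, and for each of
  them at most one of the seven symbols in \<open>L\<close> is nonzero, the one whose triple is the
  complement.\<close>

lemma sum_phi0_levi_civita:
  "(\<Sum>e\<in>UNIV. \<Sum>f\<in>UNIV. \<Sum>h\<in>UNIV. phi0 e f h * levi_civita_symbol a b c d e f h) =
     6 * psi0 (axis a 1) (axis b 1) (axis c 1) (axis d 1)"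
proof -
  define L where "L = (\<lambda>a b c d. levi_civita_symbol a b c d 1 2 3 + levi_civita_symbol a b c d 1 4 5
    + levi_civita_symbol a b c d 1 6 7 + levi_civita_symbol a b c d 2 4 6 - levi_civita_symbol a b c d 2 5 7
    - levi_civita_symbol a b c d 3 4 7 - levi_civita_symbol a b c d 3 5 6)"
  note sw = det7_swap[of "axis _ 1" "axis _ 1" "axis _ 1" "axis _ 1" "axis _ 1" "axis _ 1" "axis _ 1", folded levi_civita_symbol_det7]
  have p: "levi_civita_symbol a b c d f e h = - levi_civita_symbol a b c d e f h"
    "levi_civita_symbol a b c d e h f = - levi_civita_symbol a b c d e f h" for e f h
    by (rule sw(5), rule sw(6))
  have B: "levi_civita_symbol a b c d p q r + levi_civita_symbol a b c d r p q + levi_civita_symbol a b c d q r p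
    - levi_civita_symbol a b c d p r q - levi_civita_symbol a b c d q p r - levi_civita_symbol a b c d r q p
    = 6 * levi_civita_symbol a b c d p q r" for p q r
    using p(1)[of q p r] p(2)[of p r q] p(1)[of r p q] p(2)[of q r p] p(2)[of r q p] p(1)[of q r p] by linarith
  have "(\<Sum>e\<in>UNIV. \<Sum>f\<in>UNIV. \<Sum>h\<in>UNIV. phi0 e f h * levi_civita_symbol a b c d e f h) = 6 * L a b c d"
    unfolding sum_phi0 Let_def B L_def by simp
  moreover have "L a b c d - psi0 (axis a 1) (axis b 1) (axis c 1) (axis d 1) = 0"
  proof (rule alternating4_eq_0)
    fix a b c d :: 7
    show "L b a c d - psi0 (axis b 1) (axis a 1) (axis c 1) (axis d 1) = - (L a b c d - psi0 (axis a 1) (axis b 1) (axis c 1) (axis d 1))"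
      unfolding L_def psi0_swap12[of "axis b 1"] sw(1)[of b a] by simp
    show "L a c b d - psi0 (axis a 1) (axis c 1) (axis b 1) (axis d 1) = - (L a b c d - psi0 (axis a 1) (axis b 1) (axis c 1) (axis d 1))"
      unfolding L_def psi0_swap23[of "axis a 1" "axis c 1"] sw(2)[of a c b] by simp
    show "L a b d c - psi0 (axis a 1) (axis b 1) (axis d 1) (axis c 1) = - (L a b c d - psi0 (axis a 1) (axis b 1) (axis c 1) (axis d 1))"
      unfolding L_def psi0_swap34[of "axis a 1" "axis b 1" "axis d 1"] sw(3)[of a b d c] by simp
    assume o: "index7 a < index7 b" "index7 b < index7 c" "index7 c < index7 d"
    show "L a b c d - psi0 (axis a 1) (axis b 1) (axis c 1) (axis d 1) = 0"
      using increasing_quadruple[OF o]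
      unfolding insert_iff empty_iff prod.inject L_def
      by (elim disjE conjE FalseE; hypsubst; simp add: levi_civita_values levi_civita_not_distinct psi0_def cross7_axis inner_axis axis_component)
  qed
  ultimately show ?thesis by simp
qed

section \<open>Metric, volume and Hodge dual in a frame\<close>

lemma linear_expand:
  fixes f :: "real^'n \<Rightarrow> real"
  assumes "linear f"
  shows "f x = (\<Sum>i\<in>UNIV. x $ i * f (axis i 1))"
proof -
  have "f x = f (\<Sum>i\<in>UNIV. x $ i *\<^sub>R axis i 1)"
    using basis_expansion[of x] by (simp add: scalar_mult_eq_scaleR)
  then show ?thesis
    using assms by (simp add: linear_sum linear_cmul)
qed

lemma trilinear_expand:
  fixes f :: "real^'n \<Rightarrow> real^'n \<Rightarrow> real^'n \<Rightarrow> real"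
  assumes "\<And>y z. linear (\<lambda>x. f x y z)" "\<And>x z. linear (\<lambda>y. f x y z)" "\<And>x y. linear (\<lambda>z. f x y z)"
  shows "f x y z = (\<Sum>i\<in>UNIV. \<Sum>j\<in>UNIV. \<Sum>k\<in>UNIV. x $ i * y $ j * z $ k * f (axis i 1) (axis j 1) (axis k 1))"
proof -
  have "f x y z = (\<Sum>i\<in>UNIV. x $ i * f (axis i 1) y z)"
    by (rule linear_expand[OF assms(1)])
  also have "\<dots> = (\<Sum>i\<in>UNIV. x $ i * (\<Sum>j\<in>UNIV. y $ j * f (axis i 1) (axis j 1) z))"
    by (subst linear_expand[OF assms(2)]) (rule refl)
  also have "\<dots> = (\<Sum>i\<in>UNIV. x $ i * (\<Sum>j\<in>UNIV. y $ j * (\<Sum>k\<in>UNIV. z $ k * f (axis i 1) (axis j 1) (axis k 1))))"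
    by (subst linear_expand[OF assms(3)]) (rule refl)
  finally show ?thesis by (simp add: sum_distrib_left mult.assoc)
qed

lemma quadrilinear_expand:
  fixes f :: "real^'n \<Rightarrow> real^'n \<Rightarrow> real^'n \<Rightarrow> real^'n \<Rightarrow> real"
  assumes "\<And>y z w. linear (\<lambda>x. f x y z w)" "\<And>x z w. linear (\<lambda>y. f x y z w)"
    "\<And>x y w. linear (\<lambda>z. f x y z w)" "\<And>x y z. linear (\<lambda>w. f x y z w)"
  shows "f x y z w = (\<Sum>i\<in>UNIV. \<Sum>j\<in>UNIV. \<Sum>k\<in>UNIV. \<Sum>l\<in>UNIV.
     x $ i * y $ j * z $ k * w $ l * f (axis i 1) (axis j 1) (axis k 1) (axis l 1))"
proof -
  have "f x y z w = (\<Sum>i\<in>UNIV. x $ i * f (axis i 1) y z w)"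
    by (rule linear_expand[OF assms(1)])
  also have "\<dots> = (\<Sum>i\<in>UNIV. x $ i * (\<Sum>j\<in>UNIV. \<Sum>k\<in>UNIV. \<Sum>l\<in>UNIV.
     y $ j * z $ k * w $ l * f (axis i 1) (axis j 1) (axis k 1) (axis l 1)))"
    by (subst trilinear_expand[of "f (axis _ 1)", OF assms(2-4)]) (rule refl)
  finally show ?thesis by (simp add: sum_distrib_left mult.assoc)
qed

lemma linear_psi0:
  "linear (\<lambda>x. psi0 x y z w)" "linear (\<lambda>y. psi0 x y z w)" "linear (\<lambda>z. psi0 x y z w)" "linear (\<lambda>w. psi0 x y z w)"
  by (intro linearI; simp add: psi0_add psi0_scale)+

lemma linear_cross7_inner:
  "linear (\<lambda>x. cross7 x y \<bullet> z)" "linear (\<lambda>y. cross7 x y \<bullet> z)" "linear (\<lambda>z. cross7 x y \<bullet> z)"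
  by (intro linearI; simp add: cross7_lin inner_lin)+

lemma sum3_swap:
  "(\<Sum>a\<in>A. \<Sum>b\<in>B. \<Sum>c\<in>C. \<Sum>p\<in>D. X a b c p) = (\<Sum>p\<in>D. \<Sum>a\<in>A. \<Sum>b\<in>B. \<Sum>c\<in>C. X a b c p)"
  by (simp only: sum.swap[where B = D])

lemma sum33_swap:
  "(\<Sum>a\<in>A. \<Sum>b\<in>B. \<Sum>c\<in>C. \<Sum>p\<in>D. \<Sum>q\<in>E. \<Sum>r\<in>F. X a b c p q r) =
   (\<Sum>p\<in>D. \<Sum>q\<in>E. \<Sum>r\<in>F. \<Sum>a\<in>A. \<Sum>b\<in>B. \<Sum>c\<in>C. X a b c p q r)"
  unfolding sum3_swap[where D = D] sum3_swap[where D = E] sum3_swap[where D = F] ..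

lemma linear_cmult: "linear f \<Longrightarrow> linear (\<lambda>x. c * f x :: real)"
  by (auto simp: linear_iff algebra_simps)

lemma sum_phi0_det7:
  "(\<Sum>e\<in>UNIV. \<Sum>f\<in>UNIV. \<Sum>h\<in>UNIV. phi0 e f h * det7 x y z w (axis e 1) (axis f 1) (axis h 1)) = 6 * psi0 x y z w"
  (is "?L x y z w = _")
proof -
  have L: "linear (\<lambda>x. ?L x y z w)" "linear (\<lambda>y. ?L x y z w)" "linear (\<lambda>z. ?L x y z w)" "linear (\<lambda>w. ?L x y z w)" for x y z w
    by (intro linear_compose_sum ballI linear_cmult linear_det7)+
  have "?L x y z w = (\<Sum>i\<in>UNIV. \<Sum>j\<in>UNIV. \<Sum>k\<in>UNIV. \<Sum>l\<in>UNIV.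
     x $ i * y $ j * z $ k * w $ l * ?L (axis i 1) (axis j 1) (axis k 1) (axis l 1))"
    by (rule quadrilinear_expand[of ?L, OF L])
  also have "\<dots> = 6 * (\<Sum>i\<in>UNIV. \<Sum>j\<in>UNIV. \<Sum>k\<in>UNIV. \<Sum>l\<in>UNIV.
     x $ i * y $ j * z $ k * w $ l * psi0 (axis i 1) (axis j 1) (axis k 1) (axis l 1))"
    unfolding levi_civita_symbol_det7[symmetric] sum_phi0_levi_civita by (simp add: sum_distrib_left mult_ac)
  also have "\<dots> = 6 * psi0 x y z w"
    by (subst quadrilinear_expand[of psi0, OF linear_psi0]) (rule refl)
  finally show ?thesis .
qed

text \<open>The columns of \<open>P\<close> and the rows of \<open>R\<close> are dual frames, and
  contraction over dual frames does not depend on the frame.\<close>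

lemma sum_inverse_frames:
  fixes K :: "real^'n \<Rightarrow> real^'n \<Rightarrow> real" and P R :: "real^'n^'n"
  assumes K: "\<And>y. linear (\<lambda>x. K x y)" "\<And>x. linear (K x)" and PR: "P ** R = mat 1"
  shows "(\<Sum>a\<in>UNIV. K (P *v axis a 1) (transpose R *v axis a 1)) = (\<Sum>a\<in>UNIV. K (axis a 1) (axis a 1))"
proof -
  have "(\<Sum>a\<in>UNIV. K (P *v axis a 1) (transpose R *v axis a 1)) =
    (\<Sum>a\<in>UNIV. \<Sum>i\<in>UNIV. \<Sum>j\<in>UNIV. P $ i $ a * R $ a $ j * K (axis i 1) (axis j 1))"
  proof (rule sum.cong[OF refl])
    fix a
    have "K (P *v axis a 1) (transpose R *v axis a 1) =
      (\<Sum>i\<in>UNIV. (P *v axis a 1) $ i * (\<Sum>j\<in>UNIV. (transpose R *v axis a 1) $ j * K (axis i 1) (axis j 1)))"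
      by (subst linear_expand[OF K(1)], subst linear_expand[OF K(2)]) (rule refl)
    then show "K (P *v axis a 1) (transpose R *v axis a 1) = (\<Sum>i\<in>UNIV. \<Sum>j\<in>UNIV. P $ i $ a * R $ a $ j * K (axis i 1) (axis j 1))"
      by (simp add: matrix_vector_mult_basis column_def transpose_def sum_distrib_left mult.assoc)
  qed
  also have "\<dots> = (\<Sum>i\<in>UNIV. \<Sum>a\<in>UNIV. \<Sum>j\<in>UNIV. P $ i $ a * R $ a $ j * K (axis i 1) (axis j 1))"
    by (rule sum.swap)
  also have "\<dots> = (\<Sum>i\<in>UNIV. \<Sum>j\<in>UNIV. \<Sum>a\<in>UNIV. P $ i $ a * R $ a $ j * K (axis i 1) (axis j 1))"
    by (rule sum.cong[OF refl], rule sum.swap)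
  also have "\<dots> = (\<Sum>i\<in>UNIV. \<Sum>j\<in>UNIV. (P ** R) $ i $ j * K (axis i 1) (axis j 1))"
    by (simp add: matrix_matrix_mult_def sum_distrib_right)
  also have "\<dots> = (\<Sum>a\<in>UNIV. K (axis a 1) (axis a 1))"
    unfolding PR by (simp add: mat_def if_distrib[of "\<lambda>t. t * _"] cong: if_cong)
  finally show ?thesis .
qed

text \<open>The three terms in the definition of \<open>psi0\<close> contribute 36, -6 and -6: a
  pairing of the traces 6 u and 6 w, and twice the trace of <u * e, w * e> over the basis vectors e,
  which is 6 <u,w>.\<close>

lemma psi0_contract:
  "(\<Sum>a\<in>UNIV. \<Sum>b\<in>UNIV. \<Sum>c\<in>UNIV. \<Sum>d\<in>UNIV. (cross7 u (axis a 1) \<bullet> axis b 1) * (cross7 w (axis c 1) \<bullet> axis d 1)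
     * psi0 (axis a 1) (axis b 1) (axis c 1) (axis d 1)) = 24 * (u \<bullet> w)"
proof -
  have "(\<Sum>d\<in>UNIV. (cross7 u (axis a 1) \<bullet> axis b 1) * (cross7 w (axis c 1) \<bullet> axis d 1) * psi0 (axis a 1) (axis b 1) (axis c 1) (axis d 1))
     = (cross7 u (axis a 1) \<bullet> axis b 1) * psi0 (axis a 1) (axis b 1) (axis c 1) (cross7 w (axis c 1))" for a b c
    by (subst linear_expand[OF linear_psi0(4)]) (simp add: sum_distrib_left inner_axis mult_ac)
  moreover have "(\<Sum>b\<in>UNIV. \<Sum>c\<in>UNIV. (cross7 u (axis a 1) \<bullet> axis b 1) * psi0 (axis a 1) (axis b 1) (axis c 1) (cross7 w (axis c 1)))
     = (\<Sum>c\<in>UNIV. psi0 (axis a 1) (cross7 u (axis a 1)) (axis c 1) (cross7 w (axis c 1)))" for a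
    by (subst sum.swap, subst (2) linear_expand[OF linear_psi0(2)]) (simp add: inner_axis mult_ac)
  ultimately have "(\<Sum>a\<in>UNIV. \<Sum>b\<in>UNIV. \<Sum>c\<in>UNIV. \<Sum>d\<in>UNIV. (cross7 u (axis a 1) \<bullet> axis b 1) * (cross7 w (axis c 1) \<bullet> axis d 1)
     * psi0 (axis a 1) (axis b 1) (axis c 1) (axis d 1)) = 
     (\<Sum>a\<in>UNIV. \<Sum>c\<in>UNIV. psi0 (axis a 1) (cross7 u (axis a 1)) (axis c 1) (cross7 w (axis c 1)))" (is "_ = ?S") by simp
  have c: "cross7 x (cross7 u x) = (x \<bullet> x) *\<^sub>R u - (x \<bullet> u) *\<^sub>R x" for x u
    using cross7_cross7[of x u] cross7_skew[of u x] by (simp add: cross7_lin)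
  have s: "(\<Sum>a\<in>UNIV. cross7 (axis a 1) (cross7 u (axis a 1))) = 6 *\<^sub>R u" for u
  proof -
    have "(\<Sum>a\<in>UNIV. cross7 (axis a 1) (cross7 u (axis a 1))) = (\<Sum>a\<in>UNIV. u - u $ a *\<^sub>R axis a 1)"
      by (simp add: c inner_axis' inner_axis)
    also have "\<dots> = 7 *\<^sub>R u - u"
      using basis_expansion[of u] by (simp add: sum_subtractf scalar_mult_eq_scaleR sum_constant_scaleR del: sum_constant)
    also have "\<dots> = 6 *\<^sub>R u" using scaleR_left_diff_distrib[of 7 1 u] by simp
    finally show ?thesis .
  qed
  have t: "(\<Sum>a\<in>UNIV. cross7 u (axis a 1) \<bullet> cross7 w (axis a 1)) = 6 * (u \<bullet> w)"
  proof -
    have "cross7 u (axis a 1) \<bullet> cross7 w (axis a 1) = u \<bullet> w - u $ a * w $ a" for a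
      using cross7_inner_cross7_left[of "axis a 1" u w] cross7_skew[of u "axis a 1"] cross7_skew[of w "axis a 1"]
      by (simp add: inner_lin inner_axis inner_axis')
    then show ?thesis by (simp add: sum_subtractf) (simp add: inner_vec_def)
  qed
  have "?S = (\<Sum>a\<in>UNIV. cross7 (axis a 1) (cross7 u (axis a 1))) \<bullet> (\<Sum>c\<in>UNIV. cross7 (axis c 1) (cross7 w (axis c 1)))
     - (\<Sum>a\<in>UNIV. \<Sum>c\<in>UNIV. ((axis a 1 :: real^7) \<bullet> axis c 1) * (cross7 u (axis a 1) \<bullet> cross7 w (axis c 1)))
     + (\<Sum>a\<in>UNIV. \<Sum>c\<in>UNIV. (axis a 1 \<bullet> cross7 w (axis c 1)) * (cross7 u (axis a 1) \<bullet> axis c 1))"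
    unfolding psi0_def inner_sum_left by (simp add: sum.distrib sum_subtractf inner_sum_right)
  also have "(\<Sum>a\<in>UNIV. \<Sum>c\<in>UNIV. ((axis a 1 :: real^7) \<bullet> axis c 1) * (cross7 u (axis a 1) \<bullet> cross7 w (axis c 1))) = 6 * (u \<bullet> w)"
    unfolding t[symmetric] by (simp add: inner_axis axis_component if_distrib[of "\<lambda>t. t * _"] cong: if_cong)
  also have "(\<Sum>a\<in>UNIV. \<Sum>c\<in>UNIV. (axis a 1 \<bullet> cross7 w (axis c 1)) * (cross7 u (axis a 1) \<bullet> axis c 1)) = - 6 * (u \<bullet> w)"
  proof -
    have "(\<Sum>a\<in>UNIV. (axis a 1 \<bullet> cross7 w (axis c 1)) * (cross7 u (axis a 1) \<bullet> axis c 1)) = cross7 u (cross7 w (axis c 1)) \<bullet> axis c 1" for c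
      by (subst (2) linear_expand[OF linear_cross7_inner(2)]) (simp add: inner_axis')
    moreover have "cross7 u (cross7 w x) \<bullet> x = - (cross7 u x \<bullet> cross7 w x)" for x
      by (rule cross7_inner_swap(2))
    ultimately show ?thesis
      by (subst sum.swap) (simp add: sum_negf t)
  qed
  finally show ?thesis using \<open>_ = ?S\<close> by (simp add: s inner_lin)
qed

lemma frame_nth: "(P *v axis a 1) $ i = P $ i $ (a::'n::finite)" for P :: "real^'n^'m"
  by (simp add: matrix_vector_mult_basis column_def)

section \<open>Pullbacks of the model forms by a matrix\<close>

definition frame3 :: "real^7^7 \<Rightarrow> form3" where
  "frame3 P a b c = cross7 (P *v axis a 1) (P *v axis b 1) \<bullet> (P *v axis c 1)"

definition frame4 :: "real^7^7 \<Rightarrow> form4" where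
  "frame4 P a b c d = psi0 (P *v axis a 1) (P *v axis b 1) (P *v axis c 1) (P *v axis d 1)"

lemma frame3_expand:
  "frame3 P a b c = (\<Sum>i\<in>UNIV. \<Sum>j\<in>UNIV. \<Sum>k\<in>UNIV. P $ i $ a * P $ j $ b * P $ k $ c * phi0 i j k)"
  by (simp add: frame3_def cross7_inner frame_nth mult.commute)

lemma positive3_iff: "positive3 p \<longleftrightarrow> (\<exists>P. invertible P \<and> p = frame3 P)"
  unfolding positive3_def frame3_expand[symmetric] fun_eq_iff ..

lemma frame3_pull:
  "(\<Sum>i\<in>UNIV. \<Sum>j\<in>UNIV. \<Sum>k\<in>UNIV. J $ i $ a * J $ j $ b * J $ k $ c * frame3 P i j k) = frame3 (P ** J) a b c"
proof -
  let ?f = "\<lambda>x y z. cross7 (P *v x) (P *v y) \<bullet> (P *v z)"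
  have "?f (J *v axis a 1) (J *v axis b 1) (J *v axis c 1) =
    (\<Sum>i\<in>UNIV. \<Sum>j\<in>UNIV. \<Sum>k\<in>UNIV. (J *v axis a 1) $ i * (J *v axis b 1) $ j * (J *v axis c 1) $ k
      * ?f (axis i 1) (axis j 1) (axis k 1))"
    by (rule trilinear_expand[of ?f]; intro linearI; simp add: matrix_vector_right_distrib matrix_vector_mult_scaleR cross7_lin inner_lin)
  then show ?thesis
    by (simp add: frame3_def frame_nth matrix_vector_mul_assoc)
qed

lemma frame4_pull:
  "(\<Sum>i\<in>UNIV. \<Sum>j\<in>UNIV. \<Sum>k\<in>UNIV. \<Sum>l\<in>UNIV. J $ i $ a * J $ j $ b * J $ k $ c * J $ l $ d * frame4 P i j k l)
    = frame4 (P ** J) a b c d"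
proof -
  let ?f = "\<lambda>x y z w. psi0 (P *v x) (P *v y) (P *v z) (P *v w)"
  have "?f (J *v axis a 1) (J *v axis b 1) (J *v axis c 1) (J *v axis d 1) =
    (\<Sum>i\<in>UNIV. \<Sum>j\<in>UNIV. \<Sum>k\<in>UNIV. \<Sum>l\<in>UNIV. (J *v axis a 1) $ i * (J *v axis b 1) $ j * (J *v axis c 1) $ k
      * (J *v axis d 1) $ l * ?f (axis i 1) (axis j 1) (axis k 1) (axis l 1))"
    by (rule quadrilinear_expand[of ?f]; intro linearI; simp add: matrix_vector_right_distrib matrix_vector_mult_scaleR psi0_add psi0_scale)
  then show ?thesis
    by (simp add: frame4_def frame_nth matrix_vector_mul_assoc)
qed

lemma transpose_mv_nth: "(transpose P *v axis e 1) $ i = P $ e $ (i::'n::finite)" for P :: "real^'n^'m::finite"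
  by (simp add: frame_nth transpose_def)

text \<open>The contraction puts rows of \<open>P\<close> into three slots of the determinant.
  Writing the other four vectors as images under the transpose of \<open>P\<close> as well extracts
  \<open>det P\<close> and leaves the dual frame in those four slots.\<close>

lemma sum_frame3_levi_civita:
  assumes PR: "P ** R = mat 1"
  shows "(\<Sum>e\<in>UNIV. \<Sum>f\<in>UNIV. \<Sum>h\<in>UNIV. frame3 P e f h * levi_civita_symbol a b c d e f h) =
    6 * det P * frame4 (transpose R) a b c d"
proof -
  have RP: "transpose P *v (transpose R *v x) = x" for x :: "real^7"
  proof -
    have "R ** P = mat 1" using PR by (simp add: matrix_left_right_inverse)
    then have "transpose P ** transpose R = mat 1" by (metis matrix_transpose_mul transpose_mat)
    then show ?thesis by (simp add: matrix_vector_mul_assoc del: transpose_matrix_vector)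
  qed
  let ?e = "\<lambda>i. axis i 1 :: real^7"
  let ?D = "\<lambda>x y z. det7 (?e a) (?e b) (?e c) (?e d) x y z"
  have "(\<Sum>e\<in>UNIV. \<Sum>f\<in>UNIV. \<Sum>h\<in>UNIV. frame3 P e f h * levi_civita_symbol a b c d e f h) =
    (\<Sum>e\<in>UNIV. \<Sum>f\<in>UNIV. \<Sum>h\<in>UNIV. \<Sum>i\<in>UNIV. \<Sum>j\<in>UNIV. \<Sum>k\<in>UNIV.
       phi0 i j k * (P $ i $ e * P $ j $ f * P $ k $ h * ?D (?e e) (?e f) (?e h)))"
    unfolding frame3_expand levi_civita_symbol_det7 sum_distrib_right by (simp only: mult_ac)
  also have "\<dots> = (\<Sum>i\<in>UNIV. \<Sum>j\<in>UNIV. \<Sum>k\<in>UNIV. \<Sum>e\<in>UNIV. \<Sum>f\<in>UNIV. \<Sum>h\<in>UNIV.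
       phi0 i j k * (P $ i $ e * P $ j $ f * P $ k $ h * ?D (?e e) (?e f) (?e h)))"
    by (rule sum33_swap)
  also have "\<dots> = (\<Sum>i\<in>UNIV. \<Sum>j\<in>UNIV. \<Sum>k\<in>UNIV. phi0 i j k *
      ?D (transpose P *v ?e i) (transpose P *v ?e j) (transpose P *v ?e k))"
    unfolding trilinear_expand[of ?D "transpose P *v _", OF linear_det7(5-7)] transpose_mv_nth
    by (simp add: sum_distrib_left)
  also have "\<dots> = (\<Sum>i\<in>UNIV. \<Sum>j\<in>UNIV. \<Sum>k\<in>UNIV. phi0 i j k * (det P * det7 (transpose R *v ?e a) (transpose R *v ?e b)
      (transpose R *v ?e c) (transpose R *v ?e d) (?e i) (?e j) (?e k)))"
    using det7_mult[of "transpose P" "transpose R *v ?e a" "transpose R *v ?e b" "transpose R *v ?e c" "transpose R *v ?e d"]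
    by (simp add: RP det_transpose del: transpose_matrix_vector)
  also have "\<dots> = det P * (\<Sum>i\<in>UNIV. \<Sum>j\<in>UNIV. \<Sum>k\<in>UNIV. phi0 i j k * det7 (transpose R *v ?e a) (transpose R *v ?e b)
      (transpose R *v ?e c) (transpose R *v ?e d) (?e i) (?e j) (?e k))"
    by (simp add: sum_distrib_left mult_ac)
  also have "\<dots> = 6 * det P * frame4 (transpose R) a b c d"
    unfolding sum_phi0_det7 frame4_def by simp
  finally show ?thesis .
qed

text \<open>Each of the four remaining indices is summed over the frame and its dual frame, so
  \<open>sum_inverse_frames\<close> replaces it by the standard frame; the sums are rotated to bring
  the indices to the front one after another. The factor 24 of \<open>psi0_contract\<close> cancels
  the normalisation of the wedge product.\<close>

lemma wedge223_frame3:
  assumes PR: "P ** R = mat 1"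
  shows "wedge223 (frame3 P i) (frame3 P j) (frame3 P) = 6 * det P * ((P *v axis i 1) \<bullet> (P *v axis j 1))"
proof -
  let ?e = "\<lambda>i. axis i 1 :: real^7"
  let ?P = "\<lambda>i. P *v ?e i" and ?R = "\<lambda>i. transpose R *v ?e i"
  define u w where "u = ?P i" and "w = ?P j"
  note lin = cross7_lin inner_lin psi0_add psi0_scale
  have "wedge223 (frame3 P i) (frame3 P j) (frame3 P) =
    (\<Sum>a\<in>UNIV. \<Sum>b\<in>UNIV. \<Sum>c\<in>UNIV. \<Sum>d\<in>UNIV. frame3 P i a b * frame3 P j c d *
      (\<Sum>e\<in>UNIV. \<Sum>f\<in>UNIV. \<Sum>h\<in>UNIV. frame3 P e f h * levi_civita_symbol a b c d e f h)) / 24"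
    unfolding wedge223_def sum_distrib_left by (simp only: mult_ac)
  also have "\<dots> = 6 * det P * (\<Sum>a\<in>UNIV. \<Sum>b\<in>UNIV. \<Sum>c\<in>UNIV. \<Sum>d\<in>UNIV. (cross7 u (?P a) \<bullet> ?P b) * (cross7 w (?P c) \<bullet> ?P d)
     * psi0 (?R a) (?R b) (?R c) (?R d)) / 24"
    unfolding sum_frame3_levi_civita[OF PR] frame4_def unfolding frame3_def u_def w_def sum_distrib_left
    by (simp only: mult_ac)
  also have "(\<Sum>a\<in>UNIV. \<Sum>b\<in>UNIV. \<Sum>c\<in>UNIV. \<Sum>d\<in>UNIV. (cross7 u (?P a) \<bullet> ?P b) * (cross7 w (?P c) \<bullet> ?P d)
     * psi0 (?R a) (?R b) (?R c) (?R d)) =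
     (\<Sum>d\<in>UNIV. \<Sum>a\<in>UNIV. \<Sum>b\<in>UNIV. \<Sum>c\<in>UNIV. (cross7 u (?P a) \<bullet> ?P b) * (cross7 w (?P c) \<bullet> ?e d)
     * psi0 (?R a) (?R b) (?R c) (?e d))"
    by (rule trans[OF sum3_swap], rule sum_inverse_frames[of "\<lambda>x y. \<Sum>a\<in>UNIV. \<Sum>b\<in>UNIV. \<Sum>c\<in>UNIV. (cross7 u (?P a) \<bullet> ?P b) * (cross7 w (?P c) \<bullet> x)
     * psi0 (?R a) (?R b) (?R c) y", OF _ _ PR])
      (intro linear_compose_sum ballI linearI; simp add: lin algebra_simps)+
  also have "\<dots> = (\<Sum>c\<in>UNIV. \<Sum>d\<in>UNIV. \<Sum>a\<in>UNIV. \<Sum>b\<in>UNIV. (cross7 u (?P a) \<bullet> ?P b) * (cross7 w (?P c) \<bullet> ?e d)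
     * psi0 (?R a) (?R b) (?R c) (?e d))"
    by (rule sum3_swap)
  also have "\<dots> = (\<Sum>c\<in>UNIV. \<Sum>d\<in>UNIV. \<Sum>a\<in>UNIV. \<Sum>b\<in>UNIV. (cross7 u (?P a) \<bullet> ?P b) * (cross7 w (?e c) \<bullet> ?e d)
     * psi0 (?R a) (?R b) (?e c) (?e d))"
    by (rule sum_inverse_frames[of "\<lambda>x y. \<Sum>d\<in>UNIV. \<Sum>a\<in>UNIV. \<Sum>b\<in>UNIV. (cross7 u (?P a) \<bullet> ?P b) * (cross7 w x \<bullet> ?e d)
     * psi0 (?R a) (?R b) y (?e d)", OF _ _ PR])
      (intro linear_compose_sum ballI linearI; simp add: lin algebra_simps)+
  also have "\<dots> = (\<Sum>b\<in>UNIV. \<Sum>c\<in>UNIV. \<Sum>d\<in>UNIV. \<Sum>a\<in>UNIV. (cross7 u (?P a) \<bullet> ?P b) * (cross7 w (?e c) \<bullet> ?e d)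
     * psi0 (?R a) (?R b) (?e c) (?e d))"
    by (rule sum3_swap)
  also have "\<dots> = (\<Sum>b\<in>UNIV. \<Sum>c\<in>UNIV. \<Sum>d\<in>UNIV. \<Sum>a\<in>UNIV. (cross7 u (?P a) \<bullet> ?e b) * (cross7 w (?e c) \<bullet> ?e d)
     * psi0 (?R a) (?e b) (?e c) (?e d))"
    by (rule sum_inverse_frames[of "\<lambda>x y. \<Sum>c\<in>UNIV. \<Sum>d\<in>UNIV. \<Sum>a\<in>UNIV. (cross7 u (?P a) \<bullet> x) * (cross7 w (?e c) \<bullet> ?e d)
     * psi0 (?R a) y (?e c) (?e d)", OF _ _ PR])
      (intro linear_compose_sum ballI linearI; simp add: lin algebra_simps)+
  also have "\<dots> = (\<Sum>a\<in>UNIV. \<Sum>b\<in>UNIV. \<Sum>c\<in>UNIV. \<Sum>d\<in>UNIV. (cross7 u (?P a) \<bullet> ?e b) * (cross7 w (?e c) \<bullet> ?e d)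
     * psi0 (?R a) (?e b) (?e c) (?e d))"
    by (rule sum3_swap)
  also have "\<dots> = (\<Sum>a\<in>UNIV. \<Sum>b\<in>UNIV. \<Sum>c\<in>UNIV. \<Sum>d\<in>UNIV. (cross7 u (?e a) \<bullet> ?e b) * (cross7 w (?e c) \<bullet> ?e d)
     * psi0 (?e a) (?e b) (?e c) (?e d))"
    by (rule sum_inverse_frames[of "\<lambda>x y. \<Sum>b\<in>UNIV. \<Sum>c\<in>UNIV. \<Sum>d\<in>UNIV. (cross7 u x \<bullet> ?e b) * (cross7 w (?e c) \<bullet> ?e d)
     * psi0 y (?e b) (?e c) (?e d)", OF _ _ PR])
      (intro linear_compose_sum ballI linearI; simp add: lin algebra_simps)+
  also have "\<dots> = 24 * (u \<bullet> w)" by (rule psi0_contract)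
  finally show ?thesis by (simp add: u_def w_def)
qed

section \<open>Recovering metric and volume from the three-form\<close>

definition wedge_matrix :: "form3 \<Rightarrow> real^7^7" where
  "wedge_matrix p = (\<chi> i j. wedge223 (p i) (p j) p / 6)"

lemma invertible_if_kernel_trivial: "(\<And>y. A *v y = 0 \<Longrightarrow> y = 0) \<Longrightarrow> invertible A" for A :: "real^'n^'n"
  by (metis invertible_left_inverse matrix_left_invertible_ker)

lemma invertible_kernel: "invertible A \<Longrightarrow> A *v y = 0 \<Longrightarrow> y = 0" for A :: "real^'n^'n"
  by (metis invertible_left_inverse matrix_left_invertible_ker)

text \<open>The determinant of w g in dimension seven is w^7 times w^2. An odd power determines w
  with its sign, and then g; this gives uniqueness and, later, explicit formulas for both.\<close>

lemma induces_wedge_matrix: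
  assumes "induces p g w"
  shows "wedge_matrix p = w *\<^sub>R g" "w \<noteq> 0" "det (wedge_matrix p) = w ^ 9" "invertible g"
proof -
  show B: "wedge_matrix p = w *\<^sub>R g"
    using assms by (simp add: induces_def wedge_matrix_def vec_eq_iff mult.commute)
  have "g *v u \<noteq> 0" if "u \<noteq> 0" for u
    using assms that unfolding induces_def by (metis inner_zero_right less_irrefl)
  then show "invertible g"
    by (intro invertible_if_kernel_trivial) blast
  moreover have w: "det g = w ^ 2" using assms by (simp add: induces_def)
  ultimately show "w \<noteq> 0" by (auto simp: invertible_det_nz)
  have "wedge_matrix p = (\<chi> i. w *s g $ i)" by (simp add: B vec_eq_iff)
  then have "det (wedge_matrix p) = w ^ CARD(7) * det (\<chi> i. g $ i)"
    by (simp only: det_rows_mul prod_constant)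
  then show "det (wedge_matrix p) = w ^ 9"
    by (simp add: vec_lambda_eta w flip: power_add)
qed

lemma induces_unique:
  assumes "induces p g w" "induces p g' w'"
  shows "g = g' \<and> w = w'"
proof -
  have "w ^ 9 = w' ^ 9"
    using induces_wedge_matrix(3)[OF assms(1)] induces_wedge_matrix(3)[OF assms(2)] by (rule trans[OF sym])
  then have "w = w'" by (metis odd_numeral odd_real_root_power_cancel)
  then show ?thesis
    using induces_wedge_matrix[OF assms(1)] induces_wedge_matrix(1)[OF assms(2)]
    by (metis scaleR_left_imp_eq)
qed

lemma inner_gram: "u \<bullet> ((transpose P ** P) *v w) = (P *v u) \<bullet> (P *v w)" for P :: "real^'n^'m"
  using dot_lmul_matrix[of "P *v w" P u] by (simp add: inner_commute flip: matrix_vector_mul_assoc)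

lemma gram_nth: "(transpose P ** P) $ i $ j = (P *v axis i 1) \<bullet> (P *v axis j 1)" for P :: "real^'n^'m"
  using inner_gram[of "axis i 1" P "axis j 1"] by (simp add: inner_axis' frame_nth)

lemma induces_frame3:
  assumes "invertible P"
  shows "induces (frame3 P) (transpose P ** P) (det P)"
proof -
  obtain R where R: "P ** R = mat 1" using assms by (auto simp: invertible_def)
  have "P *v u \<noteq> 0" if "u \<noteq> 0" for u
    using assms that by (metis invertible_left_inverse matrix_left_invertible_ker)
  then show ?thesis
    unfolding induces_def wedge223_frame3[OF R] gram_nth inner_gram
    by (simp add: matrix_transpose_mul det_mul det_transpose power2_eq_square mult.commute)
qed

lemma metric_vol_frame3:
  assumes "invertible P"
  shows "metric (frame3 P) = transpose P ** P" "vol (frame3 P) = det P"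
proof -
  have "metric_vol (frame3 P) = (transpose P ** P, det P)"
    unfolding metric_vol_def
    by (rule the1_equality)
      (use induces_frame3[OF assms] induces_unique in \<open>auto intro!: ex1I[of _ "(transpose P ** P, det P)"]\<close>)
  then show "metric (frame3 P) = transpose P ** P" "vol (frame3 P) = det P"
    by (simp_all add: metric_def vol_def)
qed

lemma positive3_induces: "positive3 p \<Longrightarrow> induces p (metric p) (vol p)"
  by (auto simp: positive3_iff metric_vol_frame3 induces_frame3)

lemma transpose_nth: "transpose A $ i $ j = A $ j $ i"
  by (simp add: transpose_def)

lemma matrix_inv_inverse:
  fixes A :: "'a::semiring_1^'n^'m"
  assumes "invertible A"
  shows "A ** matrix_inv A = mat 1 \<and> matrix_inv A ** A = mat 1"
  using someI_ex[OF assms[unfolded invertible_def]] unfolding matrix_inv_def .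

lemma matrix_inv_eqI:
  fixes A :: "'a::semiring_1^'n^'m"
  assumes "A ** B = mat 1" "B ** A = mat 1"
  shows "matrix_inv A = B"
proof -
  have "invertible A" using assms unfolding invertible_def by blast
  then have "matrix_inv A = matrix_inv A ** (A ** B)" "matrix_inv A ** A = mat 1"
    using matrix_inv_inverse[of A] assms by simp_all
  then show ?thesis by (simp add: matrix_mul_assoc)
qed

text \<open>Raising the indices replaces the frame \<open>P\<close> by its dual frame, and
  contraction with the symbol dualizes once more, back to \<open>P\<close>. The determinant of the
  dual frame cancels the volume \<open>det P\<close>.\<close>

lemma hodge_frame3:
  assumes "invertible P"
  shows "hodge (frame3 P) = frame4 P"
proof (intro ext)
  fix a b c d
  define R where "R = matrix_inv P"
  have PR: "P ** R = mat 1" and RP: "R ** P = mat 1"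
    using matrix_inv_inverse[OF assms] by (simp_all add: R_def)
  have tr: "transpose R ** transpose P = mat 1" "transpose P ** transpose R = mat 1"
    by (simp_all only: PR RP transpose_mat flip: matrix_transpose_mul)
  have inv: "matrix_inv (transpose P ** P) = R ** transpose R"
  proof (rule matrix_inv_eqI)
    show "(transpose P ** P) ** (R ** transpose R) = mat 1" 
    proof -
      have "(transpose P ** P) ** (R ** transpose R) = transpose P ** (P ** R) ** transpose R"
        by (simp only: matrix_mul_assoc)
      then show ?thesis unfolding PR matrix_mul_rid tr .
    qed
    show "(R ** transpose R) ** (transpose P ** P) = mat 1"
    proof -
      have "(R ** transpose R) ** (transpose P ** P) = R ** (transpose R ** transpose P) ** P"
        by (simp only: matrix_mul_assoc)
      then show ?thesis unfolding tr matrix_mul_rid RP .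
    qed
  qed
  have r: "raise3 (metric (frame3 P)) (frame3 P) i j k = frame3 (transpose R) i j k" for i j k
  proof -
    have t: "transpose (R ** transpose R) = R ** transpose R" by (simp add: matrix_transpose_mul)
    have s: "(R ** transpose R) $ i $ j = (R ** transpose R) $ j $ i" for i j
      using transpose_nth[of "R ** transpose R" i j] unfolding t .
    have "raise3 (metric (frame3 P)) (frame3 P) i j k = frame3 (P ** (R ** transpose R)) i j k"
      unfolding raise3_def metric_vol_frame3[OF assms] inv
      by (simp only: s[of i] s[of j] s[of k] frame3_pull)
    also have "P ** (R ** transpose R) = transpose R"
      by (simp only: matrix_mul_assoc PR matrix_mul_lid)
    finally show ?thesis .
  qed
  \<comment> \<open>A cyclic shift of seven positions is an even permutation, so three of them cost
    no sign.\<close>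
  have lc: "levi_civita_symbol i j k a b c d = levi_civita_symbol a b c d i j k" for i j k
    unfolding levi_civita_symbol_det7
    using det7_rotate[of "axis i 1" "axis j 1" "axis k 1" "axis a 1" "axis b 1" "axis c 1" "axis d 1"]
      det7_rotate[of "axis j 1" "axis k 1" "axis a 1" "axis b 1" "axis c 1" "axis d 1" "axis i 1"]
      det7_rotate[of "axis k 1" "axis a 1" "axis b 1" "axis c 1" "axis d 1" "axis i 1" "axis j 1"] by linarith
  have "6 * hodge (frame3 P) a b c d = (\<Sum>i\<in>UNIV. \<Sum>j\<in>UNIV. \<Sum>k\<in>UNIV. frame3 (transpose R) i j k * (det P * levi_civita_symbol i j k a b c d))"
    unfolding hodge_def r unfolding metric_vol_frame3[OF assms] by simp
  also have "\<dots> = (\<Sum>i\<in>UNIV. \<Sum>j\<in>UNIV. \<Sum>k\<in>UNIV. frame3 (transpose R) i j k * (det P * levi_civita_symbol a b c d i j k))"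
    unfolding lc ..
  also have "\<dots> = det P * (\<Sum>i\<in>UNIV. \<Sum>j\<in>UNIV. \<Sum>k\<in>UNIV. frame3 (transpose R) i j k * levi_civita_symbol a b c d i j k)"
    by (simp add: sum_distrib_left mult_ac)
  also have "\<dots> = det P * (6 * det (transpose R) * frame4 (transpose (transpose P)) a b c d)"
    by (subst sum_frame3_levi_civita[OF tr(1)]) (rule refl)
  also have "\<dots> = 6 * frame4 P a b c d"
    using arg_cong[OF PR, of det] by (simp add: det_mul det_transpose)
  finally show "hodge (frame3 P) a b c d = frame4 P a b c d" by simp
qed

lemma sum_frame4_last: "(\<Sum>e\<in>UNIV. v $ e * frame4 P b i j e) =
    psi0 (P *v axis b 1) (P *v axis i 1) (P *v axis j 1) (P *v v)"
proof -
  have "linear (\<lambda>w. psi0 (P *v axis b 1) (P *v axis i 1) (P *v axis j 1) (P *v w))"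
    by (intro linearI) (simp_all add: matrix_vector_right_distrib matrix_vector_mult_scaleR psi0_add psi0_scale)
  from linear_expand[OF this, of v] show ?thesis by (simp add: frame4_def)
qed

lemma linear_twist: "linear (twist a b c v)"
  by (intro linearI) (simp_all add: twist_def cross7_lin inner_lin algebra_simps)

text \<open>The new frame is the old one followed by the twist along the image of
  \<open>v\<close>.\<close>

lemma deformed_frame:
  assumes P: "invertible P" and r: "r > 0" "r ^ 3 = 1 + (P *v v) \<bullet> (P *v v)"
  obtains Q where "invertible Q"
    "\<And>b i j. frame3 P b i j + (\<Sum>e\<in>UNIV. v $ e * frame4 P b i j e) = frame3 Q b i j"
    "\<And>y z. (Q *v y) \<bullet> (Q *v z) = r * ((P *v y) \<bullet> (P *v z))
        - 1 / r^2 * (((P *v v) \<bullet> (P *v y)) * ((P *v v) \<bullet> (P *v z)))"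
proof -
  define u where "u = P *v v"
  obtain a b c where e: "a^3 - 3 * a * c^2 * (u \<bullet> u) = 1" "a^2 * b + 4 * a * c^2 + b * c^2 * (u \<bullet> u) = 0"
    "3 * a^2 * c - c^3 * (u \<bullet> u) = -1" "a^2 + c^2 * (u \<bullet> u) = r" "2 * a * b + b^2 * (u \<bullet> u) - c^2 = - 1 / r^2"
    using twist_parameters[OF inner_ge_zero r[folded u_def]] by metis
  define Q where "Q = matrix (twist a b c u) ** P"
  have Q: "Q *v y = twist a b c u (P *v y)" for y
    using linear_twist[of a b c u] by (simp add: Q_def matrix_works linear_matrix_vector_mul_eq flip: matrix_vector_mul_assoc)
  have ip: "(Q *v y) \<bullet> (Q *v z) = r * ((P *v y) \<bullet> (P *v z)) - 1 / r^2 * ((u \<bullet> (P *v y)) * (u \<bullet> (P *v z)))" for y z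
    unfolding Q twist_inner e by simp
  \<comment> \<open>A vector y in the kernel would satisfy (1+|u|^2) |Py|^2 = <u,Py>^2, against
    Cauchy-Schwarz unless Py = 0.\<close>
  have "invertible Q"
  proof (rule invertible_if_kernel_trivial)
    fix y assume "Q *v y = 0"
    then have "r * ((P *v y) \<bullet> (P *v y)) = 1 / r^2 * (u \<bullet> (P *v y))^2"
      using ip[of y y] by (simp add: power2_eq_square)
    then have "r^3 * ((P *v y) \<bullet> (P *v y)) = (u \<bullet> (P *v y))^2"
      using r(1) by (simp add: field_simps power2_eq_square power3_eq_cube)
    also have "\<dots> \<le> (u \<bullet> u) * ((P *v y) \<bullet> (P *v y))"
      by (rule Cauchy_Schwarz_ineq)
    finally have "(P *v y) \<bullet> (P *v y) \<le> 0"
      using r(2) by (simp add: u_def ring_distribs)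
    then have "P *v y = 0" by (metis antisym inner_eq_zero_iff inner_ge_zero)
    then show "y = 0" by (rule invertible_kernel[OF P])
  qed
  \<comment> \<open>The deformation contracts the last slot of \<open>psi0\<close>, the twist
    formula the first; hence the coefficient -1 in \<open>twist_parameters\<close>.\<close>
  moreover have "frame3 P x i j + (\<Sum>e\<in>UNIV. v $ e * frame4 P x i j e) = frame3 Q x i j" for x i j
    unfolding frame3_def sum_frame4_last Q twist_cross7 e psi0_rotate[of _ _ _ u, folded u_def]
    by (simp add: u_def psi0_rotate[of _ _ _ "P *v v"])
  ultimately show ?thesis using that ip unfolding u_def by blast
qed

section \<open>Function algebras\<close>

text \<open>The metric, its inverse and the Hodge dual are built from the components of the form by these operations.
  The two instances give smoothness, and invariance to first order along a line.\<close>

locale function_algebra =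
  fixes S :: "'s set" and C :: "('s \<Rightarrow> real) \<Rightarrow> bool"
  assumes const: "C (\<lambda>_. c)"
    and add: "C f \<Longrightarrow> C g \<Longrightarrow> C (\<lambda>s. f s + g s)"
    and mult: "C f \<Longrightarrow> C g \<Longrightarrow> C (\<lambda>s. f s * g s)"
    and powr: "C f \<Longrightarrow> (\<And>s. s \<in> S \<Longrightarrow> f s > 0) \<Longrightarrow> C (\<lambda>s. f s powr a)"
    and cong: "C f \<Longrightarrow> (\<And>s. s \<in> S \<Longrightarrow> f s = g s) \<Longrightarrow> C g"
begin

lemma sum: "(\<And>i. i \<in> I \<Longrightarrow> C (f i)) \<Longrightarrow> C (\<lambda>s. \<Sum>i\<in>I. f i s)"
  by (induction I rule: infinite_finite_induct) (simp_all add: const add)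

lemma prod: "(\<And>i. i \<in> I \<Longrightarrow> C (f i)) \<Longrightarrow> C (\<lambda>s. \<Prod>i\<in>I. f i s)"
  by (induction I rule: infinite_finite_induct) (simp_all add: const mult)

lemma divide_const: "C f \<Longrightarrow> C (\<lambda>s. f s / c)"
  using mult[OF _ const[of "inverse c"]] by (simp add: divide_inverse)

lemma uminus: "C f \<Longrightarrow> C (\<lambda>s. - f s)"
  using mult[OF const[of "-1"]] by simp

lemma powr_square:
  assumes "C f" "\<And>s. s \<in> S \<Longrightarrow> f s \<noteq> 0"
  shows "C (\<lambda>s. (f s * f s) powr a)"
  by (rule powr[OF mult[OF assms(1) assms(1)]]) (use assms(2) not_real_square_gt_zero in blast)

lemma inverse:
  assumes "C f" "\<And>s. s \<in> S \<Longrightarrow> f s \<noteq> 0"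
  shows "C (\<lambda>s. inverse (f s))"
proof (rule cong)
  show "C (\<lambda>s. f s * (f s * f s) powr (-1))"
    by (intro mult powr_square assms)
  fix s assume "s \<in> S"
  then have "f s * f s > 0" using assms(2) not_real_square_gt_zero by blast
  then show "f s * (f s * f s) powr (-1) = inverse (f s)"
    by (auto simp: powr_minus field_simps)
qed

lemma det: "(\<And>i j. C (\<lambda>s. A s $ i $ j)) \<Longrightarrow> C (\<lambda>s. det (A s))"
  unfolding det_def by (intro sum mult const prod)

text \<open>Cramer's rule writes each entry of the inverse as a quotient of determinants.\<close>

lemma matrix_inv:
  fixes A :: "'s \<Rightarrow> real^'n^'n"
  assumes A: "\<And>i j. C (\<lambda>s. A s $ i $ j)" and inv: "\<And>s. s \<in> S \<Longrightarrow> invertible (A s)"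
  shows "C (\<lambda>s. matrix_inv (A s) $ i $ j)"
proof (rule cong)
  show "C (\<lambda>s. det (\<chi> p q. if q = i then axis j 1 $ p else A s $ p $ q) * inverse (det (A s)))"
  proof (intro mult inverse det A)
    fix p q
    show "C (\<lambda>s. (\<chi> p q. if q = i then axis j 1 $ p else A s $ p $ q) $ p $ q)"
      by (cases "q = i") (simp_all add: A const)
  qed (use inv in \<open>simp add: invertible_det_nz\<close>)
  fix s assume s: "s \<in> S"
  let ?x = "matrix_inv (A s) *v axis j 1"
  have "A s *v ?x = axis j 1"
    using matrix_inv_inverse[OF inv[OF s]] by (simp add: matrix_vector_mul_assoc)
  then have "?x = (\<chi> k. det (\<chi> p q. if q = k then axis j 1 $ p else A s $ p $ q) / det (A s))"
    using inv[OF s] by (simp add: cramer invertible_det_nz)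
  then have "?x $ i = det (\<chi> p q. if q = i then axis j 1 $ p else A s $ p $ q) / det (A s)"
    by (simp add: vec_eq_iff)
  then show "det (\<chi> p q. if q = i then axis j 1 $ p else A s $ p $ q) * inverse (det (A s)) = matrix_inv (A s) $ i $ j"
    by (simp add: frame_nth divide_inverse)
qed

context
  fixes p :: "'s \<Rightarrow> form3"
  assumes C: "\<And>a b c. C (\<lambda>s. p s a b c)" and pos: "\<And>s. s \<in> S \<Longrightarrow> positive3 (p s)"
begin

lemma wedge_matrix: "C (\<lambda>s. wedge_matrix (p s) $ i $ j)"
  unfolding wedge_matrix_def wedge223_def vec_lambda_beta
  by (intro divide_const sum mult C const)

text \<open>A signed ninth root by positive powers alone: for d = w^9, the product of d and
  (d^2)^(-4/9) is w^9 / |w|^8 = w.\<close>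

lemma vol: "C (\<lambda>s. vol (p s))"
proof (rule cong)
  show "C (\<lambda>s. det (wedge_matrix (p s)) * (det (wedge_matrix (p s)) * det (wedge_matrix (p s))) powr (-(4/9)))"
    by (intro mult powr_square det wedge_matrix)
      (use induces_wedge_matrix[OF positive3_induces[OF pos]] in auto)
  fix s assume "s \<in> S"
  note w = induces_wedge_matrix(2,3)[OF positive3_induces[OF pos[OF this]]]
  let ?w = "vol (p s)"
  have "?w ^ 9 * ?w ^ 9 = \<bar>?w\<bar> powr 18"
    using w(1) by (simp add: powr_numeral flip: power_add)
  then have "(?w ^ 9 * ?w ^ 9) powr (-(4/9)) = (\<bar>?w\<bar> powr 18) powr (-(4/9))"
    by (rule arg_cong)
  also have "\<dots> = \<bar>?w\<bar> powr (-8)"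
    unfolding powr_powr by simp
  also have "\<dots> = inverse (?w ^ 8)"
    using w(1) by (simp add: powr_minus powr_numeral)
  finally show "det (wedge_matrix (p s)) * (det (wedge_matrix (p s)) * det (wedge_matrix (p s))) powr (-(4/9)) = ?w"
    unfolding w(2) using w(1) by (simp add: field_simps eval_nat_numeral)
qed

lemma metric: "C (\<lambda>s. metric (p s) $ i $ j)"
proof (rule cong)
  show "C (\<lambda>s. wedge_matrix (p s) $ i $ j * inverse (vol (p s)))"
    by (intro mult inverse wedge_matrix vol)
      (use induces_wedge_matrix(2)[OF positive3_induces[OF pos]] in auto)
  fix s assume "s \<in> S"
  note w = induces_wedge_matrix(1,2)[OF positive3_induces[OF pos[OF this]]]
  then show "wedge_matrix (p s) $ i $ j * inverse (vol (p s)) = metric (p s) $ i $ j"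
    by simp
qed

lemma metric_inv: "C (\<lambda>s. matrix_inv (metric (p s)) $ i $ j)"
  by (intro matrix_inv metric) (rule induces_wedge_matrix(4)[OF positive3_induces[OF pos]])

lemma hodge: "C (\<lambda>s. hodge (p s) a b c d)"
  unfolding hodge_def raise3_def
  by (intro divide_const sum mult metric_inv vol const C)

end

end

text \<open>By the Leibniz and chain rules, whatever these operations build from components constant
  to first order is constant to first order.\<close>

lemma flat_function_algebra:
  assumes "e > 0"
  shows "function_algebra {-e<..<e} (\<lambda>f. (f has_real_derivative 0) (at 0))"
proof
  fix f g :: "real \<Rightarrow> real" and c a :: real
  show "((\<lambda>_. c) has_real_derivative 0) (at 0)" by simp
  assume f: "(f has_real_derivative 0) (at 0)"
  show "((\<lambda>s. f s powr a) has_real_derivative 0) (at 0)" if "\<And>s. s \<in> {-e<..<e} \<Longrightarrow> f s > 0"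
    using that[of 0] assms by (auto intro!: derivative_eq_intros f)
  show "(g has_real_derivative 0) (at 0)" if "\<And>s. s \<in> {-e<..<e} \<Longrightarrow> f s = g s"
    using f by (rule has_field_derivative_transform_within_open[where S = "{-e<..<e}"]) (use that assms in auto)
  assume g: "(g has_real_derivative 0) (at 0)"
  show "((\<lambda>s. f s + g s) has_real_derivative 0) (at 0)"
    by (auto intro!: derivative_eq_intros f g)
  show "((\<lambda>s. f s * g s) has_real_derivative 0) (at 0)"
    by (auto intro!: derivative_eq_intros f g)
qed

section \<open>Iterated derivatives of sums, products and powers\<close>

lemma ck_on_cong:
  assumes S: "open S"
  shows "ck_on k S f \<Longrightarrow> (\<And>x. x \<in> S \<Longrightarrow> f x = g x) \<Longrightarrow> ck_on k S g"
proof (induction k arbitrary: f g)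
  case 0
  then show ?case using continuous_on_cong by force
next
  case (Suc k)
  have d: "(g has_derivative frechet_derivative f (at x)) (at x)" if "x \<in> S" for x
    by (rule has_derivative_transform_within_open[where f = f, OF _ S that])
      (use Suc.prems that in \<open>auto simp: frechet_derivative_works\<close>)
  then have e: "frechet_derivative g (at x) = frechet_derivative f (at x)" if "x \<in> S" for x
    using that by (metis frechet_derivative_at)
  show ?case
    unfolding ck_on.simps
  proof (intro conjI ballI allI)
    show "g differentiable at x" if "x \<in> S" for x using d[OF that] by (auto simp: differentiable_def)
    show "ck_on k S (\<lambda>x. frechet_derivative g (at x) u)" for u
      by (rule Suc.IH[where f = "\<lambda>x. frechet_derivative f (at x) u"]) (use Suc.prems e in auto)
  qed
qed

text \<open>A derivative produced by the calculus rules may stand in for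
  \<open>frechet_derivative\<close>, with which it agrees on the open set.\<close>

lemma ck_on_SucI:
  assumes S: "open S" and f: "\<And>x. x \<in> S \<Longrightarrow> (f has_derivative f' x) (at x)" and c: "\<And>u. ck_on k S (\<lambda>x. f' x u)"
  shows "ck_on (Suc k) S f"
  unfolding ck_on.simps
proof (intro conjI ballI allI)
  show "f differentiable at x" if "x \<in> S" for x using f[OF that] by (auto simp: differentiable_def)
  show "ck_on k S (\<lambda>x. frechet_derivative f (at x) u)" for u
    by (rule ck_on_cong[OF S c[of u]]) (metis f frechet_derivative_at)
qed

lemma ck_on_Suc_derivative:
  assumes "ck_on (Suc k) S f" "x \<in> S"
  shows "(f has_derivative frechet_derivative f (at x)) (at x)"
  using assms by (simp add: frechet_derivative_works)

lemma ck_on_SucD: "open S \<Longrightarrow> ck_on (Suc k) S f \<Longrightarrow> ck_on k S f"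
proof (induction k arbitrary: f)
  case 0
  then show ?case
    by (auto intro!: continuous_at_imp_continuous_on differentiable_imp_continuous_within)
next
  case (Suc k)
  then show ?case by (subst ck_on.simps) auto
qed

lemma ck_on_const: "open S \<Longrightarrow> ck_on k S (\<lambda>_. c)"
  by (induction k arbitrary: c) (auto simp: frechet_derivative_const)

lemma ck_on_add:
  assumes S: "open S"
  shows "ck_on k S f \<Longrightarrow> ck_on k S g \<Longrightarrow> ck_on k S (\<lambda>x. f x + g x)"
proof (induction k arbitrary: f g)
  case 0 then show ?case by (auto intro: continuous_on_add)
next
  case (Suc k)
  show ?case
    by (rule ck_on_SucI[OF S has_derivative_add[OF ck_on_Suc_derivative[OF Suc.prems(1)] ck_on_Suc_derivative[OF Suc.prems(2)]]])
      (use Suc in auto)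
qed

lemma ck_on_mult:
  fixes f g :: "_ \<Rightarrow> real"
  assumes S: "open S"
  shows "ck_on k S f \<Longrightarrow> ck_on k S g \<Longrightarrow> ck_on k S (\<lambda>x. f x * g x)"
proof (induction k arbitrary: f g)
  case 0 then show ?case by (auto intro: continuous_on_mult)
next
  case (Suc k)
  show ?case
    by (rule ck_on_SucI[OF S has_derivative_mult[OF ck_on_Suc_derivative[OF Suc.prems(1)] ck_on_Suc_derivative[OF Suc.prems(2)]]])
      (use Suc.prems in \<open>auto simp del: ck_on.simps simp: ck_on.simps(2)[of k]
        intro!: ck_on_add[OF S] Suc.IH ck_on_SucD[OF S Suc.prems(1)] ck_on_SucD[OF S Suc.prems(2)]\<close>)
qed

text \<open>The exponent has to vary in the induction, since each derivative lowers it by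
  one.\<close>

lemma ck_on_powr:
  fixes f :: "_ \<Rightarrow> real"
  assumes S: "open S"
  shows "ck_on k S f \<Longrightarrow> (\<And>x. x \<in> S \<Longrightarrow> f x > 0) \<Longrightarrow> ck_on k S (\<lambda>x. f x powr a)"
proof (induction k arbitrary: a)
  case 0 then show ?case by (auto intro!: continuous_on_powr continuous_on_const simp: less_le)
next
  case (Suc k)
  have "((\<lambda>x. f x powr a) has_derivative (\<lambda>u. a * f x powr (a - 1) * frechet_derivative f (at x) u)) (at x)"
    if "x \<in> S" for x
  proof (rule has_derivative_compose[OF ck_on_Suc_derivative[OF Suc.prems(1) that]])
    show "((\<lambda>t. t powr a) has_derivative (\<lambda>u. a * f x powr (a - 1) * u)) (at (f x))"
      using has_real_derivative_powr[of "f x" a] Suc.prems(2)[OF that] by (simp add: has_field_derivative_def)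
  qed
  then show ?case
    by (rule ck_on_SucI[OF S])
      (use Suc.IH[of "a - 1"] ck_on_SucD[OF S Suc.prems(1)] Suc.prems in \<open>auto intro!: ck_on_mult[OF S] ck_on_const[OF S]\<close>)
qed

lemma smooth_function_algebra:
  assumes S: "open S"
  shows "function_algebra S (smooth_on S)"
  by unfold_locales
    (auto simp: smooth_on_def intro: ck_on_const[OF S] ck_on_add[OF S] ck_on_mult[OF S] ck_on_powr[OF S] ck_on_cong[OF S])

lemma smooth_on_differentiable: "smooth_on S f \<Longrightarrow> x \<in> S \<Longrightarrow> f differentiable (at x)"
  unfolding smooth_on_def by (metis ck_on.simps(2))

section \<open>Covariant derivatives\<close>

lemma partial_line:
  assumes "f differentiable (at x)"
  shows "((\<lambda>s. f (x + s *\<^sub>R axis a 1)) has_real_derivative partial a f x) (at 0)"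
proof -
  let ?F = "frechet_derivative f (at x)"
  have F: "(f has_derivative ?F) (at x)" using assms by (simp add: frechet_derivative_works)
  have "((\<lambda>s. f (x + s *\<^sub>R axis a 1)) has_derivative (\<lambda>s. ?F (s *\<^sub>R axis a 1))) (at (0::real))"
    by (rule has_derivative_compose[where f = "\<lambda>s. x + s *\<^sub>R axis a 1"])
      (auto intro!: derivative_eq_intros simp: F)
  moreover have "?F (s *\<^sub>R axis a 1) = partial a f x * s" for s
    using linear_cmul[OF has_derivative_linear[OF F]] by (simp add: partial_def)
  ultimately show ?thesis by (simp add: has_field_derivative_def)
qed

text \<open>Pulling a tensor field back along a coordinate line by \<open>1 - s G\<close>, where \<open>G\<close> is the connection
  matrix in that direction, turns its covariant derivative at a point into an ordinary derivative at \<open>s = 0\<close>.\<close>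

definition shear :: "real^'n^'n \<Rightarrow> real \<Rightarrow> real^'n^'n" where
  "shear G s = mat 1 - s *\<^sub>R G"

lemma shear_0 [simp]: "shear G 0 = mat 1"
  by (simp add: shear_def)

lemma shear_nth: "shear G s $ i $ j = (if i = j then 1 else 0) - s * G $ i $ j"
  by (simp add: shear_def mat_def)

lemma sum_mat_1: "(\<Sum>i\<in>UNIV. (mat 1 :: real^'n^'n) $ i $ b * f i) = f b"
  by (simp add: mat_def if_distrib[of "\<lambda>t. t * _"] cong: if_cong)

text \<open>The product rule at s = 0, where the shear is the identity. Each index contributes one
  connection term, so one application per index assembles a covariant derivative.\<close>

lemma has_derivative_shear:
  assumes "\<And>i. (F i has_real_derivative F' i) (at 0)"
  shows "((\<lambda>s. \<Sum>i\<in>UNIV. shear G s $ i $ b * F i s) has_real_derivative F' b - (\<Sum>i\<in>UNIV. G $ i $ b * F i 0)) (at 0)"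
proof -
  have "((\<lambda>s. F b s - s * (\<Sum>i\<in>UNIV. G $ i $ b * F i s)) has_real_derivative F' b - (\<Sum>i\<in>UNIV. G $ i $ b * F i 0)) (at 0)"
    by (auto intro!: derivative_eq_intros assms)
  moreover have "(\<lambda>s. \<Sum>i\<in>UNIV. shear G s $ i $ b * F i s) = (\<lambda>s. F b s - s * (\<Sum>i\<in>UNIV. G $ i $ b * F i s))"
    by (simp add: shear_nth left_diff_distrib sum_subtractf sum_distrib_left mult.assoc if_distrib[of "\<lambda>t. t * _"] cong: if_cong)
  ultimately show ?thesis by simp
qed

lemma line_in_open:
  assumes "open S" "x \<in> S"
  obtains e where "e > 0" "\<And>s. \<bar>s\<bar> < e \<Longrightarrow> x + s *\<^sub>R axis a 1 \<in> (S :: (real^'n) set)"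
proof -
  obtain e where e: "e > 0" "ball x e \<subseteq> S" using assms openE by blast
  have "x + s *\<^sub>R axis a 1 \<in> S" if "\<bar>s\<bar> < e" for s
    using e(2) that by (intro subsetD[OF e(2)]) (simp add: dist_norm)
  with e(1) show ?thesis by (rule that)
qed

lemma shear_invertible:
  obtains e where "e > 0" "\<And>s. \<bar>s\<bar> < e \<Longrightarrow> invertible (shear G s)"
proof -
  have "isCont (\<lambda>s. det (shear G s)) 0"
    unfolding det_def shear_nth by (intro continuous_intros)
  moreover have "det (shear G 0) \<noteq> 0" by simp
  ultimately obtain e where "e > 0" "\<forall>s. dist 0 s < e \<longrightarrow> det (shear G s) \<noteq> 0"
    using continuous_at_avoid by blast
  then show ?thesis using that by (simp add: invertible_det_nz)
qed

lemma smooth_metric_hodge: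
  assumes S: "open S" and \<phi>: "\<And>a b c. smooth_on S (\<lambda>y. \<phi> y a b c)" and pos: "\<And>y. y \<in> S \<Longrightarrow> positive3 (\<phi> y)"
  shows "smooth_on S (\<lambda>y. metric (\<phi> y) $ i $ j)" "smooth_on S (\<lambda>y. hodge (\<phi> y) a b c d)"
  by (rule function_algebra.metric[OF smooth_function_algebra[OF S] \<phi> pos]
      function_algebra.hodge[OF smooth_function_algebra[OF S] \<phi> pos]; assumption)+

text \<open>Metric and dual of the sheared form are the sheared metric and dual. By
  \<open>par\<close> the sheared form is constant to first order, hence so are they. As
  \<open>G\<close> may be any matrix satisfying \<open>par\<close>, the result serves the
  connections of both metrics.\<close>

lemma parallel_metric_hodge:
  assumes S: "open S" and x: "x \<in> S"
    and \<phi>: "\<And>a b c. smooth_on S (\<lambda>y. \<phi> y a b c)" and pos: "\<And>y. y \<in> S \<Longrightarrow> positive3 (\<phi> y)"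
    and par: "\<And>b c d. partial a (\<lambda>y. \<phi> y b c d) x = (\<Sum>e\<in>UNIV. G $ e $ b * \<phi> x e c d)
      + (\<Sum>e\<in>UNIV. G $ e $ c * \<phi> x b e d) + (\<Sum>e\<in>UNIV. G $ e $ d * \<phi> x b c e)"
  shows parallel_metric: "partial a (\<lambda>y. metric (\<phi> y) $ b $ c) x =
      (\<Sum>e\<in>UNIV. G $ e $ b * metric (\<phi> x) $ e $ c) + (\<Sum>e\<in>UNIV. G $ e $ c * metric (\<phi> x) $ b $ e)"
    and parallel_hodge: "partial a (\<lambda>y. hodge (\<phi> y) b c d f) x =
      (\<Sum>e\<in>UNIV. G $ e $ b * hodge (\<phi> x) e c d f) + (\<Sum>e\<in>UNIV. G $ e $ c * hodge (\<phi> x) b e d f)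
      + (\<Sum>e\<in>UNIV. G $ e $ d * hodge (\<phi> x) b c e f) + (\<Sum>e\<in>UNIV. G $ e $ f * hodge (\<phi> x) b c d e)"
proof -
  obtain e1 where e1: "e1 > 0" "\<And>s. \<bar>s\<bar> < e1 \<Longrightarrow> x + s *\<^sub>R axis a 1 \<in> S"
    using line_in_open[OF S x] by metis
  obtain e2 where e2: "e2 > 0" "\<And>s. \<bar>s\<bar> < e2 \<Longrightarrow> invertible (shear G s)"
    using shear_invertible[of G] by metis
  define e where "e = min e1 e2"
  define l where "l = (\<lambda>s. x + s *\<^sub>R axis a 1)"
  have l0: "l 0 = x" by (simp add: l_def)
  have e: "e > 0" "\<And>s. s \<in> {-e<..<e} \<Longrightarrow> l s \<in> S" "\<And>s. s \<in> {-e<..<e} \<Longrightarrow> invertible (shear G s)"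
    using e1 e2 by (auto simp: e_def l_def)
  interpret function_algebra "{-e<..<e}" "\<lambda>f. (f has_real_derivative 0) (at 0)"
    by (rule flat_function_algebra[OF e(1)])
  have line: "((\<lambda>s. f (l s)) has_real_derivative partial a f x) (at 0)" if "smooth_on S f" for f
    using partial_line[OF smooth_on_differentiable[OF that x]] by (simp add: l_def)
  define p where "p = (\<lambda>s b c d. \<Sum>i\<in>UNIV. shear G s $ i $ b * (\<Sum>j\<in>UNIV. shear G s $ j $ c *
     (\<Sum>k\<in>UNIV. shear G s $ k $ d * \<phi> (l s) i j k)))"
  have flat: "((\<lambda>s. p s b c d) has_real_derivative 0) (at 0)" for b c d
  proof -
    have 1: "((\<lambda>s. \<Sum>k\<in>UNIV. shear G s $ k $ d * \<phi> (l s) i j k) has_real_derivative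
        partial a (\<lambda>y. \<phi> y i j d) x - (\<Sum>k\<in>UNIV. G $ k $ d * \<phi> x i j k)) (at 0)" for i j
      using has_derivative_shear[of "\<lambda>k s. \<phi> (l s) i j k", OF line[OF \<phi>]] by (simp add: l0)
    have 2: "((\<lambda>s. \<Sum>j\<in>UNIV. shear G s $ j $ c * (\<Sum>k\<in>UNIV. shear G s $ k $ d * \<phi> (l s) i j k)) has_real_derivative
        partial a (\<lambda>y. \<phi> y i c d) x - (\<Sum>k\<in>UNIV. G $ k $ d * \<phi> x i c k) - (\<Sum>j\<in>UNIV. G $ j $ c * \<phi> x i j d)) (at 0)" for i
      using has_derivative_shear[of "\<lambda>j s. \<Sum>k\<in>UNIV. shear G s $ k $ d * \<phi> (l s) i j k", OF 1]
      by (simp add: l0 sum_mat_1)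
    show ?thesis
      using has_derivative_shear[of "\<lambda>i s. \<Sum>j\<in>UNIV. shear G s $ j $ c * (\<Sum>k\<in>UNIV. shear G s $ k $ d * \<phi> (l s) i j k)" _ G b, OF 2]
      unfolding p_def by (simp add: l0 sum_mat_1 par)
  qed
  \<comment> \<open>Shearing multiplies the frame on the right, so the sheared form stays positive
    while the shear is invertible.\<close>
  have frame: "\<exists>P. invertible P \<and> invertible (P ** shear G s) \<and> \<phi> (l s) = frame3 P \<and> p s = frame3 (P ** shear G s)"
    if s: "s \<in> {-e<..<e}" for s
  proof -
    obtain P where P: "invertible P" "\<phi> (l s) = frame3 P"
      using pos[OF e(2)[OF s]] by (auto simp: positive3_iff)
    have "p s = frame3 (P ** shear G s)"
      unfolding p_def P(2) frame3_pull[symmetric] by (simp add: fun_eq_iff sum_distrib_left mult.assoc)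
    then show ?thesis using P e(3)[OF s] invertible_mult by blast
  qed
  then have ppos: "positive3 (p s)" if "s \<in> {-e<..<e}" for s
    using that by (auto simp: positive3_iff)
  note sm = smooth_metric_hodge[OF S \<phi> pos]
  have "((\<lambda>s. \<Sum>i\<in>UNIV. shear G s $ i $ b * (\<Sum>j\<in>UNIV. shear G s $ j $ c * metric (\<phi> (l s)) $ i $ j)) has_real_derivative 0) (at 0)"
  proof (rule cong[OF metric[OF flat ppos]])
    fix s assume s: "s \<in> {-e<..<e}"
    then obtain P where P: "invertible P" "invertible (P ** shear G s)" "\<phi> (l s) = frame3 P" "p s = frame3 (P ** shear G s)"
      using frame by blast
    have "metric (p s) = transpose (shear G s) ** (metric (\<phi> (l s)) ** shear G s)"
      unfolding P(3,4) metric_vol_frame3[OF P(1)] metric_vol_frame3[OF P(2)]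
      by (simp add: matrix_transpose_mul matrix_mul_assoc)
    then show "metric (p s) $ b $ c = (\<Sum>i\<in>UNIV. shear G s $ i $ b * (\<Sum>j\<in>UNIV. shear G s $ j $ c * metric (\<phi> (l s)) $ i $ j))"
      by (simp add: matrix_matrix_mult_def transpose_def mult.commute)
  qed
  \<comment> \<open>The derivative of the sheared metric, zero by flatness, is also given by one
    application of \<open>has_derivative_shear\<close> for each index.\<close>
  from DERIV_unique[OF this has_derivative_shear[OF has_derivative_shear[OF line[OF sm(1)]]]]
  show "partial a (\<lambda>y. metric (\<phi> y) $ b $ c) x =
      (\<Sum>e\<in>UNIV. G $ e $ b * metric (\<phi> x) $ e $ c) + (\<Sum>e\<in>UNIV. G $ e $ c * metric (\<phi> x) $ b $ e)"
    by (simp add: sum_mat_1 l0)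
  have "((\<lambda>s. \<Sum>i\<in>UNIV. shear G s $ i $ b * (\<Sum>j\<in>UNIV. shear G s $ j $ c * (\<Sum>k\<in>UNIV. shear G s $ k $ d *
      (\<Sum>m\<in>UNIV. shear G s $ m $ f * hodge (\<phi> (l s)) i j k m)))) has_real_derivative 0) (at 0)"
  proof (rule cong[OF hodge[OF flat ppos]])
    fix s assume s: "s \<in> {-e<..<e}"
    then obtain P where P: "invertible P" "invertible (P ** shear G s)" "\<phi> (l s) = frame3 P" "p s = frame3 (P ** shear G s)"
      using frame by blast
    show "hodge (p s) b c d f = (\<Sum>i\<in>UNIV. shear G s $ i $ b * (\<Sum>j\<in>UNIV. shear G s $ j $ c * (\<Sum>k\<in>UNIV. shear G s $ k $ d *
      (\<Sum>m\<in>UNIV. shear G s $ m $ f * hodge (\<phi> (l s)) i j k m))))"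
      unfolding P(3,4) hodge_frame3[OF P(1)] hodge_frame3[OF P(2)] frame4_pull[symmetric]
      by (simp add: sum_distrib_left mult.assoc)
  qed
  from DERIV_unique[OF this has_derivative_shear[OF has_derivative_shear[OF has_derivative_shear[OF has_derivative_shear[OF line[OF sm(2)]]]]]]
  show "partial a (\<lambda>y. hodge (\<phi> y) b c d f) x =
      (\<Sum>e\<in>UNIV. G $ e $ b * hodge (\<phi> x) e c d f) + (\<Sum>e\<in>UNIV. G $ e $ c * hodge (\<phi> x) b e d f)
      + (\<Sum>e\<in>UNIV. G $ e $ d * hodge (\<phi> x) b c e f) + (\<Sum>e\<in>UNIV. G $ e $ f * hodge (\<phi> x) b c d e)"
    by (simp add: sum_mat_1 l0)
qed

section \<open>The deformed form and its metric in one chart\<close>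

locale g2_chart =
  fixes S :: "(real^7) set" and \<phi> :: "real^7 \<Rightarrow> form3" and v :: "real^7 \<Rightarrow> 7 \<Rightarrow> real"
  assumes S: "open S"
    and smooth_phi: "\<And>a b c. smooth_on S (\<lambda>y. \<phi> y a b c)"
    and pos: "\<And>y. y \<in> S \<Longrightarrow> positive3 (\<phi> y)"
    and smooth_v: "\<And>a. smooth_on S (\<lambda>y. v y a)"
begin

definition deformed_form :: "real^7 \<Rightarrow> form3" where
  "deformed_form y b i j = \<phi> y b i j + (\<Sum>e\<in>UNIV. v y e * hodge (\<phi> y) b i j e)"

definition lower :: "real^7 \<Rightarrow> 7 \<Rightarrow> real" where
  "lower y b = (\<Sum>c\<in>UNIV. metric (\<phi> y) $ b $ c * v y c)"

definition scale :: "real^7 \<Rightarrow> real" where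
  "scale y = (1 + (\<Sum>b\<in>UNIV. lower y b * v y b)) powr (1/3)"

sublocale function_algebra S "smooth_on S"
  by (rule smooth_function_algebra[OF S])

lemmas smooth_metric = smooth_metric_hodge(1)[OF S smooth_phi pos]
  and smooth_hodge = smooth_metric_hodge(2)[OF S smooth_phi pos]

lemma smooth_deformed: "smooth_on S (\<lambda>y. deformed_form y b i j)"
  unfolding deformed_form_def by (intro add sum mult smooth_phi smooth_v smooth_hodge)

lemma smooth_lower: "smooth_on S (\<lambda>y. lower y b)"
  unfolding lower_def by (intro sum mult smooth_metric smooth_v)

lemma frame_lower:
  assumes "\<phi> y = frame3 P" "invertible P"
  shows "lower y b = (P *v axis b 1) \<bullet> (P *v (\<chi> e. v y e))"
    "(\<Sum>b\<in>UNIV. lower y b * v y b) = (P *v (\<chi> e. v y e)) \<bullet> (P *v (\<chi> e. v y e))"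
    "metric (\<phi> y) $ b $ c = (P *v axis b 1) \<bullet> (P *v axis c 1)"
proof -
  have l: "lower y b = axis b 1 \<bullet> ((transpose P ** P) *v (\<chi> e. v y e))" for b
    by (simp add: lower_def assms metric_vol_frame3 inner_axis' matrix_vector_mult_def)
  show "lower y b = (P *v axis b 1) \<bullet> (P *v (\<chi> e. v y e))"
    unfolding l inner_gram ..
  show "(\<Sum>b\<in>UNIV. lower y b * v y b) = (P *v (\<chi> e. v y e)) \<bullet> (P *v (\<chi> e. v y e))"
    unfolding inner_gram[symmetric] l by (simp add: inner_vec_def[of "\<chi> e. v y e"] inner_axis' mult.commute)
  show "metric (\<phi> y) $ b $ c = (P *v axis b 1) \<bullet> (P *v axis c 1)"
    by (simp add: assms metric_vol_frame3 gram_nth)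
qed

lemma scale:
  assumes "y \<in> S"
  shows "scale y > 0" "scale y ^ 3 = 1 + (\<Sum>b\<in>UNIV. lower y b * v y b)"
proof -
  obtain P where "invertible P" "\<phi> y = frame3 P" using pos[OF assms] by (auto simp: positive3_iff)
  then have "(\<Sum>b\<in>UNIV. lower y b * v y b) \<ge> 0" using frame_lower(2)[of y P] by simp
  then have p: "1 + (\<Sum>b\<in>UNIV. lower y b * v y b) > 0" by linarith
  then show "scale y > 0" by (simp add: scale_def)
  have "scale y ^ 3 = scale y powr 3" using \<open>scale y > 0\<close> by (simp add: powr_numeral)
  also have "\<dots> = 1 + (\<Sum>b\<in>UNIV. lower y b * v y b)"
    unfolding scale_def powr_powr using p by simp
  finally show "scale y ^ 3 = 1 + (\<Sum>b\<in>UNIV. lower y b * v y b)" .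
qed

lemma deformed_metric:
  assumes "y \<in> S"
  shows positive_deformed: "positive3 (deformed_form y)"
    and metric_deformed: "metric (deformed_form y) $ b $ c =
      scale y * metric (\<phi> y) $ b $ c - 1 / (scale y)^2 * (lower y b * lower y c)"
proof -
  obtain P where P: "invertible P" "\<phi> y = frame3 P" using pos[OF assms] by (auto simp: positive3_iff)
  let ?v = "\<chi> e. v y e"
  note fl = frame_lower[OF P(2,1)]
  obtain Q where Q: "invertible Q"
    "\<And>b i j. frame3 P b i j + (\<Sum>e\<in>UNIV. ?v $ e * frame4 P b i j e) = frame3 Q b i j"
    "\<And>x z. (Q *v x) \<bullet> (Q *v z) = scale y * ((P *v x) \<bullet> (P *v z))
        - 1 / (scale y)^2 * (((P *v ?v) \<bullet> (P *v x)) * ((P *v ?v) \<bullet> (P *v z)))"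
    by (rule deformed_frame[OF P(1) scale(1)[OF assms] scale(2)[OF assms, unfolded fl(2)]]) blast
  have d: "deformed_form y = frame3 Q"
    using Q(2) by (simp add: fun_eq_iff deformed_form_def P hodge_frame3)
  then show "positive3 (deformed_form y)" using Q(1) by (auto simp: positive3_iff)
  have "metric (deformed_form y) $ b $ c = (Q *v axis b 1) \<bullet> (Q *v axis c 1)"
    by (simp add: d metric_vol_frame3[OF Q(1)] gram_nth)
  then show "metric (deformed_form y) $ b $ c =
      scale y * metric (\<phi> y) $ b $ c - 1 / (scale y)^2 * (lower y b * lower y c)"
    unfolding Q(3) fl by (simp add: inner_commute)
qed

section \<open>Derivatives at a point in one direction, with connection matrix \<open>G\<close> and
  covariant derivative \<open>U\<close> of the vector field\<close>

context
  fixes x :: "real^7" and a :: 7 and G :: "real^7^7" and U :: "real^7"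
  assumes x: "x \<in> S"
    and par: "\<And>b c d. partial a (\<lambda>y. \<phi> y b c d) x = (\<Sum>e\<in>UNIV. G $ e $ b * \<phi> x e c d)
      + (\<Sum>e\<in>UNIV. G $ e $ c * \<phi> x b e d) + (\<Sum>e\<in>UNIV. G $ e $ d * \<phi> x b c e)"
    and U: "\<And>e. U $ e = partial a (\<lambda>y. v y e) x + (\<Sum>f\<in>UNIV. G $ e $ f * v x f)"
begin

lemma line_derivative:
  "smooth_on S f \<Longrightarrow> ((\<lambda>s. f (x + s *\<^sub>R axis a 1)) has_real_derivative partial a f x) (at 0)"
  by (rule partial_line[OF smooth_on_differentiable[OF _ x]])

lemma partial_eqI:
  assumes "smooth_on S f" "((\<lambda>s. f (x + s *\<^sub>R axis a 1)) has_real_derivative D) (at 0)"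
  shows "partial a f x = D"
  using DERIV_unique[OF line_derivative[OF assms(1)] assms(2)] .

lemma partial_metric:
  "partial a (\<lambda>y. metric (\<phi> y) $ b $ c) x =
      (\<Sum>e\<in>UNIV. G $ e $ b * metric (\<phi> x) $ e $ c) + (\<Sum>e\<in>UNIV. G $ e $ c * metric (\<phi> x) $ b $ e)"
  by (rule parallel_metric[where \<phi> = \<phi>, OF S x smooth_phi pos par])

lemma partial_hodge:
  "partial a (\<lambda>y. hodge (\<phi> y) b c d f) x =
      (\<Sum>e\<in>UNIV. G $ e $ b * hodge (\<phi> x) e c d f) + (\<Sum>e\<in>UNIV. G $ e $ c * hodge (\<phi> x) b e d f)
      + (\<Sum>e\<in>UNIV. G $ e $ d * hodge (\<phi> x) b c e f) + (\<Sum>e\<in>UNIV. G $ e $ f * hodge (\<phi> x) b c d e)"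
  by (rule parallel_hodge[where \<phi> = \<phi>, OF S x smooth_phi pos par])

text \<open>Both the form and its dual are parallel for \<open>G\<close>, so by the Leibniz rule
  only the derivative of the vector field survives.\<close>

lemma nabla_deformed:
  "partial a (\<lambda>y. deformed_form y b i j) x = (\<Sum>e\<in>UNIV. U $ e * hodge (\<phi> x) b i j e)
    + (\<Sum>f\<in>UNIV. G $ f $ b * deformed_form x f i j) + (\<Sum>f\<in>UNIV. G $ f $ i * deformed_form x b f j)
    + (\<Sum>f\<in>UNIV. G $ f $ j * deformed_form x b i f)"
proof -
  let ?h = "hodge (\<phi> x)"
  have "partial a (\<lambda>y. deformed_form y b i j) x = partial a (\<lambda>y. \<phi> y b i j) x +
     (\<Sum>e\<in>UNIV. partial a (\<lambda>y. v y e) x * ?h b i j e + partial a (\<lambda>y. hodge (\<phi> y) b i j e) x * v x e)"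
    by (rule partial_eqI[OF smooth_deformed], unfold deformed_form_def)
      (auto intro!: derivative_eq_intros line_derivative[OF smooth_phi] line_derivative[OF smooth_v] line_derivative[OF smooth_hodge])
  also have "(\<Sum>e\<in>UNIV. partial a (\<lambda>y. v y e) x * ?h b i j e + partial a (\<lambda>y. hodge (\<phi> y) b i j e) x * v x e) =
     (\<Sum>e\<in>UNIV. partial a (\<lambda>y. v y e) x * ?h b i j e)
     + (\<Sum>e\<in>UNIV. \<Sum>f\<in>UNIV. G $ f $ b * (v x e * ?h f i j e)) + (\<Sum>e\<in>UNIV. \<Sum>f\<in>UNIV. G $ f $ i * (v x e * ?h b f j e))
     + (\<Sum>e\<in>UNIV. \<Sum>f\<in>UNIV. G $ f $ j * (v x e * ?h b i f e)) + (\<Sum>e\<in>UNIV. \<Sum>f\<in>UNIV. G $ f $ e * v x e * ?h b i j f)"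
    unfolding partial_hodge
    by (simp add: sum.distrib sum_distrib_left sum_distrib_right ring_distribs mult_ac)
  also have "(\<Sum>e\<in>UNIV. \<Sum>f\<in>UNIV. G $ f $ e * v x e * ?h b i j f) = (\<Sum>f\<in>UNIV. (\<Sum>e\<in>UNIV. G $ f $ e * v x e) * ?h b i j f)"
    by (subst sum.swap) (simp add: sum_distrib_right)
  also have "(\<Sum>e\<in>UNIV. \<Sum>f\<in>UNIV. G $ f $ b * (v x e * ?h f i j e)) = (\<Sum>f\<in>UNIV. G $ f $ b * (\<Sum>e\<in>UNIV. v x e * ?h f i j e))"
    by (subst sum.swap) (simp add: sum_distrib_left)
  also have "(\<Sum>e\<in>UNIV. \<Sum>f\<in>UNIV. G $ f $ i * (v x e * ?h b f j e)) = (\<Sum>f\<in>UNIV. G $ f $ i * (\<Sum>e\<in>UNIV. v x e * ?h b f j e))"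
    by (subst sum.swap) (simp add: sum_distrib_left)
  also have "(\<Sum>e\<in>UNIV. \<Sum>f\<in>UNIV. G $ f $ j * (v x e * ?h b i f e)) = (\<Sum>f\<in>UNIV. G $ f $ j * (\<Sum>e\<in>UNIV. v x e * ?h b i f e))"
    by (subst sum.swap) (simp add: sum_distrib_left)
  finally show ?thesis
    unfolding par deformed_form_def U by (simp add: sum.distrib ring_distribs)
qed

lemma metric_sym: "metric (\<phi> x) $ b $ c = metric (\<phi> x) $ c $ b"
  using positive3_induces[OF pos[OF x]] unfolding induces_def by (metis transpose_nth)

lemma partial_lower:
  "partial a (\<lambda>y. lower y b) x = (\<Sum>e\<in>UNIV. G $ e $ b * lower x e) + (\<Sum>c\<in>UNIV. metric (\<phi> x) $ b $ c * U $ c)"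
proof -
  let ?g = "metric (\<phi> x)"
  have "partial a (\<lambda>y. lower y b) x = (\<Sum>c\<in>UNIV. partial a (\<lambda>y. metric (\<phi> y) $ b $ c) x * v x c + partial a (\<lambda>y. v y c) x * ?g $ b $ c)"
    by (rule partial_eqI[OF smooth_lower], unfold lower_def)
      (auto intro!: derivative_eq_intros line_derivative[OF smooth_metric] line_derivative[OF smooth_v])
  also have "\<dots> = (\<Sum>c\<in>UNIV. \<Sum>e\<in>UNIV. G $ e $ b * (?g $ e $ c * v x c)) + (\<Sum>c\<in>UNIV. \<Sum>e\<in>UNIV. ?g $ b $ e * (G $ e $ c * v x c))
     + (\<Sum>c\<in>UNIV. ?g $ b $ c * partial a (\<lambda>y. v y c) x)"
    unfolding partial_metric
    by (simp add: sum.distrib sum_distrib_left sum_distrib_right ring_distribs mult_ac)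
  also have "(\<Sum>c\<in>UNIV. \<Sum>e\<in>UNIV. G $ e $ b * (?g $ e $ c * v x c)) = (\<Sum>e\<in>UNIV. G $ e $ b * lower x e)"
    by (subst sum.swap) (simp add: lower_def sum_distrib_left)
  also have "(\<Sum>c\<in>UNIV. \<Sum>e\<in>UNIV. ?g $ b $ e * (G $ e $ c * v x c)) = (\<Sum>e\<in>UNIV. ?g $ b $ e * (\<Sum>c\<in>UNIV. G $ e $ c * v x c))"
    by (subst sum.swap) (simp add: sum_distrib_left)
  finally show ?thesis unfolding U by (simp add: sum.distrib ring_distribs)
qed

text \<open>The \<open>G\<close> term from the derivative of \<open>lower\<close> completes the
  partial derivative of \<open>v\<close> to \<open>U\<close>, so both halves of the product rule
  give the pairing with \<open>U\<close>.\<close>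

lemma partial_norm:
  "(\<Sum>b\<in>UNIV. partial a (\<lambda>y. lower y b) x * v x b + partial a (\<lambda>y. v y b) x * lower x b) = 2 * (\<Sum>e\<in>UNIV. lower x e * U $ e)"
proof -
  let ?g = "metric (\<phi> x)"
  have 1: "(\<Sum>b\<in>UNIV. \<Sum>c\<in>UNIV. ?g $ b $ c * U $ c * v x b) = (\<Sum>e\<in>UNIV. lower x e * U $ e)"
    by (subst sum.swap) (simp add: lower_def sum_distrib_left sum_distrib_right metric_sym mult_ac)
  have 2: "(\<Sum>b\<in>UNIV. \<Sum>e\<in>UNIV. G $ e $ b * lower x e * v x b) = (\<Sum>e\<in>UNIV. lower x e * (\<Sum>b\<in>UNIV. G $ e $ b * v x b))"
    by (subst sum.swap) (simp add: sum_distrib_left mult_ac)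
  have "(\<Sum>b\<in>UNIV. partial a (\<lambda>y. lower y b) x * v x b + partial a (\<lambda>y. v y b) x * lower x b) =
    (\<Sum>b\<in>UNIV. \<Sum>e\<in>UNIV. G $ e $ b * lower x e * v x b) + (\<Sum>b\<in>UNIV. \<Sum>c\<in>UNIV. ?g $ b $ c * U $ c * v x b)
     + (\<Sum>b\<in>UNIV. lower x b * partial a (\<lambda>y. v y b) x)"
    unfolding partial_lower by (simp add: sum.distrib sum_distrib_left sum_distrib_right ring_distribs mult_ac)
  moreover have "(\<Sum>e\<in>UNIV. lower x e * U $ e) = (\<Sum>b\<in>UNIV. lower x b * partial a (\<lambda>y. v y b) x)
     + (\<Sum>e\<in>UNIV. lower x e * (\<Sum>b\<in>UNIV. G $ e $ b * v x b))"
    unfolding U by (simp add: sum.distrib ring_distribs)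
  ultimately show ?thesis unfolding 1 2 by linarith
qed

text \<open>The derivative of |v|^2 is 2 m, so the cube root r of 1+|v|^2 has derivative 2 m / (3
  r^2). The factor 4/3 comes from the derivative of -1/r^2.\<close>

lemma nabla_deformed_metric:
  defines "m \<equiv> \<Sum>e\<in>UNIV. lower x e * U $ e" and "W \<equiv> \<lambda>b. \<Sum>c\<in>UNIV. metric (\<phi> x) $ b $ c * U $ c" and "r \<equiv> scale x"
  shows "partial a (\<lambda>y. metric (deformed_form y) $ b $ c) x =
    2/3 * m / r^2 * metric (\<phi> x) $ b $ c + 4/3 * m / r^5 * (lower x b * lower x c) - 1 / r^2 * (W b * lower x c + lower x b * W c)
     + (\<Sum>e\<in>UNIV. G $ e $ b * metric (deformed_form x) $ e $ c) + (\<Sum>e\<in>UNIV. G $ e $ c * metric (deformed_form x) $ b $ e)"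
proof -
  let ?l = "\<lambda>s. x + s *\<^sub>R axis a 1"
  let ?g = "metric (\<phi> x)"
  note sc = scale[OF x, folded r_def]
  define M where "M = (\<Sum>b\<in>UNIV. lower x b * v x b)"
  have M: "1 + M > 0" using sc by (metis M_def zero_less_power)
  define r' where "r' = 2/3 * m / r^2"
  have dl: "((\<lambda>s. lower (?l s) b) has_real_derivative partial a (\<lambda>y. lower y b) x) (at 0)" for b
    by (rule line_derivative[OF smooth_lower])
  have dM: "((\<lambda>s. 1 + (\<Sum>b\<in>UNIV. lower (?l s) b * v (?l s) b)) has_real_derivative 2 * m) (at 0)"
    unfolding m_def partial_norm[symmetric]
    by (auto intro!: derivative_eq_intros dl line_derivative[OF smooth_v])
  have r3: "r = (1 + M) powr (1/3)" unfolding r_def scale_def M_def ..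
  have "(1/3) * (2 * m) * (1 + M) powr (1/3 - 1) = r'"
  proof -
    have "(1 + M) powr (1/3 - 1) = (1 + M) powr (- 2 * (1/3))" by simp
    also have "\<dots> = r powr (- 2)" unfolding r3 powr_powr by simp
    also have "\<dots> = 1 / r^2" using sc by (simp add: powr_minus powr_numeral divide_inverse)
    finally show ?thesis by (simp add: r'_def)
  qed
  then have dr: "((\<lambda>s. scale (?l s)) has_real_derivative r') (at 0)"
    unfolding scale_def
    using DERIV_fun_powr[OF dM, of "1/3"] M by (simp add: M_def mult_ac)
  have "((\<lambda>s. scale (?l s) * metric (\<phi> (?l s)) $ b $ c - 1 / (scale (?l s))^2 * (lower (?l s) b * lower (?l s) c)) has_real_derivative
     r' * ?g $ b $ c + r * partial a (\<lambda>y. metric (\<phi> y) $ b $ c) x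
     + 2 * r' / r^3 * (lower x b * lower x c)
     - 1 / r^2 * (partial a (\<lambda>y. lower y b) x * lower x c + lower x b * partial a (\<lambda>y. lower y c) x)) (at 0)"
    using sc(1) by (auto intro!: derivative_eq_intros dl dr line_derivative[OF smooth_metric] simp: r_def[symmetric] field_simps eval_nat_numeral)
  moreover have "smooth_on S (\<lambda>y. metric (deformed_form y) $ b $ c)"
    by (rule metric[OF smooth_deformed positive_deformed])
  then have "((\<lambda>s. metric (deformed_form (?l s)) $ b $ c) has_real_derivative partial a (\<lambda>y. metric (deformed_form y) $ b $ c) x) (at 0)"
    by (rule line_derivative)
  \<comment> \<open>The formula for the deformed metric holds on \<open>S\<close> only, so the two
    functions are compared on a short piece of the coordinate line.\<close>
  moreover have "((\<lambda>s. metric (deformed_form (?l s)) $ b $ c) has_real_derivative D) (at 0)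
      \<longleftrightarrow> ((\<lambda>s. scale (?l s) * metric (\<phi> (?l s)) $ b $ c - 1 / (scale (?l s))^2 * (lower (?l s) b * lower (?l s) c)) has_real_derivative D) (at 0)" for D
  proof -
    obtain e where e: "e > 0" "\<And>s. \<bar>s\<bar> < e \<Longrightarrow> ?l s \<in> S"
      using line_in_open[OF S x] by metis
    have "eventually (\<lambda>s::real. s \<in> {-e<..<e}) (nhds 0)"
      using e(1) by (intro eventually_nhds_in_open) auto
    then have "eventually (\<lambda>s. metric (deformed_form (?l s)) $ b $ c =
       scale (?l s) * metric (\<phi> (?l s)) $ b $ c - 1 / (scale (?l s))^2 * (lower (?l s) b * lower (?l s) c)) (nhds 0)"
      by eventually_elim (rule metric_deformed, rule e(2), auto)
    then show ?thesis by (intro DERIV_cong_ev refl)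
  qed
  ultimately have D: "partial a (\<lambda>y. metric (deformed_form y) $ b $ c) x = r' * ?g $ b $ c + r * partial a (\<lambda>y. metric (\<phi> y) $ b $ c) x
     + 2 * r' / r^3 * (lower x b * lower x c)
     - 1 / r^2 * (partial a (\<lambda>y. lower y b) x * lower x c + lower x b * partial a (\<lambda>y. lower y c) x)"
    using DERIV_unique by blast
  have r5: "2 * r' / r^3 = 4/3 * m / r^5" using sc(1) by (simp add: r'_def field_simps eval_nat_numeral)
  have g: "(\<Sum>e\<in>UNIV. G $ e $ b * metric (deformed_form x) $ e $ c) = r * (\<Sum>e\<in>UNIV. G $ e $ b * ?g $ e $ c)
      - 1 / r^2 * ((\<Sum>e\<in>UNIV. G $ e $ b * lower x e) * lower x c)" for b c
    unfolding metric_deformed[OF x, folded r_def] 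
    by (simp add: sum_distrib_left sum_distrib_right sum_subtractf right_diff_distrib mult_ac)
  have g': "(\<Sum>e\<in>UNIV. G $ e $ c * metric (deformed_form x) $ b $ e) = r * (\<Sum>e\<in>UNIV. G $ e $ c * ?g $ b $ e)
      - 1 / r^2 * (lower x b * (\<Sum>e\<in>UNIV. G $ e $ c * lower x e))"
    unfolding metric_deformed[OF x, folded r_def] 
    by (simp add: sum_distrib_left sum_distrib_right sum_subtractf right_diff_distrib mult_ac)
  show ?thesis
    unfolding D r5 g g' partial_metric partial_lower W_def[symmetric] r'_def by (simp only: W_def) (simp add: algebra_simps)
qed
end
end

section \<open>Both implications at a point\<close>

lemma christoffel_sym:
  assumes "\<And>a b d. partial d (\<lambda>y. g y $ a $ b) x = partial d (\<lambda>y. g y $ b $ a) x"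
  shows "christoffel g x c a b = christoffel g x c b a"
  unfolding christoffel_def by (intro sum.cong refl) (simp add: assms[of _ b a])

text \<open>Uniqueness of the torsion-free metric connection, at a single point. With the upper
  index lowered, each derivative of the metric is a sum of two terms \<open>L\<close>, and in the
  Koszul combination all but twice \<open>L a b d\<close> cancel.\<close>

lemma christoffel_unique:
  fixes \<Gamma> :: "'n::finite \<Rightarrow> 'n \<Rightarrow> 'n \<Rightarrow> real"
  assumes sym: "\<And>b c. g x $ b $ c = g x $ c $ b" and inv: "invertible (g x)"
    and \<Gamma>: "\<And>c a b. \<Gamma> c a b = \<Gamma> c b a"
    and compat: "\<And>a b c. partial a (\<lambda>y. g y $ b $ c) x =
      (\<Sum>e\<in>UNIV. \<Gamma> e a b * g x $ e $ c) + (\<Sum>e\<in>UNIV. \<Gamma> e a c * g x $ b $ e)"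
  shows "christoffel g x c a b = \<Gamma> c a b"
proof -
  define L where "L = (\<lambda>a b d. \<Sum>e\<in>UNIV. \<Gamma> e a b * g x $ e $ d)"
  have L: "L a b d = L b a d" for a b d unfolding L_def by (simp add: \<Gamma>[of _ a b])
  have p: "partial a (\<lambda>y. g y $ b $ d) x = L a b d + L a d b" for a b d
    unfolding compat L_def by (simp add: sym[of b])
  have "christoffel g x c a b = (\<Sum>d\<in>UNIV. matrix_inv (g x) $ c $ d * L a b d)"
    unfolding christoffel_def p using L[of a b] L[of a _ b] L[of b _ a]
    by (intro sum.cong refl) simp
  also have "\<dots> = (\<Sum>d\<in>UNIV. \<Sum>e\<in>UNIV. \<Gamma> e a b * (matrix_inv (g x) $ c $ d * g x $ d $ e))"
    unfolding L_def by (simp add: sum_distrib_left sym[of _ ] mult_ac)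
  also have "\<dots> = (\<Sum>e\<in>UNIV. \<Gamma> e a b * (matrix_inv (g x) ** g x) $ c $ e)"
    by (subst sum.swap) (simp add: matrix_matrix_mult_def sum_distrib_left)
  also have "\<dots> = \<Gamma> c a b"
    using matrix_inv_inverse[OF inv] by (simp add: mat_def if_distrib[of "\<lambda>t. _ * t"] cong: if_cong)
  finally show ?thesis .
qed

text \<open>Brings a vanishing covariant derivative into the shape of the assumption
  \<open>par\<close>, with the Christoffel symbols in direction \<open>a\<close> as the matrix
  \<open>G\<close>.\<close>

lemma nabla_three_eq_0_iff:
  "nabla_three g \<phi> x a b c d = 0 \<longleftrightarrow> partial a (\<lambda>y. \<phi> y b c d) x =
     (\<Sum>e\<in>UNIV. (\<chi> e b. christoffel g x e a b) $ e $ b * \<phi> x e c d)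
     + (\<Sum>e\<in>UNIV. (\<chi> e b. christoffel g x e a b) $ e $ c * \<phi> x b e d)
     + (\<Sum>e\<in>UNIV. (\<chi> e b. christoffel g x e a b) $ e $ d * \<phi> x b c e)"
  unfolding nabla_three_def vec_lambda_beta by linarith

context g2_chart
begin

abbreviation "g \<equiv> \<lambda>y. metric (\<phi> y)"
abbreviation "g' \<equiv> \<lambda>y. metric (deformed_form y)"

lemma metric_sym': "y \<in> S \<Longrightarrow> g' y $ b $ c = g' y $ c $ b"
  using positive3_induces[OF positive_deformed] unfolding induces_def by (metis transpose_nth)

context
  fixes x
  assumes x: "x \<in> S" and flat: "\<And>a b c d. nabla_three g \<phi> x a b c d = 0"
begin

definition "conn a = (\<chi> e b. christoffel g x e a b)"
definition "conn' a = (\<chi> e b. christoffel g' x e a b)"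
definition "dv a = (\<chi> e. nabla_vector g v x a e)"

lemma par: "partial a (\<lambda>y. \<phi> y b c d) x = (\<Sum>e\<in>UNIV. conn a $ e $ b * \<phi> x e c d)
      + (\<Sum>e\<in>UNIV. conn a $ e $ c * \<phi> x b e d) + (\<Sum>e\<in>UNIV. conn a $ e $ d * \<phi> x b c e)"
  using flat[of a b c d] unfolding nabla_three_eq_0_iff conn_def .

lemma dv: "dv a $ e = partial a (\<lambda>y. v y e) x + (\<Sum>f\<in>UNIV. conn a $ e $ f * v x f)"
  by (simp add: dv_def nabla_vector_def conn_def)

lemma conn_sym: "conn a $ e $ b = conn b $ e $ a"
  unfolding conn_def vec_lambda_beta
proof (rule christoffel_sym)
  show "partial d (\<lambda>y. g y $ a $ b) x = partial d (\<lambda>y. g y $ b $ a) x" for a b d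
    unfolding partial_metric[OF x par dv] by (simp add: metric_sym[OF x par dv])
qed

lemma torsion_free_if_parallel:
  assumes "\<And>a b. nabla_vector g v x a b = 0"
  shows "nabla_three g' deformed_form x a b c d = 0"
proof -
  have dv0: "dv a $ e = 0" for a e using assms by (simp add: dv_def)
  have par': "partial a (\<lambda>y. deformed_form y b c d) x = (\<Sum>e\<in>UNIV. conn a $ e $ b * deformed_form x e c d)
      + (\<Sum>e\<in>UNIV. conn a $ e $ c * deformed_form x b e d) + (\<Sum>e\<in>UNIV. conn a $ e $ d * deformed_form x b c e)" for a b c d
    using nabla_deformed[OF x par dv] by (simp add: dv0)
  have pm: "partial a (\<lambda>y. g' y $ b $ c) x =
      (\<Sum>e\<in>UNIV. conn a $ e $ b * g' x $ e $ c) + (\<Sum>e\<in>UNIV. conn a $ e $ c * g' x $ b $ e)" for a b c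
    by (rule parallel_metric[where \<phi> = deformed_form, OF S x smooth_deformed positive_deformed par'])
  \<comment> \<open>By \<open>pm\<close> the old connection is compatible with the new metric, and
    it is torsion-free.\<close>
  have "christoffel g' x e a b = conn a $ e $ b" for e a b
    by (rule christoffel_unique[where \<Gamma> = "\<lambda>e a b. conn a $ e $ b"])
      (use metric_sym'[OF x] induces_wedge_matrix(4)[OF positive3_induces[OF positive_deformed[OF x]]] conn_sym pm in auto)
  then show ?thesis
    unfolding nabla_three_eq_0_iff vec_lambda_beta by (simp add: par')
qed

text \<open>The two covariant derivatives at \<open>x\<close> are subtracted, and the resulting
  index identities are turned into identities of multilinear maps on the frame \<open>P\<close>,
  where \<open>torsion_kernel\<close> applies.\<close>

lemma parallel_if_torsion_free:
  assumes flat': "\<And>a b c d. nabla_three g' deformed_form x a b c d = 0"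
  shows "nabla_vector g v x a b = 0"
proof -
  have par': "partial a (\<lambda>y. deformed_form y b c d) x = (\<Sum>e\<in>UNIV. conn' a $ e $ b * deformed_form x e c d)
      + (\<Sum>e\<in>UNIV. conn' a $ e $ c * deformed_form x b e d) + (\<Sum>e\<in>UNIV. conn' a $ e $ d * deformed_form x b c e)" for a b c d
    using flat'[of a b c d] unfolding nabla_three_eq_0_iff conn'_def .
  have pm: "partial a (\<lambda>y. g' y $ b $ c) x =
      (\<Sum>e\<in>UNIV. conn' a $ e $ b * g' x $ e $ c) + (\<Sum>e\<in>UNIV. conn' a $ e $ c * g' x $ b $ e)" for a b c
    by (rule parallel_metric[where \<phi> = deformed_form, OF S x smooth_deformed positive_deformed par'])
  have conn'_sym: "conn' a $ e $ b = conn' b $ e $ a" for a b e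
    unfolding conn'_def vec_lambda_beta
  proof (rule christoffel_sym)
    show "partial d (\<lambda>y. g' y $ a $ b) x = partial d (\<lambda>y. g' y $ b $ a) x" for a b d
      unfolding pm by (simp add: metric_sym'[OF x, of a] metric_sym'[OF x, of b])
  qed
  define C where "C = (\<lambda>a. conn' a - conn a)"
  have C_sym: "C a $ e $ b = C b $ e $ a" for a b e
    by (simp add: C_def conn_sym[of a] conn'_sym[of a])
  have form: "(\<Sum>e\<in>UNIV. dv a $ e * hodge (\<phi> x) b i j e) = (\<Sum>f\<in>UNIV. C a $ f $ b * deformed_form x f i j)
      + (\<Sum>f\<in>UNIV. C a $ f $ i * deformed_form x b f j) + (\<Sum>f\<in>UNIV. C a $ f $ j * deformed_form x b i f)" for a b i j
    using nabla_deformed[OF x par dv, of a b i j] par'[of a b i j]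
    by (simp add: C_def left_diff_distrib sum_subtractf)
  obtain P where P: "invertible P" "\<phi> x = frame3 P" using pos[OF x] by (auto simp: positive3_iff)
  then obtain R where R: "P ** R = mat 1" "R ** P = mat 1" by (auto simp: invertible_def)
  have PR: "P *v (R *v y) = y" "R *v (P *v y) = y" for y
    by (simp_all add: matrix_vector_mul_assoc R)
  define u where "u = P *v (\<chi> e. v x e)"
  define f where "f = 1 + u \<bullet> u"
  note fl = frame_lower[OF P(2,1), folded u_def]
  define p where "p = (\<lambda>y z w. cross7 y z \<bullet> w + psi0 y z w u)"
  have p_lin: "linear (\<lambda>y. p y z w)" "linear (\<lambda>z. p y z w)" "linear (\<lambda>w. p y z w)" for y z w
    by (intro linearI; simp add: p_def cross7_lin inner_lin psi0_add psi0_scale algebra_simps)+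
  have def_p: "deformed_form x b i j = p (P *v axis b 1) (P *v axis i 1) (P *v axis j 1)" for b i j
    using sum_frame4_last[of "\<chi> e. v x e" P b i j]
    by (simp add: deformed_form_def P(2) hodge_frame3[OF P(1)] p_def frame3_def u_def)
  \<comment> \<open>\<open>V\<close> is the covariant derivative of the vector field as an
    endomorphism and \<open>E\<close> the difference of the connections as a bilinear map, both
    still in chart coordinates.\<close>
  define V where "V = (\<chi> e a. dv a $ e)"
  define E where "E = (\<lambda>X Y. \<Sum>a\<in>UNIV. X $ a *\<^sub>R (C a *v Y))"
  have V_axis: "V *v axis a 1 = dv a" for a
    by (simp add: vec_eq_iff frame_nth V_def)
  have E_axis: "E (axis a 1) Y = C a *v Y" for a Y
    unfolding E_def by (simp add: axis_component if_distrib[of "\<lambda>t. t *\<^sub>R _"] cong: if_cong)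
  have E_add: "E (X + X') Y = E X Y + E X' Y" "E X (Y + Y') = E X Y + E X Y'" for X X' Y Y'
    by (simp_all add: E_def scaleR_add_left scaleR_add_right sum.distrib matrix_vector_right_distrib)
  have E_scale: "E (c *\<^sub>R X) Y = c *\<^sub>R E X Y" "E X (c *\<^sub>R Y) = c *\<^sub>R E X Y" for c X Y
    by (simp_all add: E_def scaleR_sum_right matrix_vector_mult_scaleR mult.commute)
  have E_sym: "E X Y = E Y X" for X Y
  proof -
    have "E X Y $ e = E Y X $ e" for e
    proof -
      have "E X Y $ e = (\<Sum>a\<in>UNIV. \<Sum>b\<in>UNIV. X $ a * (C a $ e $ b * Y $ b))"
        by (simp add: E_def matrix_vector_mult_def sum_distrib_left)
      also have "\<dots> = (\<Sum>b\<in>UNIV. \<Sum>a\<in>UNIV. X $ a * (C a $ e $ b * Y $ b))"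
        by (rule sum.swap)
      also have "\<dots> = E Y X $ e"
        by (simp add: E_def matrix_vector_mult_def sum_distrib_left C_sym mult_ac)
      finally show ?thesis .
    qed
    then show ?thesis by (simp add: vec_eq_iff)
  qed
  note lin = matrix_vector_right_distrib matrix_vector_mult_scaleR E_add E_scale inner_lin psi0_add psi0_scale
    linear_add[OF p_lin(1)] linear_add[OF p_lin(2)] linear_add[OF p_lin(3)]
    linear_cmul[OF p_lin(1)] linear_cmul[OF p_lin(2)] linear_cmul[OF p_lin(3)]
  have coords: "(\<Sum>e\<in>UNIV. X $ e * h (P *v axis e 1)) = h (P *v X)"
    if "linear h" for h :: "real^7 \<Rightarrow> real" and X
  proof -
    have "linear (\<lambda>y. h (P *v y))"
      using that by (intro linearI) (simp_all add: lin linear_add linear_cmul)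
    from linear_expand[OF this, of X] show ?thesis by simp
  qed
  have column: "(\<Sum>e\<in>UNIV. M $ e $ b * h (P *v axis e 1)) = h (P *v (M *v axis b 1))"
    if "linear h" for h :: "real^7 \<Rightarrow> real" and M b
    using coords[OF that, of "M *v axis b 1"] by (simp add: frame_nth)
  have form': "psi0 (P *v Y) (P *v Z) (P *v W) (P *v (V *v X)) =
      p (P *v E X Y) (P *v Z) (P *v W) + p (P *v Y) (P *v E X Z) (P *v W) + p (P *v Y) (P *v Z) (P *v E X W)"
    (is "?f X Y Z W = ?h X Y Z W") for X Y Z W
  proof -
    have "?f (axis a 1) (axis b 1) (axis i 1) (axis j 1) = ?h (axis a 1) (axis b 1) (axis i 1) (axis j 1)" for a b i j
      using form[of a b i j] sum_frame4_last[of "dv a" P b i j]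
      unfolding P(2) hodge_frame3[OF P(1)] def_p column[OF p_lin(1)] column[OF p_lin(2)] column[OF p_lin(3)] V_axis E_axis
      by simp
    moreover have "?f X Y Z W = (\<Sum>i\<in>UNIV. \<Sum>j\<in>UNIV. \<Sum>k\<in>UNIV. \<Sum>l\<in>UNIV.
       X $ i * Y $ j * Z $ k * W $ l * ?f (axis i 1) (axis j 1) (axis k 1) (axis l 1))"
      by (rule quadrilinear_expand[of ?f]; intro linearI; simp add: lin)
    moreover have "?h X Y Z W = (\<Sum>i\<in>UNIV. \<Sum>j\<in>UNIV. \<Sum>k\<in>UNIV. \<Sum>l\<in>UNIV.
       X $ i * Y $ j * Z $ k * W $ l * ?h (axis i 1) (axis j 1) (axis k 1) (axis l 1))"
      by (rule quadrilinear_expand[of ?h]; intro linearI; simp add: lin algebra_simps)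
    ultimately show ?thesis by simp
  qed
  let ?r = "scale x"
  have r: "?r > 0" "?r ^ 3 = f" using scale(1)[OF x] scale(2)[OF x, unfolded fl(2)] unfolding f_def .
  \<comment> \<open>The factor r^2 turns the coefficients r and 1/r^2 of the deformed metric into f
    and 1.\<close>
  have metric': "?r^2 * g' x $ b $ c = f * ((P *v axis b 1) \<bullet> (P *v axis c 1)) - ((P *v axis b 1) \<bullet> u) * ((P *v axis c 1) \<bullet> u)" for b c
    unfolding metric_deformed[OF x] fl r(2)[symmetric] using r(1) by (simp add: field_simps eval_nat_numeral)
  have met: "2/3 * ((P *v (V *v X)) \<bullet> u) * ((P *v Y) \<bullet> (P *v Z)) + 4/3 * (((P *v (V *v X)) \<bullet> u) / f) * (u \<bullet> (P *v Y)) * (u \<bullet> (P *v Z))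
        - ((P *v (V *v X)) \<bullet> (P *v Y)) * (u \<bullet> (P *v Z)) - (u \<bullet> (P *v Y)) * ((P *v (V *v X)) \<bullet> (P *v Z)) =
      f * ((P *v E X Y) \<bullet> (P *v Z)) - (u \<bullet> (P *v E X Y)) * (u \<bullet> (P *v Z)) + f * ((P *v Y) \<bullet> (P *v E X Z)) - (u \<bullet> (P *v Y)) * (u \<bullet> (P *v E X Z))"
    (is "?f X Y Z = ?h X Y Z") for X Y Z
  proof -
    have "?f (axis a 1) (axis b 1) (axis c 1) = ?h (axis a 1) (axis b 1) (axis c 1)" for a b c
    proof -
      let ?e = "\<lambda>i. P *v axis i 1"
      define m where "m = (P *v dv a) \<bullet> u"
      define W where "W = (\<lambda>b. ?e b \<bullet> (P *v dv a))"
      have li: "linear (\<lambda>q. q \<bullet> z)" "linear (\<lambda>q. z \<bullet> q)" for z :: "real^7"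
        by (intro linearI; simp add: inner_lin)+
      have m: "(\<Sum>e\<in>UNIV. lower x e * dv a $ e) = m"
        unfolding fl m_def using coords[OF li(1), of "dv a" u] by (simp add: mult.commute)
      have W: "(\<Sum>c\<in>UNIV. g x $ b $ c * dv a $ c) = W b" for b
        unfolding fl W_def using coords[OF li(2), of "dv a" "?e b"] by (simp add: mult.commute)
      have lh: "linear (\<lambda>q. f * (q \<bullet> z) - (q \<bullet> u) * t)" for z t
        by (intro linearI; simp add: inner_lin algebra_simps)
      have Cg: "?r^2 * (\<Sum>e\<in>UNIV. C a $ e $ b * g' x $ e $ c) = f * ((P *v (C a *v axis b 1)) \<bullet> ?e c) - ((P *v (C a *v axis b 1)) \<bullet> u) * (?e c \<bullet> u)" for b c
        using column[OF lh, of "C a" b "?e c" "?e c \<bullet> u"]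
        by (simp add: sum_distrib_left mult.left_commute[of "?r^2"] metric')
      have "2/3 * m / ?r^2 * g x $ b $ c + 4/3 * m / ?r^5 * (lower x b * lower x c) - 1 / ?r^2 * (W b * lower x c + lower x b * W c)
        = (\<Sum>e\<in>UNIV. C a $ e $ b * g' x $ e $ c) + (\<Sum>e\<in>UNIV. C a $ e $ c * g' x $ b $ e)" (is "?K = ?D")
        using nabla_deformed_metric[OF x par dv, of a b c, unfolded m W] pm[of a b c]
        by (simp add: C_def left_diff_distrib sum_subtractf)
      then have "?r^2 * ?K = ?r^2 * ?D" by (rule arg_cong)
      also have "?r^2 * ?K = 2/3 * m * g x $ b $ c + 4/3 * (m / f) * (lower x b * lower x c) - (W b * lower x c + lower x b * W c)"
        unfolding r(2)[symmetric] using r(1) by (simp add: field_simps eval_nat_numeral)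
      finally show ?thesis
        unfolding ring_distribs(1)[of "?r^2"] Cg metric_sym'[OF x, of b] fl V_axis E_axis
        by (simp add: m_def W_def inner_commute algebra_simps)
    qed
    moreover have "?f X Y Z = (\<Sum>i\<in>UNIV. \<Sum>j\<in>UNIV. \<Sum>k\<in>UNIV. X $ i * Y $ j * Z $ k * ?f (axis i 1) (axis j 1) (axis k 1))"
      by (rule trilinear_expand[of ?f]; intro linearI; simp add: lin algebra_simps add_divide_distrib)
    moreover have "?h X Y Z = (\<Sum>i\<in>UNIV. \<Sum>j\<in>UNIV. \<Sum>k\<in>UNIV. X $ i * Y $ j * Z $ k * ?h (axis i 1) (axis j 1) (axis k 1))"
      by (rule trilinear_expand[of ?h]; intro linearI; simp add: lin algebra_simps)
    ultimately show ?thesis by simp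
  qed
  \<comment> \<open>Conjugation by \<open>P\<close> expresses the endomorphism \<open>V\<close> in
    the frame.\<close>
  have "P ** V ** R = 0"
  proof (rule torsion_kernel[of "\<lambda>x y. P *v E (R *v x) (R *v y)" "P ** V ** R" u])
    show "P *v E (R *v x) (R *v y) = P *v E (R *v y) (R *v x)" for x y
      by (subst E_sym) (rule refl)
    fix x y z w
    have A: "(P ** V ** R) *v x = P *v (V *v (R *v x))"
      by (simp only: matrix_vector_mul_assoc matrix_mul_assoc)
    show "psi0 y z w ((P ** V ** R) *v x) =
      (cross7 (P *v E (R *v x) (R *v y)) z \<bullet> w + psi0 (P *v E (R *v x) (R *v y)) z w u)
      + (cross7 y (P *v E (R *v x) (R *v z)) \<bullet> w + psi0 y (P *v E (R *v x) (R *v z)) w u)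
      + (cross7 y z \<bullet> (P *v E (R *v x) (R *v w)) + psi0 y z (P *v E (R *v x) (R *v w)) u)"
      using form'[of "R *v y" "R *v z" "R *v w" "R *v x"] unfolding A PR p_def .
    show "2/3 * (((P ** V ** R) *v x) \<bullet> u) * (y \<bullet> z) + 4/3 * ((((P ** V ** R) *v x) \<bullet> u) / (1 + u \<bullet> u)) * (u \<bullet> y) * (u \<bullet> z)
        - (((P ** V ** R) *v x) \<bullet> y) * (u \<bullet> z) - (u \<bullet> y) * (((P ** V ** R) *v x) \<bullet> z) =
      (1 + u \<bullet> u) * ((P *v E (R *v x) (R *v y)) \<bullet> z) - (u \<bullet> (P *v E (R *v x) (R *v y))) * (u \<bullet> z)
      + (1 + u \<bullet> u) * (y \<bullet> (P *v E (R *v x) (R *v z))) - (u \<bullet> y) * (u \<bullet> (P *v E (R *v x) (R *v z)))"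
      using met[of "R *v x" "R *v y" "R *v z"] unfolding A PR f_def .
  qed
  then have "P *v (V *v (R *v (P *v axis a 1))) = 0"
    by (simp only: matrix_vector_mul_assoc matrix_mul_assoc) simp
  then have "V *v axis a 1 = 0"
    unfolding PR by (rule invertible_kernel[OF P(1)])
  then show ?thesis by (simp add: V_axis dv_def vec_eq_iff)
qed

end
end

section \<open>The global statement\<close>

text \<open>The product with the first basis vector detects all components but the first, and the
  second basis vector detects that one.\<close>

lemma cross7_eq_0D: "(\<And>y. cross7 x y = 0) \<Longrightarrow> x = 0"
proof -
  assume H: "\<And>y. cross7 x y = 0"
  have "cross7 x (axis 1 1) $ i = 0" "cross7 x (axis 2 1) $ i = 0" for i by (simp_all add: H)
  from this[of 2] this[of 3] this[of 4] this[of 5] this[of 6] this[of 7]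
  show "x = 0"
    by (simp add: cross7_components axis_component vec_eq_iff forall_7)
qed

text \<open>A vector killed by \<open>M\<close> is annihilated by the form, and the nondegenerate
  frame \<open>Q\<close> then makes its image have zero product with everything. On overlaps this
  yields invertible frames from the transformation law alone, without differentiating the inverse
  transition map.\<close>

lemma invertible_frame:
  assumes Q: "invertible Q" and eq: "frame3 M = frame3 Q"
  shows "invertible M"
proof (rule invertible_if_kernel_trivial)
  fix u assume u: "M *v u = 0"
  have e: "(\<Sum>a\<in>UNIV. u $ a * frame3 N a b c) = cross7 (N *v u) (N *v axis b 1) \<bullet> (N *v axis c 1)" for N b c
  proof -
    have "linear (\<lambda>y. cross7 (N *v y) (N *v axis b 1) \<bullet> (N *v axis c 1))"
      by (intro linearI) (simp_all add: matrix_vector_right_distrib matrix_vector_mult_scaleR cross7_lin inner_lin)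
    from linear_expand[OF this, of u] show ?thesis by (simp add: frame3_def)
  qed
  have 0: "cross7 (Q *v u) (Q *v axis b 1) \<bullet> (Q *v axis c 1) = 0" for b c
    using e[of M b c] e[of Q b c] by (simp add: eq u cross7_lin)
  have 1: "cross7 (Q *v u) (Q *v y) \<bullet> (Q *v z) = 0" for y z
  proof -
    have lin: "linear (\<lambda>z. cross7 (Q *v u) (Q *v y) \<bullet> (Q *v z))" "linear (\<lambda>y. cross7 (Q *v u) (Q *v y) \<bullet> (Q *v z))" for y z
      by (intro linearI; simp add: matrix_vector_right_distrib matrix_vector_mult_scaleR cross7_lin inner_lin)+
    have "cross7 (Q *v u) (Q *v y) \<bullet> (Q *v axis c 1) = 0" for c
      by (subst linear_expand[OF lin(2)]) (simp add: 0)
    then show ?thesis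
      by (subst linear_expand[OF lin(1)]) simp
  qed
  obtain R where R: "Q ** R = mat 1" using Q by (auto simp: invertible_def)
  have "cross7 (Q *v u) y \<bullet> z = 0" for y z
    using 1[of "R *v y" "R *v z"] by (simp add: matrix_vector_mul_assoc R)
  then have "cross7 (Q *v u) y = 0" for y
    by (metis inner_eq_zero_iff)
  then have "Q *v u = 0" by (rule cross7_eq_0D)
  then show "u = 0" by (rule invertible_kernel[OF Q])
qed

lemma chart_overlap:
  assumes M: "smooth_manifold X A" and c: "c \<in> A" and d: "d \<in> A" and x: "x \<in> overlap c d"
  shows "x \<in> coords c" "transition c d x \<in> coords d"
proof -
  obtain q where q: "q \<in> fst c" "q \<in> fst d" "x = snd c q" using x by (auto simp: overlap_def)
  have "is_chart X c" using M c by (simp add: smooth_manifold_def)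
  then have "openin X (fst c)" "inj_on (snd c) (topspace (subtopology X (fst c)))"
    using homeomorphic_imp_injective_map unfolding is_chart_def by blast+
  then have "inj_on (snd c) (fst c)"
    by (simp add: openin_subset Int_absorb1)
  then show "x \<in> coords c" "transition c d x \<in> coords d"
    using q by (auto simp: coords_def transition_def)
qed

lemma open_coords: "smooth_manifold X A \<Longrightarrow> c \<in> A \<Longrightarrow> open (coords c)"
  by (simp add: smooth_manifold_def is_chart_def)

lemma torsion_free_G2_iff:
  "torsion_free_G2 A \<phi> \<longleftrightarrow> G2_structure A \<phi> \<and>
     (\<forall>c\<in>A. \<forall>x\<in>coords c. \<forall>a b i j. nabla_three (\<lambda>y. metric (\<phi> c y)) (\<phi> c) x a b i j = 0)"
proof -
  have "g2_metric \<phi> c = (\<lambda>y. metric (\<phi> c y))" for c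
    by (simp add: fun_eq_iff g2_metric_def)
  then show ?thesis by (simp add: torsion_free_G2_def full_torsion_def)
qed

theorem corollary22:
  fixes X :: "'a topology" and A :: "('a, 7) chart set"
    and \<phi> :: "('a, 7) field3" and v :: "('a, 7) vfield"
  assumes "smooth_manifold X A"
    and "torsion_free_G2 A \<phi>"
    and "vector_field A v"
  shows "deformation \<phi> v \<in> Lambda37 A \<phi> \<and>
    (torsion_free_G2 A (deformed \<phi> v) \<longleftrightarrow> parallel_vector A \<phi> v)"
proof -
  have G2: "G2_structure A \<phi>"
    and tf: "\<And>c x a b i j. c \<in> A \<Longrightarrow> x \<in> coords c \<Longrightarrow> nabla_three (\<lambda>y. metric (\<phi> c y)) (\<phi> c) x a b i j = 0"
    using assms(2) by (auto simp: torsion_free_G2_iff)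
  have chart: "g2_chart (coords c) (\<phi> c) (v c)" if "c \<in> A" for c
    using G2 that open_coords[OF assms(1) that] assms(3)
    by unfold_locales (auto simp: G2_structure_def three_form_def vector_field_def)
  have deformed: "deformed \<phi> v c = g2_chart.deformed_form (\<phi> c) (v c)" if "c \<in> A" for c
    by (simp add: fun_eq_iff deformed_def deformation_def psi_def g2_chart.deformed_form_def[OF chart[OF that]])
  \<comment> \<open>On an overlap the frame of one chart times the Jacobian is a frame of the other,
    so naturality of metric and dual handles every transformation law.\<close>
  have frames: "\<exists>P. invertible P \<and> invertible (P ** J) \<and> \<phi> d (transition c d x) = frame3 P \<and> \<phi> c x = frame3 (P ** J) \<and>
      (\<chi> i. v d (transition c d x) i) = J *v (\<chi> i. v c x i)"
    if cd: "c \<in> A" "d \<in> A" and x: "x \<in> overlap c d" and J: "J = jacobian (transition c d) (at x)" for c d x J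
  proof -
    note ov = chart_overlap[OF assms(1) cd x]
    obtain P where P: "invertible P" "\<phi> d (transition c d x) = frame3 P"
      using g2_chart.pos[OF chart[OF cd(2)] ov(2)] by (auto simp: positive3_iff)
    obtain Q where Q: "invertible Q" "\<phi> c x = frame3 Q"
      using g2_chart.pos[OF chart[OF cd(1)] ov(1)] by (auto simp: positive3_iff)
    have "\<phi> c x a b e = (\<Sum>i\<in>UNIV. \<Sum>j\<in>UNIV. \<Sum>k\<in>UNIV. J $ i $ a * J $ j $ b * J $ k $ e * frame3 P i j k)" for a b e
      using G2 cd x unfolding G2_structure_def three_form_def P(2)[symmetric] J by blast
    then have "\<phi> c x = frame3 (P ** J)" by (simp add: frame3_pull fun_eq_iff)
    moreover from this have "invertible (P ** J)"
      using invertible_frame[OF Q(1), of "P ** J"] Q(2) by simp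
    moreover have "(\<chi> i. v d (transition c d x) i) = J *v (\<chi> i. v c x i)"
      using assms(3) cd x unfolding vector_field_def J by (simp add: vec_eq_iff matrix_vector_mult_def)
    ultimately show ?thesis using P by blast
  qed
  \<comment> \<open>The one-form is minus the metric dual of \<open>v\<close>:
    \<open>Lambda37\<close> contracts the first slot of the dual form, the deformation the
    last.\<close>
  have "one_form A (\<lambda>c x a. - g2_chart.lower (\<phi> c) (v c) x a)"
    unfolding one_form_def
  proof (intro conjI ballI allI)
    fix c a assume c: "c \<in> A"
    interpret g2_chart "coords c" "\<phi> c" "v c" by (rule chart[OF c])
    show "smooth_on (coords c) (\<lambda>x. - lower x a)"
      by (rule uminus[OF smooth_lower])
  next
    fix c d x a assume cd: "c \<in> A" "d \<in> A" and x: "x \<in> overlap c d"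
    define J where "J = jacobian (transition c d) (at x)"
    obtain P where P: "invertible P" "invertible (P ** J)" "\<phi> d (transition c d x) = frame3 P" "\<phi> c x = frame3 (P ** J)"
      "(\<chi> i. v d (transition c d x) i) = J *v (\<chi> i. v c x i)"
      using frames[OF cd x J_def] by blast
    have "linear (\<lambda>y. (P *v y) \<bullet> q)" for q
      by (intro linearI) (simp_all add: matrix_vector_right_distrib matrix_vector_mult_scaleR inner_lin)
    from linear_expand[OF this, of "J *v axis a 1"]
    show "- g2_chart.lower (\<phi> c) (v c) x a =
      (\<Sum>i\<in>UNIV. jacobian (transition c d) (at x) $ i $ a * - g2_chart.lower (\<phi> d) (v d) (transition c d x) i)"
      unfolding g2_chart.frame_lower(1)[OF chart[OF cd(1)] P(4,2)] g2_chart.frame_lower(1)[OF chart[OF cd(2)] P(3,1)] P(5)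
      by (simp add: frame_nth J_def matrix_vector_mul_assoc[symmetric] sum_negf)
  qed
  moreover have "deformation \<phi> v c x b i j =
      (\<Sum>e\<in>UNIV. (\<Sum>f\<in>UNIV. matrix_inv (g2_metric \<phi> c x) $ e $ f * - g2_chart.lower (\<phi> c) (v c) x f) * psi \<phi> c x e b i j)"
    if c: "c \<in> A" and x: "x \<in> coords c" for c x b i j
  proof -
    interpret g2_chart "coords c" "\<phi> c" "v c" by (rule chart[OF c])
    obtain P where P: "invertible P" "\<phi> c x = frame3 P" using pos[OF x] by (auto simp: positive3_iff)
    let ?g = "metric (\<phi> c x)"
    have "(\<Sum>f\<in>UNIV. matrix_inv ?g $ e $ f * - lower x f) = - v c x e" for e
    proof -
      have "(\<Sum>f\<in>UNIV. matrix_inv ?g $ e $ f * lower x f) = (matrix_inv ?g *v (?g *v (\<chi> c'. v c x c'))) $ e"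
        by (simp add: lower_def matrix_vector_mult_def)
      also have "\<dots> = v c x e"
        using matrix_inv_inverse[OF induces_wedge_matrix(4)[OF positive3_induces[OF pos[OF x]]]]
        by (simp add: matrix_vector_mul_assoc)
      finally show ?thesis by (simp add: sum_negf)
    qed
    moreover have "hodge (\<phi> c x) b i j e = - hodge (\<phi> c x) e b i j" for e
      unfolding P(2) hodge_frame3[OF P(1)] frame4_def by (rule psi0_rotate)
    ultimately show ?thesis
      by (simp add: deformation_def psi_def g2_metric_def)
  qed
  ultimately have "deformation \<phi> v \<in> Lambda37 A \<phi>"
    unfolding Lambda37_def by blast
  moreover have "G2_structure A (deformed \<phi> v)"
    unfolding G2_structure_def three_form_def
  proof (intro conjI ballI allI)
    fix c a b e assume c: "c \<in> A"
    interpret g2_chart "coords c" "\<phi> c" "v c" by (rule chart[OF c])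
    show "smooth_on (coords c) (\<lambda>x. deformed \<phi> v c x a b e)"
      unfolding deformed[OF c] by (rule smooth_deformed)
    fix x assume x: "x \<in> coords c"
    show pos': "positive3 (deformed \<phi> v c x)"
      unfolding deformed[OF c] by (rule positive_deformed[OF x])
    \<comment> \<open>Being positive, the deformed form is a pullback of \<open>phi0\<close>, and
      this makes it alternating.\<close>
    then obtain Q where "deformed \<phi> v c x = frame3 Q" by (auto simp: positive3_iff)
    then have "deformed \<phi> v c x = (\<lambda>i j k. cross7 (Q *v axis i 1) (Q *v axis j 1) \<bullet> (Q *v axis k 1))"
      by (simp add: fun_eq_iff frame3_def)
    then show "deformed \<phi> v c x b a e = - deformed \<phi> v c x a b e" "deformed \<phi> v c x a e b = - deformed \<phi> v c x a b e"
      by (simp_all only: cross7_inner_swap(1)[of "Q *v axis b 1"] cross7_inner_swap(2)[of "Q *v axis a 1" "Q *v axis e 1"])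
  next
    fix c d x a b e assume cd: "c \<in> A" "d \<in> A" and x: "x \<in> overlap c d"
    define J where "J = jacobian (transition c d) (at x)"
    obtain P where P: "invertible P" "invertible (P ** J)" "\<phi> d (transition c d x) = frame3 P" "\<phi> c x = frame3 (P ** J)"
      "(\<chi> i. v d (transition c d x) i) = J *v (\<chi> i. v c x i)"
      using frames[OF cd x J_def] by blast
    define q where "q = P *v (J *v (\<chi> i. v c x i))"
    \<comment> \<open>The components in both charts are values of this single trilinear map, so the
      transformation law is its expansion in coordinates.\<close>
    define F where "F = (\<lambda>y z w. cross7 (P *v y) (P *v z) \<bullet> (P *v w) + psi0 (P *v y) (P *v z) (P *v w) q)"
    have F: "F (J *v axis a 1) (J *v axis b 1) (J *v axis e 1) = (\<Sum>i\<in>UNIV. \<Sum>j\<in>UNIV. \<Sum>k\<in>UNIV.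
       (J *v axis a 1) $ i * (J *v axis b 1) $ j * (J *v axis e 1) $ k * F (axis i 1) (axis j 1) (axis k 1))"
      by (rule trilinear_expand; intro linearI;
          simp add: F_def matrix_vector_right_distrib matrix_vector_mult_scaleR cross7_lin inner_lin psi0_add psi0_scale algebra_simps)
    have 1: "deformed \<phi> v c x a b e = F (J *v axis a 1) (J *v axis b 1) (J *v axis e 1)"
      using sum_frame4_last[of "\<chi> i. v c x i" "P ** J" a b e]
      by (simp add: deformed_def deformation_def psi_def P(4) hodge_frame3[OF P(2)] F_def frame3_def q_def matrix_vector_mul_assoc)
    have 2: "deformed \<phi> v d (transition c d x) i j k = F (axis i 1) (axis j 1) (axis k 1)" for i j k
      using sum_frame4_last[of "\<chi> i. v d (transition c d x) i" P i j k, unfolded vec_lambda_beta, unfolded P(5)]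
      by (simp add: deformed_def deformation_def psi_def P(3) hodge_frame3[OF P(1)] F_def frame3_def q_def)
    show "deformed \<phi> v c x a b e = (\<Sum>i\<in>UNIV. \<Sum>j\<in>UNIV. \<Sum>k\<in>UNIV.
             jacobian (transition c d) (at x) $ i $ a * jacobian (transition c d) (at x) $ j $ b *
             jacobian (transition c d) (at x) $ k $ e * deformed \<phi> v d (transition c d x) i j k)"
      unfolding 1 2 F by (simp add: frame_nth J_def)
  qed
  moreover have "(\<forall>a b i j. nabla_three (\<lambda>y. metric (deformed \<phi> v c y)) (deformed \<phi> v c) x a b i j = 0) \<longleftrightarrow>
      (\<forall>a b. nabla_vector (g2_metric \<phi> c) (v c) x a b = 0)" if c: "c \<in> A" and x: "x \<in> coords c" for c x
  proof -
    interpret g2_chart "coords c" "\<phi> c" "v c" by (rule chart[OF c])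
    have "g2_metric \<phi> c = (\<lambda>y. metric (\<phi> c y))" by (simp add: fun_eq_iff g2_metric_def)
    then show ?thesis
      unfolding deformed[OF c]
      using torsion_free_if_parallel[OF x tf[OF c x]] parallel_if_torsion_free[OF x tf[OF c x]] by metis
  qed
  ultimately show ?thesis
    unfolding torsion_free_G2_iff parallel_vector_def by blast
qed

end
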